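(* Consider a sequence of finite populations, indexed by the total sample size $n\to\infty$, each satisfying the null hypothesis $H_0:\ T_i(1)=T_i(0)$ for all $i$, with units partitioned into $S$ strata. Condition on all potential event times. Suppose (a) the triples $(Z_i,C_i(1),C_i(0))$ are mutually independent across all units; (b) within each stratum $s$, Assumption 1 and Assumption 2 hold for the units of that stratum (with stratum-specific treatment probability and stratum-specific censoring distribution); and (c) Condition 3 holds. Then the stratified logrank statistic satisfies $\mathrm{SLR}\mid\boldsymbol{T}(1),\boldsymbol{T}(0)\xrightarrow{d}\mathcal{N}(0,1)$.
   Context: Unit $i$ has potential event times $T_i(1),T_i(0)\ge 0$ (fixed constants), potential censoring times $C_i(1),C_i(0)\in[0,\infty]$, treatment indicator $Z_i\in\{0,1\}$. For a set of units, Assumption 1 means: conditional on all potential event and censoring times, the $Z_i$ of these units are i.i.d. Bernoulli$(p_1)$, $p_1=1-p_0\in(0,1)$; Assumption 2 means: the potential censoring times of these units are independent of all potential event times and the pairs $(C_i(1),C_i(0))$ are i.i.d. across these units. Realized: $W_i=\min\{T_i,C_i\}$, $\Delta_i=\mathbb{1}(T_i\le C_i)$ with $T_i=Z_iT_i(1)+(1-Z_i)T_i(0)$, $C_i=Z_iC_i(1)+(1-Z_i)C_i(0)$. For a given set of units (a stratum) with $m$ units: let $t_1<\dots<t_K$ be the distinct values of $T_i(0)$ among them, $d_k,n_k$ the numbers of them with $T_i(0)=t_k$ and $T_i(0)\ge t_k$, $h_k=d_k/n_k$; $N_{1k},N_{0k},N_k$ the numbers of treated, control, and all units in the set with $W_i\ge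 t_k$; $D_{1k},D_k$ the numbers of treated and all units in the set with $\Delta_i\mathbb{1}(W_i=t_k)=1$; $M_k=D_kN_{1k}/N_k$, $V_k=D_k(N_k-D_k)N_{1k}N_{0k}/\{N_k^2(N_k-1)\}$ (convention $0/0:=0$); $L=\sum_k(D_{1k}-M_k)$, $U=\sum_kV_k$. Denote by $L_{[s]},U_{[s]}$ these quantities computed on stratum $s$, and $\mathrm{SLR}=(\sum_{s=1}^SU_{[s]})^{-1/2}\sum_{s=1}^SL_{[s]}$. For a stratum with $m$ units, treatment probability $p_z$ and censoring survival functions $G_z(c)=\Pr(C_i(z)\ge c)$: Condition 1 is: as $m\to\infty$, $p_z$ has a positive limit for $z=0,1$, and $\min\{(\tilde g/\tilde d)(m/\log m)^{1/2},\tilde g m/\tilde d^3\}\to\infty$, where $\tilde d=\max_kd_k$ and $\tilde g=m^{-1}\sum_i G_1(T_i(0))G_0(T_i(0))$ (sum over units of the stratum); Condition 2 is: $K$ fixed, and for $z=0,1$, $1\le k\le K$, $p_z$ has a positive limit, $d_k/m$ and $G_z(t_k)$ have limits, and for at least one $k$, $d_k/m,G_1(t_k),G_0(t_k)$ have positive limits and $\lim h_k<1$. Condition 3: as $n\to\infty$, $S$ is fixed and for each stratum $s$, (i) the number of units in stratum $s$ tends to infinity, and (ii) Condition 1 or Condition 2 holds for the units within stratum $s$. *)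

theory Defs
  imports "HOL-Probability.Probability"
begin

text \<open>A stratum is a finite set J of unit indices; T0 gives the potential control
event times T_i(0); Z the treatment indicators; W the observed times
W_i = min(T_i, C_i) (values in [0,infinity]); Dl the event indicators Delta_i.\<close>

definition evt_time :: "nat set \<Rightarrow> (nat \<Rightarrow> real) \<Rightarrow> nat \<Rightarrow> real" where
  "evt_time J T0 k = sorted_list_of_set (T0 ` J) ! k"   (* t_{k+1}, k = 0..K-1 *)

definition nK :: "nat set \<Rightarrow> (nat \<Rightarrow> real) \<Rightarrow> nat" where
  "nK J T0 = card (T0 ` J)"

definition dk :: "nat set \<Rightarrow> (nat \<Rightarrow> real) \<Rightarrow> nat \<Rightarrow> nat" where
  "dk J T0 k = card {i \<in> J. T0 i = evt_time J T0 k}"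

definition nk :: "nat set \<Rightarrow> (nat \<Rightarrow> real) \<Rightarrow> nat \<Rightarrow> nat" where
  "nk J T0 k = card {i \<in> J. evt_time J T0 k \<le> T0 i}"

definition hk :: "nat set \<Rightarrow> (nat \<Rightarrow> real) \<Rightarrow> nat \<Rightarrow> real" where
  "hk J T0 k = real (dk J T0 k) / real (nk J T0 k)"

definition N1k :: "nat set \<Rightarrow> (nat \<Rightarrow> real) \<Rightarrow> (nat \<Rightarrow> bool) \<Rightarrow> (nat \<Rightarrow> ennreal) \<Rightarrow> nat \<Rightarrow> nat" where
  "N1k J T0 Z W k = card {i \<in> J. Z i \<and> ennreal (evt_time J T0 k) \<le> W i}"

definition N0k :: "nat set \<Rightarrow> (nat \<Rightarrow> real) \<Rightarrow> (nat \<Rightarrow> bool) \<Rightarrow> (nat \<Rightarrow> ennreal) \<Rightarrow> nat \<Rightarrow> nat" where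
  "N0k J T0 Z W k = card {i \<in> J. \<not> Z i \<and> ennreal (evt_time J T0 k) \<le> W i}"

definition Nk :: "nat set \<Rightarrow> (nat \<Rightarrow> real) \<Rightarrow> (nat \<Rightarrow> ennreal) \<Rightarrow> nat \<Rightarrow> nat" where
  "Nk J T0 W k = card {i \<in> J. ennreal (evt_time J T0 k) \<le> W i}"

definition D1k :: "nat set \<Rightarrow> (nat \<Rightarrow> real) \<Rightarrow> (nat \<Rightarrow> bool) \<Rightarrow> (nat \<Rightarrow> ennreal) \<Rightarrow> (nat \<Rightarrow> bool) \<Rightarrow> nat \<Rightarrow> nat" where
  "D1k J T0 Z W Dl k = card {i \<in> J. Z i \<and> Dl i \<and> W i = ennreal (evt_time J T0 k)}"

definition Dk :: "nat set \<Rightarrow> (nat \<Rightarrow> real) \<Rightarrow> (nat \<Rightarrow> ennreal) \<Rightarrow> (nat \<Rightarrow> bool) \<Rightarrow> nat \<Rightarrow> nat" where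
  "Dk J T0 W Dl k = card {i \<in> J. Dl i \<and> W i = ennreal (evt_time J T0 k)}"

text \<open>Real division in Isabelle satisfies x / 0 = 0, which realises the convention 0/0 := 0.\<close>

definition Mk :: "nat set \<Rightarrow> (nat \<Rightarrow> real) \<Rightarrow> (nat \<Rightarrow> bool) \<Rightarrow> (nat \<Rightarrow> ennreal) \<Rightarrow> (nat \<Rightarrow> bool) \<Rightarrow> nat \<Rightarrow> real" where
  "Mk J T0 Z W Dl k = real (Dk J T0 W Dl k) * real (N1k J T0 Z W k) / real (Nk J T0 W k)"

definition Vk :: "nat set \<Rightarrow> (nat \<Rightarrow> real) \<Rightarrow> (nat \<Rightarrow> bool) \<Rightarrow> (nat \<Rightarrow> ennreal) \<Rightarrow> (nat \<Rightarrow> bool) \<Rightarrow> nat \<Rightarrow> real" where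
  "Vk J T0 Z W Dl k =
     (let D = real (Dk J T0 W Dl k); N = real (Nk J T0 W k);
          N1 = real (N1k J T0 Z W k); N0 = real (N0k J T0 Z W k)
      in D * (N - D) * N1 * N0 / (N\<^sup>2 * (N - 1)))"

definition lr_L :: "nat set \<Rightarrow> (nat \<Rightarrow> real) \<Rightarrow> (nat \<Rightarrow> bool) \<Rightarrow> (nat \<Rightarrow> ennreal) \<Rightarrow> (nat \<Rightarrow> bool) \<Rightarrow> real" where
  "lr_L J T0 Z W Dl = (\<Sum>k<nK J T0. real (D1k J T0 Z W Dl k) - Mk J T0 Z W Dl k)"

definition lr_U :: "nat set \<Rightarrow> (nat \<Rightarrow> real) \<Rightarrow> (nat \<Rightarrow> bool) \<Rightarrow> (nat \<Rightarrow> ennreal) \<Rightarrow> (nat \<Rightarrow> bool) \<Rightarrow> real" where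
  "lr_U J T0 Z W Dl = (\<Sum>k<nK J T0. Vk J T0 Z W Dl k)"

definition obs_W :: "real \<Rightarrow> real \<Rightarrow> bool \<Rightarrow> ennreal \<Rightarrow> ennreal \<Rightarrow> ennreal" where
  "obs_W t1 t0 z c1 c0 = min (ennreal (if z then t1 else t0)) (if z then c1 else c0)"

definition obs_Delta :: "real \<Rightarrow> real \<Rightarrow> bool \<Rightarrow> ennreal \<Rightarrow> ennreal \<Rightarrow> bool" where
  "obs_Delta t1 t0 z c1 c0 = (ennreal (if z then t1 else t0) \<le> (if z then c1 else c0))"

text \<open>p: treatment probability p_1 (p_0 = 1 - p); m: stratum size; the units of the
stratum at index n are 0..m n - 1; T0 n: their control event times;
G1 n, G0 n: censoring survival functions G_z(c) = Pr(C_i(z) >= c).\<close>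

definition cond1 :: "(nat \<Rightarrow> real) \<Rightarrow> (nat \<Rightarrow> nat) \<Rightarrow> (nat \<Rightarrow> nat \<Rightarrow> real)
    \<Rightarrow> (nat \<Rightarrow> real \<Rightarrow> real) \<Rightarrow> (nat \<Rightarrow> real \<Rightarrow> real) \<Rightarrow> bool" where
  "cond1 p m T0 G1 G0 \<longleftrightarrow>
     (\<exists>l>0. p \<longlonglongrightarrow> l) \<and> (\<exists>l>0. (\<lambda>n. 1 - p n) \<longlonglongrightarrow> l) \<and>
     filterlim (\<lambda>n.
        let J = {..<m n};
            dt = real (Max ((\<lambda>k. dk J (T0 n) k) ` {..<nK J (T0 n)}));
            gt = (\<Sum>j\<in>J. G1 n (T0 n j) * G0 n (T0 n j)) / real (m n)
        in min ((gt / dt) * sqrt (real (m n) / ln (real (m n)))) (gt * real (m n) / dt ^ 3))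
       at_top sequentially"

definition cond2 :: "(nat \<Rightarrow> real) \<Rightarrow> (nat \<Rightarrow> nat) \<Rightarrow> (nat \<Rightarrow> nat \<Rightarrow> real)
    \<Rightarrow> (nat \<Rightarrow> real \<Rightarrow> real) \<Rightarrow> (nat \<Rightarrow> real \<Rightarrow> real) \<Rightarrow> bool" where
  "cond2 p m T0 G1 G0 \<longleftrightarrow>
     (\<exists>K. (\<forall>\<^sub>F n in sequentially. nK {..<m n} (T0 n) = K) \<and>
       (\<exists>l>0. p \<longlonglongrightarrow> l) \<and> (\<exists>l>0. (\<lambda>n. 1 - p n) \<longlonglongrightarrow> l) \<and>
       (\<forall>k<K. convergent (\<lambda>n. real (dk {..<m n} (T0 n) k) / real (m n)) \<and>
               convergent (\<lambda>n. G1 n (evt_time {..<m n} (T0 n) k)) \<and>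
               convergent (\<lambda>n. G0 n (evt_time {..<m n} (T0 n) k))) \<and>
       (\<exists>k<K. \<exists>a b c e.
          (\<lambda>n. real (dk {..<m n} (T0 n) k) / real (m n)) \<longlonglongrightarrow> a \<and> a > 0 \<and>
          (\<lambda>n. G1 n (evt_time {..<m n} (T0 n) k)) \<longlonglongrightarrow> b \<and> b > 0 \<and>
          (\<lambda>n. G0 n (evt_time {..<m n} (T0 n) k)) \<longlonglongrightarrow> c \<and> c > 0 \<and>
          (\<lambda>n. hk {..<m n} (T0 n) k) \<longlonglongrightarrow> e \<and> e < 1))"

end

theory Submission
  imports Defs "HOL-Combinatorics.Permutations" "HOL-Real_Asymp.Real_Asymp"
begin

text \<open>
  Fix a stratum. Let \<open>\<pi>\<^sub>k\<close> be the probability that a unit is uncensored at the \<open>k\<close>-th event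
  time, \<open>\<phi>\<^sub>k\<close> the conditional probability that such a unit is treated, and
  \<open>u\<^sub>i\<^sub>k = A\<^sub>i\<^sub>k (Z\<^sub>i - \<phi>\<^sub>k)\<close> with \<open>A\<^sub>i\<^sub>k\<close> the indicator that unit \<open>i\<close> is uncensored at that time.
  Then \<open>L\<close> is a sum of independent centred variables
  \<open>\<xi>\<^sub>i = \<Sum>\<^sub>k u\<^sub>i\<^sub>k (1(T\<^sub>i = t\<^sub>k) - h\<^sub>k)\<close>, the sum being over \<open>t\<^sub>k \<le> T\<^sub>i\<close>, minus the remainder
  \<open>\<Sum>\<^sub>k (D\<^sub>k / N\<^sub>k - h\<^sub>k) (N\<^sub>1\<^sub>k - \<phi>\<^sub>k N\<^sub>k)\<close>. Exchangeability of the units still at risk makes the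
  summands of the remainder orthogonal, so that its second moment is at most \<open>\<Sum>\<^sub>k h\<^sub>k\<close>. The variance
  of \<open>\<Sum>\<^sub>i \<xi>\<^sub>i\<close> is exactly \<open>\<sigma>\<^sup>2 = \<Sum>\<^sub>k d\<^sub>k (1 - h\<^sub>k) \<pi>\<^sub>k \<phi>\<^sub>k (1 - \<phi>\<^sub>k)\<close>, and \<open>U\<close> differs from \<open>\<sigma>\<^sup>2\<close> by
  \<open>O(\<surd>m + \<sigma>)\<close> in mean. Since moreover \<open>|\<xi>\<^sub>i| \<le> 2 + ln m\<close>, everything follows from
  \<open>\<sigma>\<^sup>2 / \<surd>m \<rightarrow> \<infinity>\<close>, which each of the two conditions implies: the remainder is negligible,
  \<open>U / \<sigma>\<^sup>2 \<rightarrow> 1\<close>, and a Lyapunov type estimate of characteristic functions gives the limit. Strata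
  are treated together, as one sum of independent variables.
\<close>

section \<open>Finite products of finitely supported distributions\<close>

locale finite_product =
  fixes I :: "'i set" and dflt :: 'x and p :: "'i \<Rightarrow> 'x pmf"
  assumes finite_I: "finite I"
    and finite_supp: "i \<in> I \<Longrightarrow> finite (set_pmf (p i))"
begin

definition E :: "(('i \<Rightarrow> 'x) \<Rightarrow> real) \<Rightarrow> real" where
  "E f = measure_pmf.expectation (Pi_pmf I dflt p) f"

lemma finite_set_Pi_pmf: "finite (set_pmf (Pi_pmf I dflt p))"
  using finite_I finite_supp by (auto simp: set_Pi_pmf)

lemma integrable_Pi_pmf:
  "integrable (measure_pmf (Pi_pmf I dflt p)) (f :: ('i \<Rightarrow> 'x) \<Rightarrow> 'c::{banach,
      second_countable_topology})"
  by (rule integrable_measure_pmf_finite[OF finite_set_Pi_pmf])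

lemma E_add: "E (\<lambda>x. f x + g x) = E f + E g"
  unfolding E_def by (simp add: integrable_Pi_pmf)

lemma E_diff: "E (\<lambda>x. f x - g x) = E f - E g"
  unfolding E_def by (simp add: integrable_Pi_pmf)

lemma E_cmult: "E (\<lambda>x. c * f x) = c * E f"
  unfolding E_def by simp

lemma E_sum: "E (\<lambda>x. \<Sum>k\<in>A. f k x) = (\<Sum>k\<in>A. E (f k))"
  unfolding E_def by (simp add: integrable_Pi_pmf)

lemma E_const: "E (\<lambda>x. c) = c"
  unfolding E_def by simp

lemma E_mono: "(\<And>x. f x \<le> g x) \<Longrightarrow> E f \<le> E g"
  unfolding E_def by (intro integral_mono integrable_Pi_pmf) auto

lemma E_nonneg: "(\<And>x. 0 \<le> f x) \<Longrightarrow> 0 \<le> E f"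
  unfolding E_def by simp

lemma E_abs_le_sqrt: "E (\<lambda>x. \<bar>f x\<bar>) \<le> sqrt (E (\<lambda>x. (f x)\<^sup>2))"
proof -
  have "(E (\<lambda>x. \<bar>f x\<bar>))\<^sup>2 \<le> E (\<lambda>x. (f x)\<^sup>2)"
  proof -
    define c where "c = E (\<lambda>x. \<bar>f x\<bar>)"
    have "0 \<le> E (\<lambda>x. (\<bar>f x\<bar> - c)\<^sup>2)" by (rule E_nonneg) simp
    also have "(\<lambda>x. (\<bar>f x\<bar> - c)\<^sup>2) = (\<lambda>x. ((f x)\<^sup>2 - (2 * c) * \<bar>f x\<bar>) + c\<^sup>2)"
      by (auto simp: power2_diff)
    also have "E \<dots> = E (\<lambda>x. (f x)\<^sup>2) - (2 * c) * c + c\<^sup>2"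
      by (simp add: E_add E_diff E_cmult E_const c_def)
    finally show ?thesis by (simp add: c_def[symmetric] power2_eq_square)
  qed
  then show ?thesis by (simp add: real_le_rsqrt)
qed

lemma E_indep:
  assumes i: "i \<in> I" and g: "\<And>x v. g (x(i := v)) = g x"
  shows "E (\<lambda>x. f (x i) * g x) = measure_pmf.expectation (p i) f * E g"
proof -
  define A where "A = I - {i}"
  have I: "I = insert i A" "i \<notin> A" "finite A" using i finite_I by (auto simp: A_def)
  have fin: "finite (set_pmf (Pi_pmf A dflt p))"
    using finite_I finite_supp by (auto simp: set_Pi_pmf A_def)
  have fini: "finite (set_pmf (p i))" using i finite_supp by simp
  have *: "E h = (\<Sum>a\<in>set_pmf (p i). \<Sum>y\<in>set_pmf (Pi_pmf A dflt p). h (y(i := a)) * (pmf (p i) a *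
      pmf (Pi_pmf A dflt p) y))" for h
  proof -
    have "E h = measure_pmf.expectation (pair_pmf (p i) (Pi_pmf A dflt p)) (\<lambda>z. h ((snd z)(i :=
        fst z)))"
      unfolding E_def Pi_pmf_insert[OF I(3,2), of dflt p, folded I(1)]
          by (simp add: case_prod_beta')
    also have "\<dots> = (\<Sum>z\<in>set_pmf (p i) \<times> set_pmf (Pi_pmf A dflt p). h ((snd z)(i := fst z)) * pmf
        (pair_pmf (p i) (Pi_pmf A dflt p)) z)"
      by (subst integral_measure_pmf_real) (use fin fini in auto)
    finally show ?thesis by (simp add: sum.cartesian_product case_prod_beta' pmf_pair[symmetric])
  qed
  have fi: "measure_pmf.expectation (p i) f = (\<Sum>a\<in>set_pmf (p i). f a * pmf (p i) a)"
    by (subst integral_measure_pmf_real) (use fini in auto)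
  have one: "(\<Sum>a\<in>set_pmf (p i). pmf (p i) a) = 1"
    by (rule sum_pmf_eq_1[OF fini]) simp
  let ?G = "\<Sum>y\<in>set_pmf (Pi_pmf A dflt p). g y * pmf (Pi_pmf A dflt p) y"
  have "E g = (\<Sum>a\<in>set_pmf (p i). pmf (p i) a * ?G)"
    unfolding * by (simp add: g sum_distrib_left mult_ac)
  also have "\<dots> = ?G" by (simp add: sum_distrib_right[symmetric] one)
  finally have G: "E g = ?G" .
  show ?thesis unfolding G fi
    by (subst *) (simp add: g sum_distrib_left sum_distrib_right mult_ac, rule sum.swap)
qed

lemma E_component:
  assumes "i \<in> I"
  shows "E (\<lambda>x. f (x i)) = measure_pmf.expectation (p i) f"
  using E_indep[OF assms, of "\<lambda>_. 1" f] by (simp add: E_const)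

lemma E_swap:
  assumes ij: "i \<in> I" "j \<in> I" "p i = p j"
  shows "E (\<lambda>x. f (x \<circ> Transposition.transpose i j)) = E f"
proof -
  let ?t = "Transposition.transpose i j"
  have t: "?t permutes I" using ij by (intro permutes_swap_id)
  have pt: "p (?t k) = p k" for k using ij by (auto simp: Transposition.transpose_def)
  have "map_pmf (\<lambda>x. x \<circ> ?t) (Pi_pmf I dflt p) = Pi_pmf I dflt p"
  proof (rule pmf_eqI)
    fix x
    have "pmf (map_pmf (\<lambda>x. x \<circ> ?t) (Pi_pmf I dflt p)) ((x \<circ> ?t) \<circ> ?t)
        = pmf (Pi_pmf I dflt p) (x \<circ> ?t)"
      by (rule pmf_map_inj', rule injI) (metis comp_assoc comp_id transpose_comp_involutory)
    then have "pmf (map_pmf (\<lambda>x. x \<circ> ?t) (Pi_pmf I dflt p)) x = pmf (Pi_pmf I dflt p) (x \<circ> ?t)"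
      by (simp add: comp_assoc)
    also have "\<dots> = pmf (Pi_pmf I dflt p) x"
    proof -
      have "(\<forall>k. k \<notin> I \<longrightarrow> (x \<circ> ?t) k = dflt) = (\<forall>k. k \<notin> I \<longrightarrow> x k = dflt)"
        using ij by (auto simp: Transposition.transpose_def)
      moreover have "(\<Prod>k\<in>I. pmf (p k) ((x \<circ> ?t) k)) = (\<Prod>k\<in>I. pmf (p k) (x k))"
        using prod.permute[OF t, of "\<lambda>k. pmf (p k) (x k)"] by (simp add: o_def pt)
      ultimately show ?thesis by (simp only: pmf_Pi[OF finite_I])
    qed
    finally show "pmf (map_pmf (\<lambda>x. x \<circ> ?t) (Pi_pmf I dflt p)) x = pmf (Pi_pmf I dflt p) x" .
  qed
  then show ?thesis
    unfolding E_def integral_map_pmf[symmetric, where g = "\<lambda>x. x \<circ> ?t"] by simp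
qed

definition symmetric_on :: "'i set \<Rightarrow> (('i \<Rightarrow> 'x) \<Rightarrow> real) \<Rightarrow> bool" where
  "symmetric_on B F \<longleftrightarrow> (\<forall>i\<in>B. \<forall>j\<in>B. \<forall>x. F (x \<circ> Transposition.transpose i j) = F x)"

lemma symmetric_onD: "symmetric_on B F \<Longrightarrow> i \<in> B \<Longrightarrow> j \<in> B \<Longrightarrow> F (x \<circ> Transposition.transpose i j) = F x"
  unfolding symmetric_on_def by blast

lemma symmetric_on_sum:
  assumes "B \<subseteq> A" shows "symmetric_on B (\<lambda>x. \<Sum>i\<in>A. f (x i))"
  unfolding symmetric_on_def
proof (intro ballI allI)
  fix i j x assume "i \<in> B" "j \<in> B"
  then have "Transposition.transpose i j permutes A" using assms by (intro permutes_swap_id) auto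
  from sum.permute[OF this, of "\<lambda>i. f (x i)"]
  show "(\<Sum>k\<in>A. f ((x \<circ> Transposition.transpose i j) k)) = (\<Sum>k\<in>A. f (x k))" by (simp add: o_def)
qed

lemma symmetric_on_sum_disjoint:
  assumes "B \<inter> A = {}" shows "symmetric_on B (\<lambda>x. \<Sum>i\<in>A. f (x i))"
  unfolding symmetric_on_def
proof (intro ballI allI sum.cong refl)
  fix i j x k assume "i \<in> B" "j \<in> B" "k \<in> A"
  then have "Transposition.transpose i j k = k" using assms
      by (auto simp: Transposition.transpose_def)
  then show "f ((x \<circ> Transposition.transpose i j) k) = f (x k)" by simp
qed

text \<open>Exchanging two equally distributed units on which \<open>F\<close> is symmetric shows that
  \<open>E (f (x i) * F x)\<close> does not depend on the unit \<open>i\<close>.\<close>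

lemma E_symmetric:
  assumes B: "B \<subseteq> I" "finite B" "\<And>i j. i \<in> B \<Longrightarrow> j \<in> B \<Longrightarrow> p i = p j"
    and F: "symmetric_on B F" and A: "A \<subseteq> B" "B \<noteq> {}"
  shows "E (\<lambda>x. (\<Sum>i\<in>A. f (x i)) * F x) = real (card A) / real (card B) * E (\<lambda>x. (\<Sum>i\<in>B. f (x i)) *
      F x)"
proof -
  obtain b where b: "b \<in> B" using A by auto
  have e: "E (\<lambda>x. f (x i) * F x) = E (\<lambda>x. f (x b) * F x)" if "i \<in> B" for i
  proof -
    have "E (\<lambda>x. f (x b) * F x) = E (\<lambda>x. (\<lambda>x. f (x b) * F x) (x \<circ> Transposition.transpose i b))"
      by (rule E_swap[of i b "\<lambda>x. f (x b) * F x", symmetric]) (use B b that in blast)+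
    also have "\<dots> = E (\<lambda>x. f (x i) * F x)"
      using symmetric_onD[OF F that b] by simp
    finally show ?thesis by simp
  qed
  have s: "E (\<lambda>x. (\<Sum>i\<in>C. f (x i)) * F x) = real (card C) * E (\<lambda>x. f (x b) * F x)" if "C \<subseteq> B" for C
  proof -
    have "E (\<lambda>x. (\<Sum>i\<in>C. f (x i)) * F x) = (\<Sum>i\<in>C. E (\<lambda>x. f (x i) * F x))"
      by (simp add: sum_distrib_right E_sum)
    also have "\<dots> = (\<Sum>i\<in>C. E (\<lambda>x. f (x b) * F x))"
      by (intro sum.cong refl e) (use that in blast)
    finally show ?thesis by simp
  qed
  have "card B \<noteq> 0" using A B by auto
  then show ?thesis by (simp add: s[OF A(1)] s[OF order_refl])
qed

lemma E_symmetric_pairs: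
  assumes B: "B \<subseteq> I" "finite B" "\<And>i j. i \<in> B \<Longrightarrow> j \<in> B \<Longrightarrow> p i = p j"
    and F: "symmetric_on B F" and A: "A \<subseteq> B" and card: "2 \<le> card B"
  shows "E (\<lambda>x. (\<Sum>i\<in>A. \<Sum>j\<in>A - {i}. f (x i) * f (x j)) * F x) =
    (real (card A) * (real (card A) - 1)) / (real (card B) * (real (card B) - 1)) *
      E (\<lambda>x. (\<Sum>i\<in>B. \<Sum>j\<in>B - {i}. f (x i) * f (x j)) * F x)"
proof -
  obtain b c where b: "b \<in> B" and c: "c \<in> B" and bc: "b \<noteq> c"
    using card by (metis card_2_iff' obtain_subset_with_card_n subset_iff)
  let ?e = "\<lambda>i j. E (\<lambda>x. f (x i) * f (x j) * F x)"
  have 1: "?e i j = ?e i' j" if "i \<in> B" "i' \<in> B" "j \<noteq> i" "j \<noteq> i'" for i j i'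
  proof -
    have "?e i j = E (\<lambda>x. (\<lambda>x. f (x i) * f (x j) * F x) (x \<circ> Transposition.transpose i i'))"
      by (rule E_swap[of i i' "\<lambda>x. f (x i) * f (x j) * F x", symmetric]) (use B that in blast)+
    also have "\<dots> = ?e i' j"
      using symmetric_onD[OF F that(1,2)] that by simp
    finally show ?thesis .
  qed
  have sy: "?e i j = ?e j i" for i j by (simp add: mult_ac)
  have e: "?e i j = ?e b c" if "i \<in> B" "j \<in> B" "i \<noteq> j" for i j
  proof (cases "j = b")
    case False
    have "?e i j = ?e b j" using 1[of i b j] that b False by auto
    also have "\<dots> = ?e c b" using 1[of j c b] sy[of b j] that b c False bc by auto
    finally show ?thesis using sy[of b c] by simp
  next
    case True
    have "?e i j = ?e c b" using 1[of i c b] that c bc True by auto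
    then show ?thesis using sy[of b c] by simp
  qed
  have s: "E (\<lambda>x. (\<Sum>i\<in>C. \<Sum>j\<in>C - {i}. f (x i) * f (x j)) * F x)
      = real (card C) * (real (card C) - 1) * ?e b c" if "C \<subseteq> B" for C
  proof -
    have fin: "finite C" using that B(2) by (rule finite_subset)
    have "E (\<lambda>x. (\<Sum>i\<in>C. \<Sum>j\<in>C - {i}. f (x i) * f (x j)) * F x) = (\<Sum>i\<in>C. \<Sum>j\<in>C - {i}. ?e i j)"
      by (simp add: sum_distrib_right E_sum)
    also have "\<dots> = (\<Sum>i\<in>C. \<Sum>j\<in>C - {i}. ?e b c)"
      by (intro sum.cong refl e) (use that in auto)
    also have "\<dots> = (\<Sum>i\<in>C. (real (card C) - 1) * ?e b c)"
      by (intro sum.cong refl) (use card_Suc_Diff1[OF fin] in \<open>fastforce simp del: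
          card_Diff_insert\<close>)
    finally show ?thesis by simp
  qed
  show ?thesis using card by (simp add: s[OF A] s[OF order_refl])
qed

lemma E_indep_sum_sq:
  assumes A: "A \<subseteq> I" and mean: "\<And>i. i \<in> A \<Longrightarrow> measure_pmf.expectation (p i) (f i) = 0"
  shows "E (\<lambda>x. (\<Sum>i\<in>A. f i (x i))\<^sup>2) = (\<Sum>i\<in>A. measure_pmf.expectation (p i) (\<lambda>v. (f i v)\<^sup>2))"
proof -
  have fin: "finite A" using A finite_I by (rule finite_subset)
  have off: "E (\<lambda>x. f i (x i) * f j (x j)) = (if j
      = i then measure_pmf.expectation (p i) (\<lambda>v. (f i v)\<^sup>2) else 0)"
    if "i \<in> A" "j \<in> A" for i j
  proof (cases "j = i")
    case True
    then show ?thesis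
      using E_component[of i "\<lambda>v. (f i v)\<^sup>2"] A that by (auto simp: power2_eq_square)
  next
    case False
    then show ?thesis
      using E_indep[of i "\<lambda>x. f j (x j)" "f i"] A that mean by (auto simp: subset_iff)
  qed
  have "E (\<lambda>x. (\<Sum>i\<in>A. f i (x i))\<^sup>2) = (\<Sum>i\<in>A. \<Sum>j\<in>A. E (\<lambda>x. f i (x i) * f j (x j)))"
    by (simp add: power2_eq_square sum_product E_sum)
  also have "\<dots> = (\<Sum>i\<in>A. \<Sum>j\<in>A. if j = i then measure_pmf.expectation (p i) (\<lambda>v. (f i v)\<^sup>2) else 0)"
    by (intro sum.cong refl off)
  also have "\<dots> = (\<Sum>i\<in>A. measure_pmf.expectation (p i) (\<lambda>v. (f i v)\<^sup>2))"
    using fin by (intro sum.cong refl) simp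
  finally show ?thesis .
qed

end

section \<open>Characteristic functions of bounded independent sums\<close>

lemma exp_neg_quadratic_approx:
  fixes y :: real
  assumes "0 \<le> y"
  shows "\<bar>exp (- y) - (1 - y)\<bar> \<le> y\<^sup>2 / 2"
proof -
  have 1: "1 - y \<le> exp (- y)" using exp_ge_add_one_self[of "- y"] by simp
  have "exp (- y) \<le> 1 - y + y\<^sup>2 / 2"
  proof -
    have e: "1 + y + y\<^sup>2 / 2 \<le> exp y" using exp_lower_Taylor_quadratic[OF assms] by simp
    have pos: "0 < 1 - y + y\<^sup>2 / 2"
      using zero_le_power2[of "y - 1"] by (simp add: power2_eq_square algebra_simps)
    have "1 \<le> (1 - y + y\<^sup>2 / 2) * (1 + y + y\<^sup>2 / 2)"
    proof -
      have "(1 - y + y\<^sup>2 / 2) * (1 + y + y\<^sup>2 / 2) = 1 + (y\<^sup>2)\<^sup>2 / 4"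
        by (simp add: field_simps power2_eq_square)
      then show ?thesis by simp
    qed
    also have "\<dots> \<le> (1 - y + y\<^sup>2 / 2) * exp y" using e pos by (intro mult_left_mono) auto
    finally show ?thesis by (simp add: exp_minus field_simps)
  qed
  with 1 show ?thesis by simp
qed

lemma cmod_iexp_diff_le: "cmod (iexp s - iexp t) \<le> \<bar>s - t\<bar>"
proof -
  have "iexp s - iexp t = iexp t * (iexp (s - t) - 1)"
    by (simp add: right_diff_distrib exp_add[symmetric] algebra_simps)
  then have "cmod (iexp s - iexp t) = cmod (iexp (s - t) - 1)" by (simp add: norm_mult)
  also have "\<dots> \<le> \<bar>s - t\<bar>" using iexp_approx1[of "s - t" 0] by simp
  finally show ?thesis .
qed

context finite_product
begin

lemma expectation_prod:
  fixes f :: "'i \<Rightarrow> 'x \<Rightarrow> complex"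
  shows "measure_pmf.expectation (Pi_pmf I dflt p) (\<lambda>x. \<Prod>i\<in>I. f i (x i))
      = (\<Prod>i\<in>I. measure_pmf.expectation (p i) (f i))"
proof -
  have "prob_space.indep_vars (measure_pmf (Pi_pmf I dflt p)) (\<lambda>_. borel) (\<lambda>i x. f i (x i)) I"
    by (rule prob_space.indep_vars_compose2[OF measure_pmf.prob_space_axioms indep_vars_Pi_pmf[OF
        finite_I]]) simp
  then have "measure_pmf.expectation (Pi_pmf I dflt p) (\<lambda>x. \<Prod>i\<in>I. f i (x i))
      = (\<Prod>i\<in>I. measure_pmf.expectation (Pi_pmf I dflt p) (\<lambda>x. f i (x i)))"
    by (intro prob_space.indep_vars_lebesgue_integral[OF measure_pmf.prob_space_axioms] finite_I
        integrable_Pi_pmf)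
  also have "\<dots> = (\<Prod>i\<in>I. measure_pmf.expectation (p i) (f i))"
  proof (rule prod.cong[OF refl])
    fix i assume "i \<in> I"
    then have "map_pmf (\<lambda>x. x i) (Pi_pmf I dflt p) = p i"
        by (simp add: Pi_pmf_component[OF finite_I])
    then show "measure_pmf.expectation (Pi_pmf I dflt p) (\<lambda>x. f i (x i))
        = measure_pmf.expectation (p i) (f i)"
      by (metis integral_map_pmf)
  qed
  finally show ?thesis .
qed

lemma char_sum_approx_normal:
  fixes f :: "'i \<Rightarrow> 'x \<Rightarrow> real"
  assumes mean: "\<And>i. i \<in> I \<Longrightarrow> measure_pmf.expectation (p i) (f i) = 0"
    and bound: "\<And>i v. i \<in> I \<Longrightarrow> \<bar>f i v\<bar> \<le> B" and B: "0 \<le> B"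
    and var: "(\<Sum>i\<in>I. measure_pmf.expectation (p i) (\<lambda>v. (f i v)\<^sup>2)) = 1"
  shows "cmod (measure_pmf.expectation (Pi_pmf I dflt p) (\<lambda>x. iexp (t * (\<Sum>i\<in>I. f i (x i)))) - exp
      (- (t\<^sup>2) / 2))
     \<le> \<bar>t\<bar> ^ 3 * B + t ^ 4 * B\<^sup>2"
proof -
  define s where "s i = measure_pmf.expectation (p i) (\<lambda>v. (f i v)\<^sup>2)" for i
  have s0: "0 \<le> s i" for i unfolding s_def by simp
  have int: "integrable (measure_pmf (p i)) g" if "i \<in> I" for i and g :: "'x \<Rightarrow> real"
    by (rule integrable_measure_pmf_finite[OF finite_supp[OF that]])
  have sB: "s i \<le> B\<^sup>2" if i: "i \<in> I" for i
  proof -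
    have "s i \<le> measure_pmf.expectation (p i) (\<lambda>v. B\<^sup>2)" unfolding s_def
      using bound[OF i] B by (intro integral_mono int i) (metis abs_le_square_iff abs_of_nonneg)
    then show ?thesis by simp
  qed
  define z where "z i = measure_pmf.expectation (p i) (\<lambda>v. iexp (t * f i v))" for i
  define w where "w i = complex_of_real (exp (- (t\<^sup>2 * s i / 2)))" for i
  have prodz: "measure_pmf.expectation (Pi_pmf I dflt p) (\<lambda>x. iexp (t * (\<Sum>i\<in>I. f i (x i))))
      = (\<Prod>i\<in>I. z i)"
  proof -
    have "iexp (t * (\<Sum>i\<in>I. f i (x i))) = (\<Prod>i\<in>I. iexp (t * f i (x i)))" for x
      by (simp add: sum_distrib_left exp_sum[OF finite_I])
    then show ?thesis unfolding z_def using expectation_prod[of "\<lambda>i v. iexp (t * f i v)"] by simp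
  qed
  have prodw: "(\<Prod>i\<in>I. w i) = exp (- (t\<^sup>2) / 2)"
  proof -
    have "(\<Prod>i\<in>I. exp (- (t\<^sup>2 * s i / 2))) = exp (\<Sum>i\<in>I. - (t\<^sup>2 * s i / 2))"
      by (simp add: exp_sum[OF finite_I])
    also have "(\<Sum>i\<in>I. - (t\<^sup>2 * s i / 2)) = - (t\<^sup>2) / 2 * (\<Sum>i\<in>I. s i)"
      by (simp add: sum_distrib_left sum_negf)
    also have "\<dots> = - (t\<^sup>2) / 2" using var by (simp add: s_def)
    finally show ?thesis unfolding w_def of_real_prod[symmetric] by (simp add: exp_of_real)
  qed
  have zi: "cmod (z i - (1 - t\<^sup>2 * s i / 2)) \<le> \<bar>t\<bar> ^ 3 * B * s i" if i: "i \<in> I" for i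
  proof -
    have "cmod (char (distr (measure_pmf (p i)) borel (f i)) t - (1 - t\<^sup>2 * s i / 2)) \<le>
       t\<^sup>2 / 6 * measure_pmf.expectation (p i) (\<lambda>v. min (6 * (f i v)\<^sup>2) (\<bar>t\<bar> * \<bar>f i v\<bar> ^ 3))"
      by (rule prob_space.char_approx3'[OF measure_pmf.prob_space_axioms]) (use int i mean in
          \<open>auto simp: s_def\<close>)
    also have "char (distr (measure_pmf (p i)) borel (f i)) t = z i"
      unfolding char_def z_def by (simp add: integral_distr)
    also have "t\<^sup>2 / 6 * measure_pmf.expectation (p i) (\<lambda>v. min (6 * (f i v)\<^sup>2) (\<bar>t\<bar> * \<bar>f i v\<bar> ^ 3))
       \<le> t\<^sup>2 * measure_pmf.expectation (p i) (\<lambda>v. (\<bar>t\<bar> * B) * (f i v)\<^sup>2)"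
    proof (intro mult_mono integral_mono int i)
      fix v
      have "\<bar>t\<bar> * \<bar>f i v\<bar> ^ 3 = \<bar>t\<bar> * \<bar>f i v\<bar> * (f i v)\<^sup>2"
        by (simp add: power3_eq_cube power2_eq_square)
      also have "\<dots> \<le> \<bar>t\<bar> * B * (f i v)\<^sup>2" using bound[OF i]
          by (intro mult_right_mono mult_left_mono) auto
      finally show "min (6 * (f i v)\<^sup>2) (\<bar>t\<bar> * \<bar>f i v\<bar> ^ 3) \<le> (\<bar>t\<bar> * B) * (f i v)\<^sup>2" by linarith
    qed auto
    also have "\<dots> = \<bar>t\<bar> ^ 3 * B * s i" by (simp add: s_def power3_eq_cube power2_eq_square)
    finally show ?thesis .
  qed
  have wi: "cmod (w i - (1 - t\<^sup>2 * s i / 2)) \<le> t ^ 4 * B\<^sup>2 * s i" if i: "i \<in> I" for i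
  proof -
    have "w i - (1 - t\<^sup>2 * s i / 2) = complex_of_real (exp (- (t\<^sup>2 * s i / 2)) - (1 - t\<^sup>2 * s i /
        2))"
      unfolding w_def by simp
    then have "cmod (w i - (1 - t\<^sup>2 * s i / 2)) = \<bar>exp (- (t\<^sup>2 * s i / 2)) - (1 - t\<^sup>2 * s i / 2)\<bar>"
      by (simp only: norm_of_real)
    also have "\<dots> \<le> (t\<^sup>2 * s i / 2)\<^sup>2 / 2" using s0 by (intro exp_neg_quadratic_approx) auto
    also have "\<dots> = (t ^ 4 / 8) * (s i * s i)" by (simp add: power2_eq_square power4_eq_xxxx)
    also have "\<dots> \<le> t ^ 4 * (B\<^sup>2 * s i)"
      using sB[OF i] s0 by (intro mult_mono) auto
    finally show ?thesis by (simp add: mult_ac)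
  qed
  have "cmod ((\<Prod>i\<in>I. z i) - (\<Prod>i\<in>I. w i)) \<le> (\<Sum>i\<in>I. cmod (z i - w i))"
  proof (rule norm_prod_diff)
    show "cmod (z i) \<le> 1" if "i \<in> I" for i
    proof -
      have "cmod (z i) \<le> measure_pmf.expectation (p i) (\<lambda>v. cmod (iexp (t * f i v)))"
        unfolding z_def by (rule integral_norm_bound)
      then show ?thesis by simp
    qed
    show "cmod (w i) \<le> 1" for i unfolding w_def norm_of_real using s0 by simp
  qed
  also have "\<dots> \<le> (\<Sum>i\<in>I. (\<bar>t\<bar> ^ 3 * B + t ^ 4 * B\<^sup>2) * s i)"
  proof (rule sum_mono)
    fix i assume i: "i \<in> I"
    have "cmod (z i - w i) \<le> cmod (z i - (1 - t\<^sup>2 * s i / 2)) + cmod (w i - (1 - t\<^sup>2 * s i / 2))"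
      by (metis norm_minus_commute norm_triangle_sub norm_diff_triangle_le order_refl)
    then show "cmod (z i - w i) \<le> (\<bar>t\<bar> ^ 3 * B + t ^ 4 * B\<^sup>2) * s i"
      using zi[OF i] wi[OF i] by (simp add: distrib_right)
  qed
  also have "\<dots> = \<bar>t\<bar> ^ 3 * B + t ^ 4 * B\<^sup>2" using var
      by (simp add: sum_distrib_left[symmetric] s_def)
  finally show ?thesis unfolding prodz prodw .
qed

lemma cmod_expectation_diff_le:
  fixes f g :: "('i \<Rightarrow> 'x) \<Rightarrow> complex"
  assumes "\<And>x. cmod (f x - g x) \<le> B x"
  shows "cmod (measure_pmf.expectation (Pi_pmf I dflt p) f - measure_pmf.expectation (Pi_pmf I
      dflt p) g) \<le> E B"
proof -
  have "cmod (measure_pmf.expectation (Pi_pmf I dflt p) f - measure_pmf.expectation (Pi_pmf I dflt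
      p) g)
     = cmod (measure_pmf.expectation (Pi_pmf I dflt p) (\<lambda>x. f x - g x))"
    by (simp add: integrable_Pi_pmf)
  also have "\<dots> \<le> E (\<lambda>x. cmod (f x - g x))" unfolding E_def by (rule integral_norm_bound)
  also have "\<dots> \<le> E B" using assms by (rule E_mono)
  finally show ?thesis .
qed

text \<open>A quantitative Slutsky argument: \<open>\<rho>\<close> is the additive and \<open>w\<close> the multiplicative
  perturbation of \<open>X\<close>.\<close>

lemma char_perturbation:
  assumes \<delta>: "0 < \<delta>" "\<delta> \<le> 1/2"
    and Y: "\<And>x. 0 < w x \<Longrightarrow> Y x = (X x - \<rho> x) / sqrt (w x)"
  shows "cmod (measure_pmf.expectation (Pi_pmf I dflt p) (\<lambda>x. iexp (t * Y x))
      - measure_pmf.expectation (Pi_pmf I dflt p) (\<lambda>x. iexp (t * X x)))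
     \<le> \<bar>t\<bar> * (2 * \<delta> * E (\<lambda>x. \<bar>X x\<bar>) + 2 * E (\<lambda>x. \<bar>\<rho> x\<bar>)) + 2 / \<delta> * E (\<lambda>x. \<bar>w x - 1\<bar>)"
proof -
  have pt: "cmod (iexp (t * Y x) - iexp (t * X x)) \<le> \<bar>t\<bar> * (2 * \<delta> * \<bar>X x\<bar> + 2 * \<bar>\<rho> x\<bar>)
      + 2 / \<delta> * \<bar>w x - 1\<bar>" for x
  proof (cases "\<bar>w x - 1\<bar> \<le> \<delta>")
    case False
    have "cmod (iexp (t * Y x) - iexp (t * X x)) \<le> cmod (iexp (t * Y x)) + cmod (iexp (t * X x))"
      by (rule norm_triangle_ineq4)
    also have "\<dots> = 2" by simp
    also have "\<dots> \<le> 2 / \<delta> * \<bar>w x - 1\<bar>" using False \<delta> by (simp add: field_simps)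
    also have "\<dots> \<le> \<bar>t\<bar> * (2 * \<delta> * \<bar>X x\<bar> + 2 * \<bar>\<rho> x\<bar>) + 2 / \<delta> * \<bar>w x - 1\<bar>" using \<delta> by simp
    finally show ?thesis .
  next
    case True
    define r where "r = sqrt (w x)"
    have wx: "1/2 \<le> w x" using True \<delta> by linarith
    have r: "1/2 \<le> r" unfolding r_def using wx by (intro real_le_rsqrt) (simp add: power2_eq_square)
    have rr: "r * r = w x" unfolding r_def using wx by simp
    have ir: "\<bar>1 / r - 1\<bar> \<le> 2 * \<delta>"
    proof -
      have "(1 - w x) / (r * (1 + r)) = ((1 - r) * (1 + r)) / (r * (1 + r))"
        unfolding rr[symmetric] by (simp add: algebra_simps)
      also have "\<dots> = (1 - r) / r" using r by simp
      finally have "1 / r - 1 = (1 - w x) / (r * (1 + r))" using r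
          by (simp add: diff_divide_distrib)
      then have "\<bar>1 / r - 1\<bar> = \<bar>w x - 1\<bar> / (r * (1 + r))" using r
          by (simp add: abs_divide abs_minus_commute)
      also have "\<dots> \<le> \<delta> / (1/2 * 1)" using True r \<delta> by (intro frac_le mult_mono) auto
      finally show ?thesis by simp
    qed
    have "Y x - X x = X x * (1 / r - 1) - \<rho> x * (1 / r)" using Y[of x] wx
        unfolding r_def[symmetric] by (simp add: diff_divide_distrib right_diff_distrib)
    then have "\<bar>Y x - X x\<bar> \<le> \<bar>X x\<bar> * \<bar>1 / r - 1\<bar> + \<bar>\<rho> x\<bar> * \<bar>1 / r\<bar>"
      by (metis abs_mult abs_triangle_ineq4)
    also have "\<dots> \<le> \<bar>X x\<bar> * (2 * \<delta>) + \<bar>\<rho> x\<bar> * 2"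
      using ir r by (intro add_mono mult_left_mono) (auto simp: field_simps)
    finally have yx: "\<bar>Y x - X x\<bar> \<le> 2 * \<delta> * \<bar>X x\<bar> + 2 * \<bar>\<rho> x\<bar>" by (simp add: mult_ac)
    have "cmod (iexp (t * Y x) - iexp (t * X x)) \<le> \<bar>t * Y x - t * X x\<bar>" by (rule cmod_iexp_diff_le)
    also have "\<dots> = \<bar>t\<bar> * \<bar>Y x - X x\<bar>" by (simp add: abs_mult[symmetric] algebra_simps)
    also have "\<dots> \<le> \<bar>t\<bar> * (2 * \<delta> * \<bar>X x\<bar> + 2 * \<bar>\<rho> x\<bar>)" by (intro mult_left_mono yx) simp
    finally show ?thesis using \<delta> by (smt (verit) abs_ge_zero divide_nonneg_nonneg
        mult_nonneg_nonneg)
  qed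
  have "E (\<lambda>x. \<bar>t\<bar> * (2 * \<delta> * \<bar>X x\<bar> + 2 * \<bar>\<rho> x\<bar>) + 2 / \<delta> * \<bar>w x - 1\<bar>) =
    \<bar>t\<bar> * (2 * \<delta> * E (\<lambda>x. \<bar>X x\<bar>) + 2 * E (\<lambda>x. \<bar>\<rho> x\<bar>)) + 2 / \<delta> * E (\<lambda>x. \<bar>w x - 1\<bar>)"
    by (simp only: E_add E_cmult)
  with cmod_expectation_diff_le[of "\<lambda>x. iexp (t * Y x)" "\<lambda>x. iexp (t * X x)", OF pt] show ?thesis
      by simp
qed

end

section \<open>The logrank statistic of one stratum\<close>

text \<open>The stratum \<open>J\<close> is part of a larger population \<open>I\<close>. A unit is described by a type \<open>v\<close>:
  \<open>a k v\<close> indicates that it is uncensored at the \<open>k\<close>-th event time (counted from 0), and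
  \<open>x1 k v\<close> that it is treated as well. The event time of unit \<open>i\<close> is the \<open>e i\<close>-th one.\<close>

locale stratum = finite_product I dflt p
  for I :: "'i set" and dflt :: 'x and p :: "'i \<Rightarrow> 'x pmf" +
  fixes J :: "'i set" and P :: "'x pmf" and e :: "'i \<Rightarrow> nat" and K :: nat
    and x1 a :: "nat \<Rightarrow> 'x \<Rightarrow> real"
  assumes J_sub: "J \<subseteq> I"
    and p_eq: "i \<in> J \<Longrightarrow> p i = P"
    and fin_P: "finite (set_pmf P)"
    and e_J: "e ` J = {..<K}"
    and a_range: "a k v = 0 \<or> a k v = 1"
    and x1_range: "x1 k v = 0 \<or> x1 k v = a k v"
begin

definition "R k = {i \<in> J. k \<le> e i}"
definition "Ev k = {i \<in> J. e i = k}"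
definition "n k = real (card (R k))"
definition "d k = real (card (Ev k))"
definition "h k = d k / n k"
definition "N k x = (\<Sum>i\<in>R k. a k (x i))"
definition "N1 k x = (\<Sum>i\<in>R k. x1 k (x i))"
definition "D k x = (\<Sum>i\<in>Ev k. a k (x i))"
definition "D1 k x = (\<Sum>i\<in>Ev k. x1 k (x i))"
definition "\<pi> k = measure_pmf.expectation P (a k)"
definition "\<pi>1 k = measure_pmf.expectation P (x1 k)"
definition "\<phi> k = \<pi>1 k / \<pi> k"
definition "u k v = x1 k v - \<phi> k * a k v"
definition "S k x = (\<Sum>i\<in>R k. u k (x i))"
definition "\<tau> k = \<pi> k * \<phi> k * (1 - \<phi> k)"
definition "\<sigma>2 = (\<Sum>k<K. d k * (1 - h k) * \<tau> k)"
definition "b i k = of_bool (k \<le> e i) * (of_bool (e i = k) - h k)"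
definition "\<xi> i v = (\<Sum>k<K. u k v * b i k)"
definition "Rem x = (\<Sum>k<K. (D k x / N k x - h k) * S k x)"
definition "L x = (\<Sum>k<K. D1 k x - D k x * N1 k x / N k x)"
definition "V k x = D k x * (N k x - D k x) * N1 k x * (N k x - N1 k x) / ((N k x)\<^sup>2 * (N k x - 1))"
definition "U x = (\<Sum>k<K. V k x)"

lemma fin_J: "finite J" using J_sub finite_I finite_subset by blast
lemma fin_R: "finite (R k)" unfolding R_def using fin_J by auto
lemma fin_Ev: "finite (Ev k)" unfolding Ev_def using fin_J by auto
lemma Ev_R: "Ev k \<subseteq> R k" unfolding R_def Ev_def by auto
lemma R_J: "R k \<subseteq> J" unfolding R_def by auto
lemma R_I: "R k \<subseteq> I" using R_J J_sub by auto
lemma p_R: "i \<in> R k \<Longrightarrow> p i = P" using p_eq R_J by blast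
lemma e_less: "i \<in> J \<Longrightarrow> e i < K" using e_J by auto

lemma Ev_nonempty:
  assumes "k < K" shows "Ev k \<noteq> {}"
proof -
  have "k \<in> e ` J" using assms e_J by simp
  then show ?thesis unfolding Ev_def by auto
qed

lemma R_nonempty: "k < K \<Longrightarrow> R k \<noteq> {}"
  using Ev_nonempty Ev_R by blast

lemma d_ge_1: "k < K \<Longrightarrow> 1 \<le> d k"
  unfolding d_def using Ev_nonempty[of k] fin_Ev[of k] by (simp add: Suc_le_eq card_gt_0_iff)

lemma d_le_n: "d k \<le> n k"
  unfolding d_def n_def using card_mono[OF fin_R Ev_R] by simp

lemma n_ge_1: "k < K \<Longrightarrow> 1 \<le> n k"
  using d_ge_1 d_le_n order_trans by blast

lemma h_nonneg: "0 \<le> h k" unfolding h_def d_def n_def by simp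

lemma h_le_1: "h k \<le> 1"
  unfolding h_def using d_le_n[of k] by (simp add: d_def n_def divide_le_eq)

lemma n_Suc: "n (Suc k) = n k - d k"
proof -
  have "R k = Ev k \<union> R (Suc k)" "Ev k \<inter> R (Suc k) = {}"
    unfolding R_def Ev_def by auto
  then have "card (R k) = card (Ev k) + card (R (Suc k))"
    using card_Un_disjoint[OF fin_Ev fin_R] by metis
  then show ?thesis unfolding n_def d_def by simp
qed

lemma n_0: "n 0 = real (card J)" unfolding n_def R_def by simp

lemma a_nonneg: "0 \<le> a k v" using a_range[of k v] by auto
lemma a_sq: "a k v * a k v = a k v" using a_range[of k v] by auto
lemma x1_nonneg: "0 \<le> x1 k v" using x1_range[of k v] a_nonneg[of k v] by auto
lemma x1_le: "x1 k v \<le> a k v" using x1_range[of k v] a_nonneg[of k v] by auto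

lemma integrable_P: "integrable (measure_pmf P) (f :: 'x \<Rightarrow> real)"
  by (rule integrable_measure_pmf_finite[OF fin_P])

lemma \<pi>1_nonneg: "0 \<le> \<pi>1 k" unfolding \<pi>1_def using x1_nonneg by simp
lemma \<pi>1_le: "\<pi>1 k \<le> \<pi> k" unfolding \<pi>1_def \<pi>_def by (intro integral_mono integrable_P x1_le)
lemma \<pi>_nonneg: "0 \<le> \<pi> k" using \<pi>1_nonneg \<pi>1_le order_trans by blast
lemma \<phi>_nonneg: "0 \<le> \<phi> k" unfolding \<phi>_def using \<pi>1_nonneg \<pi>_nonneg by simp
lemma \<phi>_le: "\<phi> k \<le> 1" unfolding \<phi>_def using \<pi>1_le[of k] \<pi>_nonneg[of k]
    by (auto simp: divide_le_eq_1)
lemma \<phi>_\<pi>: "\<phi> k * \<pi> k = \<pi>1 k"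
  unfolding \<phi>_def using \<pi>1_le[of k] \<pi>1_nonneg[of k] by auto

lemma \<pi>_le_1: "\<pi> k \<le> 1"
proof -
  have "\<pi> k \<le> measure_pmf.expectation P (\<lambda>_. 1)" unfolding \<pi>_def
    using a_range[of k] by (intro integral_mono integrable_P) (metis order_refl zero_le_one)
  then show ?thesis by simp
qed

lemma \<tau>_nonneg: "0 \<le> \<tau> k" unfolding \<tau>_def using \<pi>_nonneg[of k] \<phi>_nonneg[of k] \<phi>_le[of k] by simp

lemma mean_u: "measure_pmf.expectation P (u k) = 0"
  unfolding u_def using integrable_P by (simp add: \<pi>1_def[symmetric] \<pi>_def[symmetric] \<phi>_\<pi>)

lemma u_sq: "(u k v)\<^sup>2 = x1 k v * (1 - 2 * \<phi> k) + (\<phi> k)\<^sup>2 * a k v"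
  unfolding u_def using x1_range[of k v] a_range[of k v]
      by (auto simp: power2_eq_square algebra_simps)

lemma second_moment_u: "measure_pmf.expectation P (\<lambda>v. (u k v)\<^sup>2) = \<tau> k"
  unfolding u_sq using integrable_P
  by (simp add: \<pi>1_def[symmetric] \<pi>_def[symmetric] \<phi>_\<pi>[symmetric] \<tau>_def power2_eq_square
      algebra_simps)

lemma abs_u_le: "\<bar>u k v\<bar> \<le> a k v"
  unfolding u_def using x1_range[of k v] a_range[of k v] \<phi>_nonneg[of k] \<phi>_le[of k] by auto

lemma abs_u_le_1: "\<bar>u k v\<bar> \<le> 1"
  using abs_u_le[of k v] a_range[of k v] by auto

lemma N_nonneg: "0 \<le> N k x" unfolding N_def by (intro sum_nonneg a_nonneg)
lemma D_nonneg: "0 \<le> D k x" unfolding D_def by (intro sum_nonneg a_nonneg)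
lemma D_le_N: "D k x \<le> N k x" unfolding D_def N_def by (intro sum_mono2 fin_R Ev_R a_nonneg)
lemma D_le_d: "D k x \<le> d k"
proof -
  have "D k x \<le> (\<Sum>i\<in>Ev k. 1)" unfolding D_def using a_range[of k]
      by (intro sum_mono) (metis order_refl zero_le_one)
  then show ?thesis by (simp add: d_def)
qed
lemma N1_nonneg: "0 \<le> N1 k x" unfolding N1_def by (intro sum_nonneg x1_nonneg)
lemma N1_le_N: "N1 k x \<le> N k x" unfolding N1_def N_def by (intro sum_mono x1_le)
lemma S_eq: "S k x = N1 k x - \<phi> k * N k x"
  unfolding S_def N1_def N_def u_def by (simp add: sum_subtractf sum_distrib_left)
lemma S_zero: "N k x = 0 \<Longrightarrow> S k x = 0"
  using S_eq[of k x] N1_nonneg[of k x] N1_le_N[of k x] by simp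

lemma sum_indicator_nat:
  assumes "finite A" shows "\<exists>m. (\<Sum>i\<in>A. a k (x i)) = real m"
  using assms
proof (induction A)
  case (insert b A)
  then obtain m where "(\<Sum>i\<in>A. a k (x i)) = real m" by auto
  with insert a_range[of k "x b"] show ?case
    by (auto intro: exI[of _ m] exI[of _ "Suc m"])
qed (auto intro: exI[of _ 0])

lemma N_cases: obtains "N k x = 0" | "N k x = 1" | "2 \<le> N k x"
proof -
  obtain m where m: "N k x = real m" using sum_indicator_nat[OF fin_R] N_def by metis
  then show ?thesis using that by (cases "m = 0"; cases "m = 1") auto
qed

lemma D_cases: obtains "D k x = 0" | "1 \<le> D k x"
proof -
  obtain m where m: "D k x = real m" using sum_indicator_nat[OF fin_Ev] D_def by metis
  then show ?thesis using that by (cases "m = 0") auto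
qed

lemma L_decomp: "L x = (\<Sum>i\<in>J. \<xi> i (x i)) - Rem x"
proof -
  have 1: "D1 k x - D k x * N1 k x / N k x = (\<Sum>i\<in>R k. u k (x i) * (of_bool (e i
      = k) - h k)) - (D k x / N k x - h k) * S k x" for k
  proof -
    have D1: "D1 k x = (\<Sum>i\<in>Ev k. u k (x i)) + \<phi> k * D k x"
      unfolding D1_def D_def u_def by (simp add: sum_subtractf sum_distrib_left)
    have "(\<Sum>i\<in>R k. u k (x i) * (of_bool (e i = k) - h k)) =
        (\<Sum>i\<in>R k. of_bool (e i = k) * u k (x i)) - (\<Sum>i\<in>R k. h k * u k (x i))"
      by (simp add: algebra_simps sum_subtractf)
    also have "(\<Sum>i\<in>R k. of_bool (e i = k) * u k (x i)) = (\<Sum>i\<in>Ev k. u k (x i))"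
      by (rule sum.mono_neutral_cong_right[OF fin_R Ev_R]) (auto simp: Ev_def R_def)
    also have "(\<Sum>i\<in>R k. h k * u k (x i)) = h k * S k x" by (simp add: S_def sum_distrib_left)
    finally have A: "(\<Sum>i\<in>R k. u k (x i) * (of_bool (e i = k) - h k))
        = (\<Sum>i\<in>Ev k. u k (x i)) - h k * S k x" .
    show ?thesis
    proof (cases "N k x = 0")
      case True
      then have "D k x = 0" using D_nonneg[of k x] D_le_N[of k x] by simp
      with True show ?thesis using A D1 S_zero[OF True] by simp
    next
      case False
      then show ?thesis unfolding A D1 by (simp add: S_eq field_simps)
    qed
  qed
  have "(\<Sum>i\<in>R k. u k (x i) * (of_bool (e i = k) - h k)) = (\<Sum>i\<in>J. u k (x i) * b i k)" for k
    by (rule sum.mono_neutral_cong_left[OF fin_J R_J]) (auto simp: b_def R_def)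
  then have "(\<Sum>k<K. \<Sum>i\<in>R k. u k (x i) * (of_bool (e i = k) - h k))
      = (\<Sum>k<K. \<Sum>i\<in>J. u k (x i) * b i k)"
    by simp
  also have "\<dots> = (\<Sum>i\<in>J. \<xi> i (x i))" unfolding \<xi>_def by (rule sum.swap)
  finally show ?thesis unfolding L_def Rem_def by (simp add: 1 sum_subtractf)
qed

lemma symmetric_N: "R l \<subseteq> R k \<Longrightarrow> symmetric_on (R l) (N k)"
  unfolding N_def by (rule symmetric_on_sum)

lemma symmetric_S: "R l \<subseteq> R k \<Longrightarrow> symmetric_on (R l) (S k)"
  unfolding S_def by (rule symmetric_on_sum)

lemma R_antimono: "k \<le> l \<Longrightarrow> R l \<subseteq> R k" unfolding R_def by auto

lemma symmetric_D: "k < l \<Longrightarrow> symmetric_on (R l) (D k)"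
  unfolding D_def by (rule symmetric_on_sum_disjoint) (auto simp: R_def Ev_def)

lemma E_D:
  assumes "k < K" "symmetric_on (R k) F"
  shows "E (\<lambda>x. D k x * F x) = h k * E (\<lambda>x. N k x * F x)"
  unfolding D_def N_def h_def d_def n_def
  by (rule E_symmetric) (use assms R_I fin_R p_R Ev_R R_nonempty in \<open>auto\<close>)

lemma pair_sum:
  assumes "finite A"
  shows "(\<Sum>i\<in>A. \<Sum>j\<in>A - {i}. a k (x i) * a k (x j)) = (\<Sum>i\<in>A. a k (x i)) * ((\<Sum>i\<in>A. a k (x i)) - 1)"
proof -
  have "(\<Sum>j\<in>A - {i}. a k (x i) * a k (x j)) = a k (x i) * (\<Sum>j\<in>A. a k (x j)) - a k (x i)"
      if "i \<in> A" for i
    using sum.remove[OF assms that, of "\<lambda>j. a k (x i) * a k (x j)"]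
        by (simp add: sum_distrib_left a_sq)
  then have "(\<Sum>i\<in>A. \<Sum>j\<in>A - {i}. a k (x i) * a k (x j))
      = (\<Sum>i\<in>A. a k (x i) * (\<Sum>j\<in>A. a k (x j)) - a k (x i))"
    by (intro sum.cong) auto
  then show ?thesis by (simp add: sum_subtractf sum_distrib_right[symmetric] right_diff_distrib)
qed

lemma E_D2:
  assumes "k < K" "symmetric_on (R k) F" "2 \<le> n k"
  shows "E (\<lambda>x. (D k x * (D k x - 1)) * F x) = h k * ((d k - 1) / (n k - 1)) * E (\<lambda>x. (N k x * (N
      k x - 1)) * F x)"
proof -
  have "E (\<lambda>x. (\<Sum>i\<in>Ev k. \<Sum>j\<in>Ev k - {i}. a k (x i) * a k (x j)) * F x) =
    (real (card (Ev k)) * (real (card (Ev k)) - 1)) / (real (card (R k)) * (real (card (R k)) -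
        1)) *
      E (\<lambda>x. (\<Sum>i\<in>R k. \<Sum>j\<in>R k - {i}. a k (x i) * a k (x j)) * F x)"
    by (rule E_symmetric_pairs) (use assms R_I fin_R p_R Ev_R in \<open>auto simp: n_def\<close>)
  then show ?thesis unfolding pair_sum[OF fin_R] pair_sum[OF fin_Ev] D_def N_def h_def d_def n_def
      by simp
qed

lemma symmetric_on_combine2:
  "symmetric_on B F \<Longrightarrow> symmetric_on B G \<Longrightarrow> symmetric_on B (\<lambda>x. H (F x) (G x))"
  unfolding symmetric_on_def by auto

lemma E_D_centered_sq:
  assumes k: "k < K" and F: "symmetric_on (R k) F" and F0: "\<And>x. 0 \<le> F x" "\<And>x. N k x = 0 \<Longrightarrow> F x = 0"
  shows "E (\<lambda>x. (D k x / N k x - h k)\<^sup>2 * F x) \<le> h k * E (\<lambda>x. F x / N k x)"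
proof (cases "card (R k) = 1")
  case True
  then have "Ev k = R k" using Ev_nonempty[OF k] Ev_R[of k]
      by (metis card_1_singletonE subset_singletonD)
  then have "D k x = N k x" "h k = 1" for x unfolding D_def N_def h_def d_def n_def using True
      by auto
  then have "(\<lambda>x. (D k x / N k x - h k)\<^sup>2 * F x) = (\<lambda>x. 0)" using F0(2) by fastforce
  then show ?thesis using F0 h_nonneg N_nonneg by (simp add: E_const E_nonneg)
next
  case False
  then have n2: "2 \<le> n k" using n_ge_1[OF k] unfolding n_def by simp
  let ?F1 = "\<lambda>x. F x / N k x" and ?F2 = "\<lambda>x. F x / (N k x)\<^sup>2"
  have N: "symmetric_on (R k) (N k)" by (rule symmetric_N) simp
  have F1: "symmetric_on (R k) ?F1" by (rule symmetric_on_combine2[OF F N])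
  have F2: "symmetric_on (R k) ?F2" by (rule symmetric_on_combine2[OF F N, of "\<lambda>f n. f / n\<^sup>2"])
  have "(\<lambda>x. (D k x / N k x - h k)\<^sup>2 * F x) =
    (\<lambda>x. (((D k x * (D k x - 1)) * ?F2 x + D k x * ?F2 x) - (2 * h k) * (D k x * ?F1 x))
        + (h k)\<^sup>2 * F x)" (is "?l = ?r")
  proof
    fix x show "?l x = ?r x" using F0(2)[of x]
      by (cases "N k x = 0") (auto simp: field_simps power2_eq_square)
  qed
  then have "E ?l = E (\<lambda>x. (D k x * (D k x - 1)) * ?F2 x)
      + E (\<lambda>x. D k x * ?F2 x) - (2 * h k) * E (\<lambda>x. D k x * ?F1 x) + (h k)\<^sup>2 * E F"
    by (simp only: E_add E_diff E_cmult)
  also have "\<dots> = h k * ((d k - 1) / (n k - 1)) * E (\<lambda>x. (N k x * (N k x - 1)) * ?F2 x)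
      + h k * E (\<lambda>x. N k x * ?F2 x) - (2 * h k) * (h k * E (\<lambda>x. N k x * ?F1 x)) + (h k)\<^sup>2 * E F"
    by (simp only: E_D[OF k F1] E_D[OF k F2] E_D2[OF k F2 n2])
  also have "(\<lambda>x. N k x * ?F1 x) = F" using F0(2) by auto
  also have "(\<lambda>x. N k x * ?F2 x) = ?F1" by (auto simp: power2_eq_square)
  also have "(\<lambda>x. (N k x * (N k x - 1)) * ?F2 x) = (\<lambda>x. F x - ?F1 x)"
  proof
    fix x show "(N k x * (N k x - 1)) * ?F2 x = F x - ?F1 x" using F0(2)[of x]
      by (cases "N k x = 0") (auto simp: field_simps power2_eq_square)
  qed
  also have "E (\<lambda>x. F x - ?F1 x) = E F - E ?F1" by (rule E_diff)
  finally have eq: "E ?l = h k * ((d k - 1) / (n k - 1)) * (E F - E ?F1)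
      + h k * E ?F1 - (h k)\<^sup>2 * E F"
    by (simp add: power2_eq_square)
  have EF: "0 \<le> E F" "0 \<le> E ?F1" using F0(1) N_nonneg by (auto intro!: E_nonneg)
  have q: "(d k - 1) / (n k - 1) \<le> h k" "0 \<le> (d k - 1) / (n k - 1)"
    unfolding h_def using n2 d_le_n[of k] d_ge_1[OF k] by (auto simp: field_simps)
  have "(d k - 1) / (n k - 1) * (E F - E ?F1) \<le> h k * E F"
  proof -
    have "(d k - 1) / (n k - 1) * (E F - E ?F1) \<le> (d k - 1) / (n k - 1) * E F"
      using q EF by (intro mult_left_mono) auto
    also have "\<dots> \<le> h k * E F" using q EF by (intro mult_right_mono) auto
    finally show ?thesis .
  qed
  from mult_left_mono[OF this h_nonneg[of k]] show ?thesis
    unfolding eq by (simp add: power2_eq_square mult.assoc)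
qed

lemma E_S_sq: "E (\<lambda>x. (S k x)\<^sup>2 / N k x) \<le> 1"
proof -
  \<comment> \<open>Where \<open>u k (x i)\<close> does not vanish, unit \<open>i\<close> counts in \<open>N k x\<close>, so \<open>N k x\<close> may be replaced by an
    expression in the other units, which is independent of unit \<open>i\<close>.\<close>
  have off: "E (\<lambda>x. u k (x i) * u k (x j) / N k x) = 0" if ij: "i \<in> R k" "j \<in> R k" "i \<noteq> j" for i j
  proof -
    define g where "g x = u k (x j) / (1 + (\<Sum>l\<in>R k - {i}. a k (x l)))" for x :: "'i \<Rightarrow> 'x"
    have "u k (x i) * u k (x j) / N k x = u k (x i) * g x" for x
    proof (cases "a k (x i) = 0")
      case True then show ?thesis using abs_u_le[of k "x i"] by simp
    next
      case False
      then have "N k x = 1 + (\<Sum>l\<in>R k - {i}. a k (x l))"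
        unfolding N_def using sum.remove[OF fin_R ij(1), of "\<lambda>l. a k (x l)"] a_range[of k "x i"]
            by simp
      then show ?thesis unfolding g_def by simp
    qed
    then have "E (\<lambda>x. u k (x i) * u k (x j) / N k x) = E (\<lambda>x. u k (x i) * g x)" by simp
    also have "\<dots> = measure_pmf.expectation (p i) (u k) * E g"
    proof (rule E_indep)
      show "i \<in> I" using ij R_I by auto
      show "g (x(i := v)) = g x" for x v
      proof -
        have "(\<Sum>l\<in>R k - {i}. a k ((x(i := v)) l)) = (\<Sum>l\<in>R k - {i}. a k (x l))"
          by (intro sum.cong) auto
        then show ?thesis unfolding g_def using ij by simp
      qed
    qed
    finally show ?thesis using mean_u p_R[OF ij(1)] by simp
  qed
  have "E (\<lambda>x. (S k x)\<^sup>2 / N k x) = E (\<lambda>x. \<Sum>i\<in>R k. \<Sum>j\<in>R k. u k (x i) * u k (x j) / N k x)"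
    unfolding S_def by (simp add: power2_eq_square sum_product sum_divide_distrib)
  also have "\<dots> = (\<Sum>i\<in>R k. \<Sum>j\<in>R k. E (\<lambda>x. u k (x i) * u k (x j) / N k x))"
    by (simp only: E_sum)
  also have "\<dots> = (\<Sum>i\<in>R k. E (\<lambda>x. u k (x i) * u k (x i) / N k x))"
  proof (rule sum.cong[OF refl])
    fix i assume i: "i \<in> R k"
    show "(\<Sum>j\<in>R k. E (\<lambda>x. u k (x i) * u k (x j) / N k x)) = E (\<lambda>x. u k (x i) * u k (x i) / N k x)"
    proof -
      have "(\<Sum>j\<in>R k - {i}. E (\<lambda>x. u k (x i) * u k (x j) / N k x)) = 0"
        by (intro sum.neutral ballI off[OF i]) auto
      then show ?thesis
        using sum.remove[OF fin_R i, of "\<lambda>j. E (\<lambda>x. u k (x i) * u k (x j) / N k x)"] by simp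
    qed
  qed
  also have "\<dots> \<le> (\<Sum>i\<in>R k. E (\<lambda>x. a k (x i) / N k x))"
  proof (intro sum_mono E_mono divide_right_mono N_nonneg)
    fix i x
    have "u k (x i) * u k (x i) \<le> \<bar>u k (x i)\<bar> * 1"
      using abs_u_le_1[of k "x i"] by (metis abs_ge_self abs_ge_zero abs_mult mult_left_mono
          order_trans)
    then show "u k (x i) * u k (x i) \<le> a k (x i)" using abs_u_le[of k "x i"] by simp
  qed
  also have "\<dots> = E (\<lambda>x. \<Sum>i\<in>R k. a k (x i) / N k x)" by (simp only: E_sum)
  also have "\<dots> = E (\<lambda>x. N k x / N k x)" by (simp only: N_def sum_divide_distrib[symmetric])
  also have "\<dots> \<le> E (\<lambda>x. 1)" by (rule E_mono) simp
  finally show ?thesis by (simp add: E_const)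
qed

lemma E_Rem_sq: "E (\<lambda>x. (Rem x)\<^sup>2) \<le> (\<Sum>k<K. h k)"
proof -
  let ?B = "\<lambda>k x. (D k x / N k x - h k) * S k x"
  have off: "E (\<lambda>x. ?B k x * ?B l x) = 0" if kl: "k < l" "l < K" for k l
  proof -
    define F where "F x = ?B k x * (S l x / N l x)" for x
    have sub: "R l \<subseteq> R k" using kl R_antimono by simp
    have "symmetric_on (R l) F"
      using symmetric_D[OF kl(1)] symmetric_N[OF sub] symmetric_S[OF sub] symmetric_N[OF
          order_refl, of l] symmetric_S[OF order_refl, of l]
      unfolding F_def symmetric_on_def by simp
    note ED = E_D[OF kl(2) this]
    have "(\<lambda>x. ?B k x * ?B l x) = (\<lambda>x. D l x * F x - h l * (N l x * F x))"
    proof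
      fix x show "?B k x * ?B l x = D l x * F x - h l * (N l x * F x)"
      proof (cases "N l x = 0")
        case True
        then show ?thesis by (simp add: F_def S_zero)
      next
        case False
        then have "S l x = N l x * (S l x / N l x)" by simp
        then have "?B k x * ?B l x = ?B k x * (D l x / N l x - h l) * (N l x * (S l x / N l x))"
            by simp
        also have "\<dots> = F x * ((D l x / N l x) * N l x) - h l * (N l x * F x)"
          unfolding F_def by (simp only: algebra_simps)
        finally show ?thesis using False by (simp add: mult.commute)
      qed
    qed
    then show ?thesis using ED by (simp add: E_diff E_cmult)
  qed
  have off': "E (\<lambda>x. ?B k x * ?B l x) = 0" if "k \<noteq> l" "k < K" "l < K" for k l
    using off[of k l] off[of l k] that by (cases "k < l") (auto simp: mult.commute)
  have diag: "E (\<lambda>x. ?B k x * ?B k x) \<le> h k" if k: "k < K" for k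
  proof -
    have "E (\<lambda>x. ?B k x * ?B k x) = E (\<lambda>x. (D k x / N k x - h k)\<^sup>2 * (S k x)\<^sup>2)"
      by (simp add: power2_eq_square mult_ac)
    also have "\<dots> \<le> h k * E (\<lambda>x. (S k x)\<^sup>2 / N k x)"
      by (rule E_D_centered_sq[OF k])
        (use symmetric_S[OF order_refl, of k] S_zero in \<open>auto simp: symmetric_on_def\<close>)
    also have "\<dots> \<le> h k * 1" by (intro mult_left_mono E_S_sq h_nonneg)
    finally show ?thesis by simp
  qed
  have "E (\<lambda>x. (Rem x)\<^sup>2) = (\<Sum>k<K. \<Sum>l<K. E (\<lambda>x. ?B k x * ?B l x))"
    unfolding Rem_def power2_eq_square sum_product by (simp only: E_sum)
  also have "\<dots> = (\<Sum>k<K. E (\<lambda>x. ?B k x * ?B k x))"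
  proof (rule sum.cong[OF refl])
    fix k assume k: "k \<in> {..<K}"
    have "(\<Sum>l\<in>{..<K} - {k}. E (\<lambda>x. ?B k x * ?B l x)) = 0"
      by (intro sum.neutral ballI off') (use k in auto)
    then show "(\<Sum>l<K. E (\<lambda>x. ?B k x * ?B l x)) = E (\<lambda>x. ?B k x * ?B k x)"
      using sum.remove[OF finite_lessThan k, of "\<lambda>l. E (\<lambda>x. ?B k x * ?B l x)"] by simp
  qed
  also have "\<dots> \<le> (\<Sum>k<K. h k)" by (intro sum_mono diag) simp
  finally show ?thesis .
qed

text \<open>The limit of \<open>V k x / D k x\<close>.\<close>

definition "w k = (1 - h k) * \<phi> k * (1 - \<phi> k)"

lemma w_nonneg: "0 \<le> w k"
  unfolding w_def using h_le_1[of k] \<phi>_nonneg[of k] \<phi>_le[of k] by simp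

lemma w_le_1: "w k \<le> 1"
  unfolding w_def using h_le_1[of k] h_nonneg[of k] \<phi>_nonneg[of k] \<phi>_le[of k]
  by (intro mult_le_one) auto

lemma V_approx: "\<bar>V k x - D k x * w k\<bar> \<le> D k x / N k x + D k x * \<bar>D k x / N k x - h k\<bar>
    + D k x * (\<bar>S k x\<bar> / N k x)"
proof (cases rule: N_cases[of k x])
  case 1
  then show ?thesis using D_nonneg[of k x] D_le_N[of k x] by (simp add: V_def)
next
  case 2
  have "D k x = 0 \<or> D k x = 1" using D_nonneg[of k x] D_le_N[of k x] 2
      by (cases rule: D_cases[of k x]) auto
  moreover have "w k \<le> 1" "0 \<le> w k" using w_le_1 w_nonneg by auto
  ultimately show ?thesis using 2 by (auto simp: V_def)
next
  case 3
  define D' N' r q where "D' = D k x" and "N' = N k x" and "r = N1 k x / N k x" and "q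
      = D k x / N k x"
  have N: "2 \<le> N'" using 3 by (simp add: N'_def)
  have D: "0 \<le> D'" "D' \<le> N'" using D_nonneg D_le_N by (auto simp: D'_def N'_def)
  have r: "0 \<le> r" "r \<le> 1" using N1_nonneg[of k x] N1_le_N[of k x] 3 by (auto simp: r_def)
  have q: "0 \<le> q" "q \<le> 1" using D 3 by (auto simp: q_def D'_def N'_def)
  have rr: "0 \<le> r * (1 - r)" "r * (1 - r) \<le> 1" using r by (auto intro: mult_le_one)
  have V: "V k x = D' * ((N' - D') / (N' - 1)) * (r * (1 - r))"
    unfolding V_def r_def D'_def[symmetric] N'_def[symmetric] using N
        by (simp add: field_simps power2_eq_square)
  have "V k x - D k x * w k = D' * ((N' - D') / (N' - 1) - (1 - q)) * (r * (1 - r))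
      + D' * (h k - q) * (r * (1 - r))
     + D' * (1 - h k) * (r * (1 - r) - \<phi> k * (1 - \<phi> k))"
    unfolding V w_def D'_def[symmetric] by (simp add: algebra_simps)
  also have "\<bar>\<dots>\<bar> \<le> \<bar>D' * ((N' - D') / (N' - 1) - (1 - q)) * (r * (1 - r))\<bar>
      + \<bar>D' * (h k - q) * (r * (1 - r))\<bar> + \<bar>D' * (1 - h k) * (r * (1 - r) - \<phi> k * (1 - \<phi> k))\<bar>"
    by linarith
  also have "\<bar>D' * ((N' - D') / (N' - 1) - (1 - q)) * (r * (1 - r))\<bar> \<le> q"
  proof -
    have 1: "D' * ((N' - D') / (N' - 1) - (1 - q)) = q * ((N' - D') / (N' - 1))"
      unfolding q_def D'_def[symmetric] N'_def[symmetric] using N by (simp add: field_simps)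
    have "D' * ((N' - D') / (N' - 1) - (1 - q)) \<le> q \<and> 0 \<le> D' * ((N' - D') / (N' - 1) - (1 - q))"
    proof (cases rule: D_cases[of k x])
      case 1
      then show ?thesis by (simp add: q_def D'_def)
    next
      case 2
      then have "(N' - D') / (N' - 1) \<le> 1" "0 \<le> (N' - D') / (N' - 1)" using N D
          by (auto simp: D'_def)
      then show ?thesis unfolding 1 using q by (intro conjI mult_left_le mult_nonneg_nonneg)
    qed
    then have *: "D' * ((N' - D') / (N' - 1) - (1 - q)) \<le> q" "0
        \<le> D' * ((N' - D') / (N' - 1) - (1 - q))" by auto
    have "\<bar>D' * ((N' - D') / (N' - 1) - (1 - q)) * (r * (1 - r))\<bar>
        = D' * ((N' - D') / (N' - 1) - (1 - q)) * (r * (1 - r))"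
      using mult_nonneg_nonneg[OF *(2) rr(1)] by (rule abs_of_nonneg)
    also have "\<dots> \<le> D' * ((N' - D') / (N' - 1) - (1 - q))" using *(2) rr by (intro mult_left_le)
    finally show ?thesis using *(1) by linarith
  qed
  also have "\<bar>D' * (h k - q) * (r * (1 - r))\<bar> \<le> D' * \<bar>q - h k\<bar>"
  proof -
    have "\<bar>D' * (h k - q) * (r * (1 - r))\<bar> = (D' * \<bar>q - h k\<bar>) * (r * (1 - r))"
      using rr D r by (simp add: abs_mult abs_minus_commute)
    also have "\<dots> \<le> D' * \<bar>q - h k\<bar>" using rr D by (intro mult_left_le) auto
    finally show ?thesis .
  qed
  also have "\<bar>D' * (1 - h k) * (r * (1 - r) - \<phi> k * (1 - \<phi> k))\<bar> \<le> D' * (\<bar>S k x\<bar> / N')"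
  proof -
    have "r * (1 - r) - \<phi> k * (1 - \<phi> k) = (r - \<phi> k) * (1 - r - \<phi> k)" by (simp add: algebra_simps)
    then have "\<bar>r * (1 - r) - \<phi> k * (1 - \<phi> k)\<bar> = \<bar>r - \<phi> k\<bar> * \<bar>1 - r - \<phi> k\<bar>" by (simp add: abs_mult)
    also have "\<dots> \<le> \<bar>r - \<phi> k\<bar>" using r \<phi>_nonneg[of k] \<phi>_le[of k] by (intro mult_left_le) auto
    also have "\<dots> = \<bar>S k x\<bar> / N'"
    proof -
      have "S k x = (r - \<phi> k) * N'" using N by (simp add: S_eq r_def N'_def field_simps)
      then show ?thesis using N by (simp add: abs_mult)
    qed
    finally have 2: "\<bar>r * (1 - r) - \<phi> k * (1 - \<phi> k)\<bar> \<le> \<bar>S k x\<bar> / N'" .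
    have "\<bar>D' * (1 - h k) * (r * (1 - r) - \<phi> k * (1 - \<phi> k))\<bar>
        = D' * ((1 - h k) * \<bar>r * (1 - r) - \<phi> k * (1 - \<phi> k)\<bar>)"
      using D h_le_1[of k] by (simp add: abs_mult)
    also have "\<dots> \<le> D' * (1 * (\<bar>S k x\<bar> / N'))"
      using D 2 h_nonneg[of k] h_le_1[of k] by (intro mult_left_mono mult_mono) auto
    finally show ?thesis by simp
  qed
  finally show ?thesis unfolding D'_def N'_def q_def by simp
qed

lemma E_V_approx:
  assumes k: "k < K"
  shows "E (\<lambda>x. \<bar>V k x - D k x * w k\<bar>) \<le> 3 * (d k / sqrt (n k))"
proof -
  define c where "c = sqrt (n k)"
  have n: "1 \<le> n k" using n_ge_1[OF k] .
  have c: "1 \<le> c" "c * c = n k" using n by (auto simp: c_def)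
  have hc: "c * h k = d k / c" unfolding h_def c(2)[symmetric] using c(1) by simp
  have hle: "h k \<le> d k / c"
  proof -
    have "1 * h k \<le> c * h k" using c h_nonneg[of k] by (intro mult_right_mono) auto
    then show ?thesis using hc by simp
  qed
  have symN: "symmetric_on (R k) (\<lambda>x. f (N k x) (S k x))" for f :: "real \<Rightarrow> real \<Rightarrow> real"
    using symmetric_N[OF order_refl, of k] symmetric_S[OF order_refl, of k]
        unfolding symmetric_on_def by simp
  have E1: "E (\<lambda>x. D k x / N k x) \<le> h k"
  proof -
    have "E (\<lambda>x. D k x / N k x) = E (\<lambda>x. D k x * (1 / N k x))" by simp
    also have "\<dots> = h k * E (\<lambda>x. N k x * (1 / N k x))" by (rule E_D[OF k symN])
    also have "\<dots> \<le> h k * E (\<lambda>x. 1)" by (intro mult_left_mono h_nonneg E_mono) simp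
    finally show ?thesis by (simp add: E_const)
  qed
  have E2: "E (\<lambda>x. (D k x / N k x - h k)\<^sup>2 * N k x) \<le> h k"
  proof -
    have "E (\<lambda>x. (D k x / N k x - h k)\<^sup>2 * N k x) \<le> h k * E (\<lambda>x. N k x / N k x)"
      by (rule E_D_centered_sq[OF k symmetric_N[OF order_refl] N_nonneg])
    also have "\<dots> \<le> h k * E (\<lambda>x. 1)" by (intro mult_left_mono h_nonneg E_mono) simp
    finally show ?thesis by (simp add: E_const)
  qed
  have E3: "E (\<lambda>x. D k x * ((S k x)\<^sup>2 / (N k x)\<^sup>2)) \<le> h k"
  proof -
    have "E (\<lambda>x. D k x * ((S k x)\<^sup>2 / (N k x)\<^sup>2)) = h k * E (\<lambda>x. N k x * ((S k x)\<^sup>2 / (N k x)\<^sup>2))"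
      by (rule E_D[OF k symN])
    also have "(\<lambda>x. N k x * ((S k x)\<^sup>2 / (N k x)\<^sup>2)) = (\<lambda>x. (S k x)\<^sup>2 / N k x)"
      by (auto simp: power2_eq_square)
    also have "h k * E (\<lambda>x. (S k x)\<^sup>2 / N k x) \<le> h k * 1" by (intro mult_left_mono h_nonneg E_S_sq)
    finally show ?thesis by simp
  qed
  have amgm: "y \<le> (1 / c + c * y\<^sup>2) / 2" for y
  proof -
    have "0 \<le> (1 - c * y)\<^sup>2 / c" using c by simp
    then show ?thesis using c by (simp add: field_simps power2_eq_square)
  qed
  have "\<bar>V k x - D k x * w k\<bar> \<le> D k x / N k x + (1/2) * ((1 / c) * D k x
      + c * ((D k x / N k x - h k)\<^sup>2 * N k x))
      + (1/2) * ((1 / c) * D k x + c * (D k x * ((S k x)\<^sup>2 / (N k x)\<^sup>2)))" for x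
  proof -
    have 1: "D k x * \<bar>D k x / N k x - h k\<bar> \<le> ((1 / c) * D k x
        + c * ((D k x / N k x - h k)\<^sup>2 * N k x)) / 2"
    proof (cases "N k x = 0")
      case True
      then show ?thesis using D_nonneg[of k x] D_le_N[of k x] by simp
    next
      case False
      define q where "q = D k x / N k x"
      have N: "0 < N k x" using False N_nonneg[of k x] by simp
      have q: "0 \<le> q" "q \<le> 1" "D k x = q * N k x" using D_nonneg[of k x] D_le_N[of k x] N
          by (auto simp: q_def)
      have "q * \<bar>q - h k\<bar> \<le> (1 / c * q\<^sup>2 + c * (q - h k)\<^sup>2) / 2"
      proof -
        have "0 \<le> (q - c * \<bar>q - h k\<bar>)\<^sup>2 / c" using c by simp
        then show ?thesis using c by (simp add: field_simps power2_eq_square)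
      qed
      also have "\<dots> \<le> (1 / c * q + c * (q - h k)\<^sup>2) / 2"
      proof -
        have "q\<^sup>2 \<le> q" using q by (simp add: power2_eq_square mult_left_le)
        then have "1 / c * q\<^sup>2 \<le> 1 / c * q" using c by (intro mult_left_mono) auto
        then show ?thesis by (intro divide_right_mono add_right_mono) auto
      qed
      finally have "q * \<bar>q - h k\<bar> * N k x \<le> (1 / c * q + c * (q - h k)\<^sup>2) / 2 * N k x"
        using N by (intro mult_right_mono) auto
      then show ?thesis unfolding q_def[symmetric] unfolding q(3) by (simp add: algebra_simps)
    qed
    have 2: "D k x * (\<bar>S k x\<bar> / N k x) \<le> ((1 / c) * D k x
        + c * (D k x * ((S k x)\<^sup>2 / (N k x)\<^sup>2))) / 2"
    proof -
      have "D k x * (\<bar>S k x\<bar> / N k x) \<le> D k x * ((1 / c + c * (\<bar>S k x\<bar> / N k x)\<^sup>2) / 2)"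
        by (intro mult_left_mono amgm D_nonneg)
      then show ?thesis by (simp add: power_divide algebra_simps)
    qed
    have "v \<le> A + B + C \<Longrightarrow> B \<le> P / 2 \<Longrightarrow> C \<le> Q / 2 \<Longrightarrow> v \<le> A + (1/2) * P
        + (1/2) * Q" for v A B C P Q :: real
      by simp
    from this[OF V_approx 1 2] show ?thesis .
  qed
  then have "E (\<lambda>x. \<bar>V k x - D k x * w k\<bar>) \<le> E (\<lambda>x. D k x / N k x + (1/2) * ((1 / c) * D k x
      + c * ((D k x / N k x - h k)\<^sup>2 * N k x))
      + (1/2) * ((1 / c) * D k x + c * (D k x * ((S k x)\<^sup>2 / (N k x)\<^sup>2))))"
    by (rule E_mono)
  also have "\<dots> = E (\<lambda>x. D k x / N k x) + (1/2) * ((1 / c) * E (D k)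
      + c * E (\<lambda>x. (D k x / N k x - h k)\<^sup>2 * N k x))
     + (1/2) * ((1 / c) * E (D k) + c * E (\<lambda>x. D k x * ((S k x)\<^sup>2 / (N k x)\<^sup>2)))"
    by (simp only: E_add E_cmult)
  also have "\<dots> \<le> d k / c + (1/2) * (d k / c + d k / c) + (1/2) * (d k / c + d k / c)"
  proof -
    have "E (D k) \<le> d k" using E_mono[of "D k" "\<lambda>_. d k"] D_le_d by (simp add: E_const)
    then have 1: "(1 / c) * E (D k) \<le> d k / c" using c by (simp add: divide_right_mono)
    have 2: "c * E (\<lambda>x. (D k x / N k x - h k)\<^sup>2 * N k x)
        \<le> d k / c" "c * E (\<lambda>x. D k x * ((S k x)\<^sup>2 / (N k x)\<^sup>2)) \<le> d k / c"
      unfolding hc[symmetric] using E2 E3 c by (auto intro: mult_left_mono)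
    show ?thesis using 1 2 order_trans[OF E1 hle] by (intro add_mono mult_left_mono) auto
  qed
  finally show ?thesis by (simp add: c_def)
qed

lemma E_weighted_D: "E (\<lambda>x. \<bar>(\<Sum>k<K. D k x * w k) - \<sigma>2\<bar>) \<le> sqrt \<sigma>2"
proof -
  define f where "f i v = w (e i) * (a (e i) v - \<pi> (e i))" for i v
  have grp: "(\<Sum>k<K. \<Sum>i\<in>Ev k. g i) = (\<Sum>i\<in>J. g i)" for g :: "'i \<Rightarrow> real"
    unfolding Ev_def by (rule sum.group) (use fin_J e_J in auto)
  have "\<sigma>2 = (\<Sum>k<K. \<Sum>i\<in>Ev k. w (e i) * \<pi> (e i))"
    unfolding \<sigma>2_def by (intro sum.cong) (auto simp: Ev_def d_def \<tau>_def w_def)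
  then have s: "\<sigma>2 = (\<Sum>i\<in>J. w (e i) * \<pi> (e i))" by (simp add: grp)
  have "(\<Sum>k<K. D k x * w k) = (\<Sum>k<K. \<Sum>i\<in>Ev k. w (e i) * a (e i) (x i))" for x
    unfolding D_def sum_distrib_right by (intro sum.cong) (auto simp: Ev_def)
  then have Y: "(\<Sum>k<K. D k x * w k) - \<sigma>2 = (\<Sum>i\<in>J. f i (x i))" for x
    unfolding grp s f_def by (simp add: sum_subtractf algebra_simps)
  have mean: "measure_pmf.expectation (p i) (f i) = 0" if "i \<in> J" for i
    unfolding f_def p_eq[OF that] using integrable_P by (simp add: \<pi>_def)
  have "E (\<lambda>x. (\<Sum>i\<in>J. f i (x i))\<^sup>2) = (\<Sum>i\<in>J. measure_pmf.expectation (p i) (\<lambda>v. (f i v)\<^sup>2))"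
    by (rule E_indep_sum_sq[OF J_sub mean])
  also have "\<dots> \<le> (\<Sum>i\<in>J. w (e i) * \<pi> (e i))"
  proof (rule sum_mono)
    fix i assume i: "i \<in> J"
    define W Q where "W = w (e i)" and "Q = \<pi> (e i)"
    have W: "0 \<le> W" "W \<le> 1" and Q: "0 \<le> Q" "Q \<le> 1" using w_nonneg w_le_1 \<pi>_nonneg \<pi>_le_1
        by (auto simp: W_def Q_def)
    have "(f i v)\<^sup>2 = W\<^sup>2 * ((1 - 2 * Q) * a (e i) v + Q\<^sup>2)" for v
      unfolding f_def W_def[symmetric] Q_def[symmetric] using a_range[of "e i" v]
      by (auto simp: power2_eq_square algebra_simps)
    then have "measure_pmf.expectation (p i) (\<lambda>v. (f i v)\<^sup>2) = W\<^sup>2 * ((1 - 2 * Q) * Q + Q\<^sup>2)"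
      unfolding p_eq[OF i] using integrable_P by (simp add: Q_def \<pi>_def)
    also have "\<dots> = (W * (1 - Q)) * W * Q" by (simp add: power2_eq_square algebra_simps)
    also have "\<dots> \<le> 1 * W * Q" using W Q by (intro mult_right_mono) (auto intro: mult_le_one)
    finally show "measure_pmf.expectation (p i) (\<lambda>v. (f i v)\<^sup>2) \<le> w (e i) * \<pi> (e i)"
        by (simp add: W_def Q_def)
  qed
  finally have "E (\<lambda>x. (\<Sum>i\<in>J. f i (x i))\<^sup>2) \<le> \<sigma>2" by (simp add: s)
  then show ?thesis unfolding Y using E_abs_le_sqrt[of "\<lambda>x. \<Sum>i\<in>J. f i (x i)"] real_sqrt_le_mono
      order_trans by blast
qed

lemma sum_d_sqrt_n: "(\<Sum>k<K. d k / sqrt (n k)) \<le> 2 * sqrt (real (card J))"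
proof -
  have "d k / sqrt (n k) \<le> 2 * (sqrt (n k) - sqrt (n (Suc k)))" if "k < K" for k
  proof -
    define A B where "A = sqrt (n k)" and "B = sqrt (n (Suc k))"
    have A: "0 < A" using n_ge_1[OF that] by (simp add: A_def)
    have B: "0 \<le> B" by (simp add: B_def n_def)
    have nA: "n k = A * A" and nB: "n (Suc k) = B * B" by (auto simp: A_def B_def n_def)
    have "d k = A * A - B * B" using n_Suc[of k] nA nB by simp
    moreover have "A * A - B * B \<le> 2 * (A - B) * A"
      using zero_le_square[of "A - B"] by (simp add: algebra_simps)
    ultimately show ?thesis unfolding A_def[symmetric] B_def[symmetric] using A
        by (simp add: divide_le_eq)
  qed
  then have "(\<Sum>k<K. d k / sqrt (n k)) \<le> (\<Sum>k<K. 2 * (sqrt (n k) - sqrt (n (Suc k))))"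
    by (intro sum_mono) simp
  also have "\<dots> = 2 * (sqrt (n 0) - sqrt (n K))"
    using sum_lessThan_telescope'[of "\<lambda>k. sqrt (n k)" K] by (simp only: sum_distrib_left[symmetric])
  also have "\<dots> \<le> 2 * sqrt (n 0)" by (simp add: n_def)
  finally show ?thesis by (simp add: n_0)
qed

lemma sum_h_le: "(\<Sum>k<K. h k) \<le> 2 * sqrt (real (card J))"
proof -
  have "h k \<le> d k / sqrt (n k)" if "k < K" for k
  proof -
    have "sqrt (n k) \<le> n k" using n_ge_1[OF that] by (simp add: real_le_lsqrt power2_eq_square)
    then show ?thesis unfolding h_def using n_ge_1[OF that] d_ge_1[OF that]
        by (intro divide_left_mono) auto
  qed
  then have "(\<Sum>k<K. h k) \<le> (\<Sum>k<K. d k / sqrt (n k))" by (intro sum_mono) simp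
  then show ?thesis using sum_d_sqrt_n by linarith
qed

lemma sum_h_le_ln: "(\<Sum>k<K. h k) \<le> 1 + ln (real (card J))"
proof (cases K)
  case 0
  then have "J = {}" using e_J by simp
  with 0 show ?thesis by simp
next
  case (Suc K')
  have "h k \<le> ln (n k) - ln (n (Suc k))" if "k < K'" for k
  proof -
    have 1: "1 \<le> n k" "1 \<le> n (Suc k)" using n_ge_1 that Suc by auto
    have "ln (n (Suc k) / n k) \<le> n (Suc k) / n k - 1" using 1 by (intro ln_le_minus_one) auto
    moreover have "h k = 1 - n (Suc k) / n k" unfolding h_def n_Suc using 1
        by (simp add: field_simps)
    ultimately show ?thesis using 1 by (simp add: ln_div)
  qed
  then have "(\<Sum>k<K'. h k) \<le> (\<Sum>k<K'. ln (n k) - ln (n (Suc k)))" by (intro sum_mono) simp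
  also have "\<dots> = ln (n 0) - ln (n K')" by (rule sum_lessThan_telescope')
  also have "\<dots> \<le> ln (n 0)" using n_ge_1[of K'] Suc by simp
  finally show ?thesis using Suc h_le_1[of K'] by (simp add: n_0)
qed

lemma E_U: "E (\<lambda>x. \<bar>U x - \<sigma>2\<bar>) \<le> 6 * sqrt (real (card J)) + sqrt \<sigma>2"
proof -
  have "\<bar>U x - \<sigma>2\<bar> \<le> (\<Sum>k<K. \<bar>V k x - D k x * w k\<bar>) + \<bar>(\<Sum>k<K. D k x * w k) - \<sigma>2\<bar>" for x
  proof -
    have "U x - \<sigma>2 = (\<Sum>k<K. V k x - D k x * w k) + ((\<Sum>k<K. D k x * w k) - \<sigma>2)"
      unfolding U_def by (simp add: sum_subtractf)
    then show ?thesis using sum_abs[of "\<lambda>k. V k x - D k x * w k" "{..<K}"] by linarith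
  qed
  then have "E (\<lambda>x. \<bar>U x - \<sigma>2\<bar>) \<le> E (\<lambda>x. (\<Sum>k<K. \<bar>V k x - D k x * w k\<bar>)
      + \<bar>(\<Sum>k<K. D k x * w k) - \<sigma>2\<bar>)"
    by (rule E_mono)
  also have "\<dots> = (\<Sum>k<K. E (\<lambda>x. \<bar>V k x - D k x * w k\<bar>)) + E (\<lambda>x. \<bar>(\<Sum>k<K. D k x * w k) - \<sigma>2\<bar>)"
    by (simp only: E_add E_sum)
  also have "\<dots> \<le> (\<Sum>k<K. 3 * (d k / sqrt (n k))) + sqrt \<sigma>2"
    by (intro add_mono sum_mono E_V_approx E_weighted_D) simp
  also have "\<dots> \<le> 6 * sqrt (real (card J)) + sqrt \<sigma>2"
    using sum_d_sqrt_n unfolding sum_distrib_left[symmetric] by linarith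
  finally show ?thesis .
qed

lemma mean_\<xi>: "measure_pmf.expectation P (\<xi> i) = 0"
  unfolding \<xi>_def using integrable_P by (simp add: mean_u)

lemma abs_\<xi>_le:
  assumes "i \<in> J"
  shows "\<bar>\<xi> i v\<bar> \<le> 2 + ln (real (card J))"
proof -
  have "\<bar>\<xi> i v\<bar> \<le> (\<Sum>k<K. \<bar>u k v * b i k\<bar>)" unfolding \<xi>_def by (rule sum_abs)
  also have "\<dots> \<le> (\<Sum>k<K. of_bool (k = e i) + h k)"
  proof (rule sum_mono)
    fix k
    have "\<bar>u k v * b i k\<bar> \<le> 1 * \<bar>b i k\<bar>" unfolding abs_mult
        by (intro mult_right_mono abs_u_le_1) simp
    also have "\<dots> \<le> of_bool (k = e i) + h k" unfolding b_def using h_nonneg[of k] h_le_1[of k]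
        by auto
    finally show "\<bar>u k v * b i k\<bar> \<le> of_bool (k = e i) + h k" .
  qed
  also have "\<dots> = 1 + (\<Sum>k<K. h k)" using e_less[OF assms] by (simp add: sum.distrib)
  finally show ?thesis using sum_h_le_ln by linarith
qed

lemma sum_second_moment_\<xi>: "(\<Sum>i\<in>J. measure_pmf.expectation P (\<lambda>v. (\<xi> i v)\<^sup>2)) = \<sigma>2"
proof -
  define c where "c k l = measure_pmf.expectation P (\<lambda>v. u k v * u l v)" for k l
  have sum_b: "(\<Sum>i\<in>J. b i l) = 0" if l: "l < K" for l
  proof -
    have "(\<Sum>i\<in>J. b i l) = (\<Sum>i\<in>R l. of_bool (e i = l) - h l)"
      by (rule sum.mono_neutral_cong_right[OF fin_J R_J]) (auto simp: R_def b_def)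
    also have "\<dots> = (\<Sum>i\<in>R l. of_bool (e i = l)) - n l * h l" by (simp add: sum_subtractf n_def)
    also have "(\<Sum>i\<in>R l. of_bool (e i = l)) = (\<Sum>i\<in>Ev l. 1 :: real)"
      by (rule sum.mono_neutral_cong_right[OF fin_R Ev_R]) (auto simp: R_def Ev_def)
    finally show ?thesis using n_ge_1[OF l] by (simp add: h_def d_def)
  qed
  have off: "(\<Sum>i\<in>J. b i k * b i l) = 0" if kl: "k < l" "l < K" for k l
  proof -
    have "b i k * b i l = - h k * b i l" for i unfolding b_def using kl by auto
    then have "(\<Sum>i\<in>J. b i k * b i l) = - h k * (\<Sum>i\<in>J. b i l)" by (simp only: sum_distrib_left)
    then show ?thesis using sum_b[OF kl(2)] by simp
  qed
  have diag: "(\<Sum>i\<in>J. b i k * b i k) = d k * (1 - h k)" if k: "k < K" for k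
  proof -
    have "b i k * b i k = of_bool (e i = k) * (1 - h k) - h k * b i k" for i
      unfolding b_def by (auto simp: algebra_simps)
    then have "(\<Sum>i\<in>J. b i k * b i k) = (\<Sum>i\<in>J. of_bool (e i = k) * (1 - h k)) - h k * (\<Sum>i\<in>J. b i k)"
      by (simp only: sum_subtractf sum_distrib_left)
    also have "(\<Sum>i\<in>J. of_bool (e i = k) * (1 - h k)) = (\<Sum>i\<in>Ev k. 1 - h k)"
      by (rule sum.mono_neutral_cong_right[OF fin_J]) (auto simp: Ev_def)
    finally show ?thesis using sum_b[OF k] by (simp add: d_def)
  qed
  have "measure_pmf.expectation P (\<lambda>v. (\<xi> i v)\<^sup>2) = (\<Sum>k<K. \<Sum>l<K. c k l * (b i k * b i l))" for i
  proof -
    have "(\<lambda>v. (\<xi> i v)\<^sup>2) = (\<lambda>v. \<Sum>k<K. \<Sum>l<K. (u k v * u l v) * (b i k * b i l))"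
      unfolding \<xi>_def power2_eq_square sum_product by (simp add: mult_ac)
    then show ?thesis using integrable_P by (simp add: c_def)
  qed
  then have "(\<Sum>i\<in>J. measure_pmf.expectation P (\<lambda>v. (\<xi> i v)\<^sup>2))
      = (\<Sum>i\<in>J. \<Sum>k<K. \<Sum>l<K. c k l * (b i k * b i l))"
    by simp
  also have "\<dots> = (\<Sum>k<K. \<Sum>i\<in>J. \<Sum>l<K. c k l * (b i k * b i l))" by (rule sum.swap)
  also have "\<dots> = (\<Sum>k<K. \<Sum>l<K. \<Sum>i\<in>J. c k l * (b i k * b i l))" by (intro sum.cong refl sum.swap)
  also have "\<dots> = (\<Sum>k<K. \<Sum>l<K. c k l * (\<Sum>i\<in>J. b i k * b i l))" by (simp only: sum_distrib_left)
  also have "\<dots> = (\<Sum>k<K. c k k * (d k * (1 - h k)))"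
  proof (rule sum.cong[OF refl])
    fix k assume k: "k \<in> {..<K}"
    have "(\<Sum>i\<in>J. b i k * b i l) = 0" if "l \<in> {..<K} - {k}" for l
      using off[of k l] off[of l k] that k by (cases "k < l") (auto simp: mult.commute)
    then have "(\<Sum>l\<in>{..<K} - {k}. c k l * (\<Sum>i\<in>J. b i k * b i l)) = 0" by (intro sum.neutral) auto
    then show "(\<Sum>l<K. c k l * (\<Sum>i\<in>J. b i k * b i l)) = c k k * (d k * (1 - h k))"
      using sum.remove[OF finite_lessThan k, of "\<lambda>l. c k l * (\<Sum>i\<in>J. b i k * b i l)"] diag k by simp
  qed
  also have "\<dots> = \<sigma>2"
    unfolding \<sigma>2_def c_def using second_moment_u by (simp add: power2_eq_square mult_ac)
  finally show ?thesis .
qed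

lemma \<sigma>2_nonneg: "0 \<le> \<sigma>2"
  unfolding \<sigma>2_def using h_le_1 \<tau>_nonneg by (intro sum_nonneg mult_nonneg_nonneg) (auto simp: d_def)

lemma \<tau>_ge: "\<pi>1 k * (\<pi> k - \<pi>1 k) \<le> \<tau> k"
proof -
  have "\<pi>1 k * (\<pi> k - \<pi>1 k) = \<tau> k * \<pi> k"
    unfolding \<tau>_def \<phi>_\<pi>[symmetric] by (simp add: algebra_simps)
  also have "\<dots> \<le> \<tau> k" using \<tau>_nonneg \<pi>_le_1 \<pi>_nonneg by (intro mult_left_le) auto
  finally show ?thesis .
qed

lemma \<sigma>2_ge_term:
  assumes "k < K" "\<pi>1 k * (\<pi> k - \<pi>1 k) = c * g"
  shows "c * (d k * (1 - h k) * g) \<le> \<sigma>2"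
proof -
  have nn: "0 \<le> d k * (1 - h k)" for k using h_le_1[of k] by (simp add: d_def)
  have "c * (d k * (1 - h k) * g) = d k * (1 - h k) * (\<pi>1 k * (\<pi> k - \<pi>1 k))" by (simp add: assms(2))
  also have "\<dots> \<le> d k * (1 - h k) * \<tau> k" by (intro mult_left_mono \<tau>_ge nn)
  also have "\<dots> \<le> \<sigma>2" unfolding \<sigma>2_def
    by (rule member_le_sum) (use assms nn \<tau>_nonneg in \<open>auto intro: mult_nonneg_nonneg\<close>)
  finally show ?thesis .
qed

lemma \<sigma>2_ge_sum:
  assumes g: "\<And>k. k < K \<Longrightarrow> \<pi>1 k * (\<pi> k - \<pi>1 k) = c * g k" "\<And>k. k < K \<Longrightarrow> 0 \<le> g k \<and> g k \<le> 1"
    and c: "0 \<le> c" and dm: "\<And>k. k < K \<Longrightarrow> d k \<le> dm" "0 \<le> dm"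
  shows "c * ((\<Sum>k<K. d k * g k) - 2 * dm * sqrt (real (card J))) \<le> \<sigma>2"
proof -
  have "(\<Sum>k<K. d k * h k * g k) \<le> (\<Sum>k<K. dm * h k)"
  proof (rule sum_mono)
    fix k assume k: "k \<in> {..<K}"
    have "d k * h k * g k \<le> d k * h k * 1"
      using g(2)[of k] k h_nonneg[of k] by (intro mult_left_mono) (auto simp: d_def)
    also have "\<dots> \<le> dm * h k" using dm(1)[of k] k h_nonneg[of k] by (auto intro: mult_right_mono)
    finally show "d k * h k * g k \<le> dm * h k" .
  qed
  also have "\<dots> = dm * (\<Sum>k<K. h k)" by (simp add: sum_distrib_left)
  also have "\<dots> \<le> dm * (2 * sqrt (real (card J)))" by (intro mult_left_mono sum_h_le dm)
  finally have 1: "(\<Sum>k<K. d k * h k * g k) \<le> 2 * dm * sqrt (real (card J))" by simp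
  have "(\<Sum>k<K. d k * g k) - (\<Sum>k<K. d k * h k * g k) = (\<Sum>k<K. d k * (1 - h k) * g k)"
    by (simp add: sum_subtractf[symmetric] algebra_simps)
  with 1 have "c * ((\<Sum>k<K. d k * g k) - 2 * dm * sqrt (real (card J)))
      \<le> c * (\<Sum>k<K. d k * (1 - h k) * g k)"
    using c by (intro mult_left_mono) auto
  also have "\<dots> = (\<Sum>k<K. d k * (1 - h k) * (c * g k))" by (simp add: sum_distrib_left mult_ac)
  also have "\<dots> \<le> \<sigma>2" unfolding \<sigma>2_def
  proof (rule sum_mono)
    fix k assume "k \<in> {..<K}"
    then have "c * g k = \<pi>1 k * (\<pi> k - \<pi>1 k)" using g(1) by simp
    then show "d k * (1 - h k) * (c * g k) \<le> d k * (1 - h k) * \<tau> k"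
      using \<tau>_ge[of k] h_le_1[of k] by (intro mult_left_mono) (auto simp: d_def)
  qed
  finally show ?thesis .
qed

end

section \<open>Combination of strata\<close>

context finite_product
begin

lemma stratified_char_bound:
  fixes S :: nat and st :: "'i \<Rightarrow> nat" and J :: "nat \<Rightarrow> 'i set" and P e K x1 a
  assumes str: "\<And>s. s < S \<Longrightarrow> stratum I p (J s) (P s) (e s) (K s) (x1 s) (a s)"
    and st: "\<And>i. i \<in> I \<Longrightarrow> st i < S" and J: "\<And>s. s < S \<Longrightarrow> J s = {i \<in> I. st i = s}"
  defines "\<sigma>2 \<equiv> \<lambda>s. stratum.\<sigma>2 (J s) (P s) (e s) (K s) (x1 s) (a s)"
  defines "v \<equiv> \<Sum>s<S. \<sigma>2 s"
  assumes v: "0 < v" and \<delta>: "0 < \<delta>" "\<delta> \<le> 1/2"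
    and B: "0 \<le> B" "\<And>s. s < S \<Longrightarrow> 2 + ln (real (card (J s))) \<le> B"
  shows "cmod (measure_pmf.expectation (Pi_pmf I dflt p) (\<lambda>x. iexp (t *
      ((\<Sum>s<S. stratum.L (J s) (e s) (K s) (x1 s) (a s) x) / sqrt (\<Sum>s<S. stratum.U (J s) (e s) (K
          s) (x1 s) (a s) x))))
      - exp (- (t\<^sup>2) / 2))
    \<le> \<bar>t\<bar> ^ 3 * (B / sqrt v) + t ^ 4 * (B / sqrt v)\<^sup>2
      + \<bar>t\<bar> * (2 * \<delta> + 2 * (\<Sum>s<S. sqrt (2 * sqrt (real (card (J s)))) / sqrt v))
      + 2 / \<delta> * (\<Sum>s<S. (6 * sqrt (real (card (J s))) + sqrt (\<sigma>2 s)) / v)"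
proof -
  define L U Rem \<xi> where "L s = stratum.L (J s) (e s) (K s) (x1 s) (a s)"
    and "U s = stratum.U (J s) (e s) (K s) (x1 s) (a s)"
    and "Rem s = stratum.Rem (J s) (P s) (e s) (K s) (x1 s) (a s)"
    and "\<xi> s = stratum.\<xi> (J s) (P s) (e s) (K s) (x1 s) (a s)" for s
  define \<sigma> where "\<sigma> = sqrt v"
  have \<sigma>: "0 < \<sigma>" "\<sigma> * \<sigma> = v" using v by (auto simp: \<sigma>_def)
  have grp: "(\<Sum>s<S. \<Sum>i\<in>J s. g i) = (\<Sum>i\<in>I. g i)" for g :: "'i \<Rightarrow> real"
  proof -
    have "(\<Sum>s<S. \<Sum>i\<in>J s. g i) = (\<Sum>s<S. \<Sum>i\<in>{i \<in> I. st i = s}. g i)"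
      by (intro sum.cong refl) (auto simp: J)
    also have "\<dots> = (\<Sum>i\<in>I. g i)" by (rule sum.group) (use st finite_I in auto)
    finally show ?thesis .
  qed
  define f where "f i y = \<xi> (st i) i y / \<sigma>" for i y
  have p_st: "p i = P (st i)" "i \<in> J (st i)" if "i \<in> I" for i
    using stratum.p_eq[OF str[OF st[OF that]], of i] that J[OF st[OF that]] by auto
  have mean: "measure_pmf.expectation (p i) (f i) = 0" if "i \<in> I" for i
    unfolding f_def p_st(1)[OF that] using stratum.mean_\<xi>[OF str[OF st[OF that]]]
        by (simp add: \<xi>_def)
  have bound: "\<bar>f i y\<bar> \<le> B / \<sigma>" if "i \<in> I" for i y
  proof -
    have "\<bar>\<xi> (st i) i y\<bar> \<le> B"
      using stratum.abs_\<xi>_le[OF str[OF st[OF that]] p_st(2)[OF that]] B(2)[OF st[OF that]]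
          order_trans unfolding \<xi>_def by blast
    then show ?thesis unfolding f_def using \<sigma> by (simp add: divide_right_mono)
  qed
  have var: "(\<Sum>i\<in>I. measure_pmf.expectation (p i) (\<lambda>y. (f i y)\<^sup>2)) = 1"
  proof -
    have "(\<Sum>i\<in>I. measure_pmf.expectation (p i) (\<lambda>y. (f i y)\<^sup>2))
        = (\<Sum>s<S. \<Sum>i\<in>J s. measure_pmf.expectation (p i) (\<lambda>y. (f i y)\<^sup>2))"
      by (rule grp[symmetric])
    also have "\<dots> = (\<Sum>s<S. \<Sum>i\<in>J s. measure_pmf.expectation (P s) (\<lambda>y. (\<xi> s i y)\<^sup>2) / v)"
    proof (intro sum.cong refl)
      fix s i assume "s \<in> {..<S}" "i \<in> J s"
      then have "p i = P s" "st i = s" using p_st J by auto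
      then show "measure_pmf.expectation (p i) (\<lambda>y. (f i y)\<^sup>2)
          = measure_pmf.expectation (P s) (\<lambda>y. (\<xi> s i y)\<^sup>2) / v"
        unfolding f_def by (simp add: power_divide power2_eq_square \<sigma>(2))
    qed
    also have "\<dots> = (\<Sum>s<S. \<sigma>2 s / v)"
    proof (rule sum.cong[OF refl])
      fix s assume "s \<in> {..<S}"
      then show "(\<Sum>i\<in>J s. measure_pmf.expectation (P s) (\<lambda>y. (\<xi> s i y)\<^sup>2) / v) = \<sigma>2 s / v"
        using stratum.sum_second_moment_\<xi>[OF str, of s] unfolding \<xi>_def \<sigma>2_def
            by (simp add: sum_divide_distrib[symmetric])
    qed
    also have "\<dots> = 1" using v by (simp add: sum_divide_distrib[symmetric] v_def)
    finally show ?thesis .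
  qed
  define X where "X x = (\<Sum>i\<in>I. f i (x i))" for x
  define \<rho> where "\<rho> x = (\<Sum>s<S. Rem s x) / \<sigma>" for x
  define w where "w x = (\<Sum>s<S. U s x) / v" for x
  define Y where "Y x = (\<Sum>s<S. L s x) / sqrt (\<Sum>s<S. U s x)" for x
  have EX: "E (\<lambda>x. \<bar>X x\<bar>) \<le> 1"
  proof -
    have "E (\<lambda>x. (X x)\<^sup>2) = 1" unfolding X_def
        by (subst E_indep_sum_sq[OF order_refl mean]) (use var in auto)
    then show ?thesis using E_abs_le_sqrt[of X] by simp
  qed
  have E\<rho>: "E (\<lambda>x. \<bar>\<rho> x\<bar>) \<le> (\<Sum>s<S. sqrt (2 * sqrt (real (card (J s)))) / \<sigma>)"
  proof -
    have "\<bar>\<rho> x\<bar> \<le> (\<Sum>s<S. (1 / \<sigma>) * \<bar>Rem s x\<bar>)" for x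
    proof -
      have "\<bar>\<rho> x\<bar> = \<bar>\<Sum>s<S. Rem s x\<bar> * (1 / \<sigma>)" unfolding \<rho>_def using \<sigma> by (simp add: abs_divide)
      also have "\<dots> \<le> (\<Sum>s<S. \<bar>Rem s x\<bar>) * (1 / \<sigma>)" using \<sigma> by (intro mult_right_mono sum_abs) simp
      finally show ?thesis by (simp add: sum_distrib_left mult.commute)
    qed
    then have "E (\<lambda>x. \<bar>\<rho> x\<bar>) \<le> E (\<lambda>x. \<Sum>s<S. (1 / \<sigma>) * \<bar>Rem s x\<bar>)" by (rule E_mono)
    also have "\<dots> = (\<Sum>s<S. (1 / \<sigma>) * E (\<lambda>x. \<bar>Rem s x\<bar>))" by (simp only: E_sum E_cmult)
    also have "\<dots> \<le> (\<Sum>s<S. (1 / \<sigma>) * sqrt (2 * sqrt (real (card (J s)))))"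
    proof (intro sum_mono mult_left_mono)
      fix s assume s: "s \<in> {..<S}"
      have "E (\<lambda>x. (Rem s x)\<^sup>2) \<le> 2 * sqrt (real (card (J s)))"
        unfolding Rem_def by (rule order_trans[OF stratum.E_Rem_sq[OF str] stratum.sum_h_le[OF
            str]]) (use s in auto)
      then show "E (\<lambda>x. \<bar>Rem s x\<bar>) \<le> sqrt (2 * sqrt (real (card (J s))))"
        using E_abs_le_sqrt[of "Rem s"] real_sqrt_le_mono order_trans by blast
    qed (use \<sigma> in auto)
    finally show ?thesis by simp
  qed
  have Ew: "E (\<lambda>x. \<bar>w x - 1\<bar>) \<le> (\<Sum>s<S. (6 * sqrt (real (card (J s))) + sqrt (\<sigma>2 s)) / v)"
  proof -
    have "\<bar>w x - 1\<bar> \<le> (\<Sum>s<S. (1 / v) * \<bar>U s x - \<sigma>2 s\<bar>)" for x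
    proof -
      have "w x - 1 = ((\<Sum>s<S. U s x) - v) / v" unfolding w_def using v
          by (simp add: diff_divide_distrib)
      also have "\<dots> = (\<Sum>s<S. U s x - \<sigma>2 s) / v" by (simp add: v_def sum_subtractf)
      finally have "\<bar>w x - 1\<bar> = \<bar>\<Sum>s<S. U s x - \<sigma>2 s\<bar> * (1 / v)" using v by (simp add: abs_divide)
      also have "\<dots> \<le> (\<Sum>s<S. \<bar>U s x - \<sigma>2 s\<bar>) * (1 / v)" using v
          by (intro mult_right_mono sum_abs) simp
      finally show ?thesis by (simp add: sum_distrib_left mult.commute)
    qed
    then have "E (\<lambda>x. \<bar>w x - 1\<bar>) \<le> E (\<lambda>x. \<Sum>s<S. (1 / v) * \<bar>U s x - \<sigma>2 s\<bar>)" by (rule E_mono)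
    also have "\<dots> = (\<Sum>s<S. (1 / v) * E (\<lambda>x. \<bar>U s x - \<sigma>2 s\<bar>))" by (simp only: E_sum E_cmult)
    also have "\<dots> \<le> (\<Sum>s<S. (1 / v) * (6 * sqrt (real (card (J s))) + sqrt (\<sigma>2 s)))"
      using stratum.E_U[OF str] v unfolding U_def \<sigma>2_def by (intro sum_mono mult_left_mono) auto
    finally show ?thesis by simp
  qed
  have Y: "Y x = (X x - \<rho> x) / sqrt (w x)" if "0 < w x" for x
  proof -
    have U: "(\<Sum>s<S. U s x) = w x * v" unfolding w_def using v by simp
    have "(\<Sum>s<S. L s x) = (\<Sum>s<S. \<Sum>i\<in>J s. \<xi> s i (x i)) - (\<Sum>s<S. Rem s x)"
      unfolding sum_subtractf[symmetric] using stratum.L_decomp[OF str]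
          unfolding L_def \<xi>_def Rem_def by (intro sum.cong refl) simp
    also have "(\<Sum>s<S. \<Sum>i\<in>J s. \<xi> s i (x i)) = (\<Sum>s<S. \<Sum>i\<in>J s. \<xi> (st i) i (x i))"
      by (intro sum.cong refl) (auto simp: J)
    also have "\<dots> = \<sigma> * X x" unfolding grp X_def f_def using \<sigma> by (simp add: sum_distrib_left)
    also have "(\<Sum>s<S. Rem s x) = \<sigma> * \<rho> x" unfolding \<rho>_def using \<sigma> by simp
    finally have "(\<Sum>s<S. L s x) = \<sigma> * (X x - \<rho> x)" by (simp add: right_diff_distrib)
    moreover have "sqrt (w x * v) = \<sigma> * sqrt (w x)" by (simp add: real_sqrt_mult \<sigma>_def)
    ultimately show ?thesis unfolding Y_def U using \<sigma> by simp
  qed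
  let ?E = "measure_pmf.expectation (Pi_pmf I dflt p)"
  have 1: "cmod (?E (\<lambda>x. iexp (t * Y x)) - ?E (\<lambda>x. iexp (t * X x)))
     \<le> \<bar>t\<bar> * (2 * \<delta> * E (\<lambda>x. \<bar>X x\<bar>) + 2 * E (\<lambda>x. \<bar>\<rho> x\<bar>)) + 2 / \<delta> * E (\<lambda>x. \<bar>w x - 1\<bar>)"
    by (rule char_perturbation[OF \<delta> Y])
  also have "\<dots> \<le> \<bar>t\<bar> * (2 * \<delta> * 1 + 2 * (\<Sum>s<S. sqrt (2 * sqrt (real (card (J s)))) / \<sigma>))
     + 2 / \<delta> * (\<Sum>s<S. (6 * sqrt (real (card (J s))) + sqrt (\<sigma>2 s)) / v)"
    using \<delta> by (intro add_mono mult_left_mono EX E\<rho> Ew) auto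
  finally have 1: "cmod (?E (\<lambda>x. iexp (t * Y x)) - ?E (\<lambda>x. iexp (t * X x))) \<le> \<dots>" .
  have 2: "cmod (?E (\<lambda>x. iexp (t * X x)) - exp (- (t\<^sup>2) / 2)) \<le> \<bar>t\<bar> ^ 3 * (B / \<sigma>)
      + t ^ 4 * (B / \<sigma>)\<^sup>2"
    unfolding X_def by (rule char_sum_approx_normal[OF mean bound _ var]) (use B \<sigma> in auto)
  have "cmod (A - C) \<le> b1 + b2" if "cmod (A - B) \<le> b2" "cmod (B - C) \<le> b1" for A B C b1 b2
    using norm_triangle_ineq[of "A - B" "B - C"] that by simp
  from this[OF 1 2] show ?thesis unfolding Y_def L_def U_def \<sigma>_def
    by (simp only: mult_1_right add.assoc)
qed

end

lemma variance_growth_few_ties: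
  fixes p m gt dm v :: "nat \<Rightarrow> real"
  assumes p: "p \<longlonglongrightarrow> l" "0 < l" "(\<lambda>n. 1 - p n) \<longlonglongrightarrow> l'" "0 < l'"
    and m: "filterlim m at_top sequentially"
    and lim: "filterlim (\<lambda>n. (gt n / dm n) * sqrt (m n / ln (m n))) at_top sequentially"
    and gt: "\<And>n. 0 \<le> gt n" and dm: "\<forall>\<^sub>F n in sequentially. 1 \<le> dm n"
    and pn: "\<And>n. 0 \<le> p n * (1 - p n)"
    and v: "\<forall>\<^sub>F n in sequentially. p n * (1 - p n) * (m n * gt n - 2 * dm n * sqrt (m n)) \<le> v n"
  shows "filterlim (\<lambda>n. v n / sqrt (m n)) at_top sequentially"
proof -
  have m3: "\<forall>\<^sub>F n in sequentially. exp 1 \<le> m n" using m by (simp add: filterlim_at_top)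
  have r: "filterlim (\<lambda>n. (gt n / dm n) * sqrt (m n)) at_top sequentially"
  proof (rule filterlim_at_top_mono[OF lim])
    show "\<forall>\<^sub>F n in sequentially. (gt n / dm n) * sqrt (m n / ln (m n)) \<le> (gt n / dm n) * sqrt (m n)"
      using m3 dm
    proof eventually_elim
      case (elim n)
      have pos: "0 < m n" using elim by (meson exp_gt_zero less_le_trans)
      then have "1 \<le> ln (m n)" using elim by (simp add: ln_ge_iff)
      then have "0 < ln (m n)" "1 \<le> ln (m n)" by linarith+
      then have "m n / ln (m n) \<le> m n / 1" using pos by (intro divide_left_mono) auto
      then show ?case using gt[of n] elim by (intro mult_left_mono) auto
    qed
  qed
  have r2: "filterlim (\<lambda>n. - 2 + (gt n / dm n) * sqrt (m n)) at_top sequentially"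
    by (rule filterlim_tendsto_add_at_top[OF tendsto_const r])
  have "(\<lambda>n. p n * (1 - p n)) \<longlonglongrightarrow> l * l'" by (intro tendsto_mult p)
  from filterlim_tendsto_pos_mult_at_top[OF this _ r2]
  have f: "filterlim (\<lambda>n. p n * (1 - p n) * (- 2 + (gt n / dm n) * sqrt (m n))) at_top sequentially"
    using p by simp
  have r3: "\<forall>\<^sub>F n in sequentially. 0 \<le> - 2 + (gt n / dm n) * sqrt (m n)"
    using r2 unfolding filterlim_at_top by blast
  show ?thesis
  proof (rule filterlim_at_top_mono[OF f])
    show "\<forall>\<^sub>F n in sequentially. p n * (1 - p n) * (- 2 + (gt n / dm n) * sqrt (m n))
        \<le> v n / sqrt (m n)"
      using m3 dm v r3
    proof eventually_elim
      case (elim n)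
      have pos: "0 < m n" using elim(1) by (meson exp_gt_zero less_le_trans)
      have "- 2 + (gt n / dm n) * sqrt (m n) \<le> dm n * (- 2 + (gt n / dm n) * sqrt (m n))"
        using elim(2,4) by (simp add: mult_le_cancel_right1)
      also have "\<dots> = (m n * gt n - 2 * dm n * sqrt (m n)) / sqrt (m n)"
      proof -
        have "m n * gt n / sqrt (m n) = gt n * (m n / sqrt (m n))" by simp
        also have "\<dots> = gt n * sqrt (m n)" using pos by (simp only: real_div_sqrt less_imp_le)
        finally have "(m n * gt n - 2 * dm n * sqrt (m n)) / sqrt (m n)
            = gt n * sqrt (m n) - 2 * dm n"
          using pos by (simp add: diff_divide_distrib)
        then show ?thesis using elim(2) by (simp add: algebra_simps)
      qed
      finally have "p n * (1 - p n) * (- 2 + (gt n / dm n) * sqrt (m n))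
          \<le> p n * (1 - p n) * ((m n * gt n - 2 * dm n * sqrt (m n)) / sqrt (m n))"
        by (intro mult_left_mono pn)
      also have "\<dots> = (p n * (1 - p n) * (m n * gt n - 2 * dm n * sqrt (m n))) / sqrt (m n)" by simp
      also have "\<dots> \<le> v n / sqrt (m n)" using elim(3) pos by (intro divide_right_mono) auto
      finally show ?case .
    qed
  qed
qed

lemma variance_growth_many_ties:
  fixes p m d h g v :: "nat \<Rightarrow> real"
  assumes p: "p \<longlonglongrightarrow> l" "0 < l" "(\<lambda>n. 1 - p n) \<longlonglongrightarrow> l'" "0 < l'"
    and m: "filterlim m at_top sequentially"
    and d: "(\<lambda>n. d n / m n) \<longlonglongrightarrow> a" "0 < a" and g: "g \<longlonglongrightarrow> b" "0 < b" and h: "h \<longlonglongrightarrow> c" "c < 1"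
    and v: "\<forall>\<^sub>F n in sequentially. p n * (1 - p n) * (d n * (1 - h n) * g n) \<le> v n"
  shows "filterlim (\<lambda>n. v n / sqrt (m n)) at_top sequentially"
proof -
  have lim: "(\<lambda>n. p n * (1 - p n) * ((d n / m n) * (1 - h n) * g n)) \<longlonglongrightarrow> l * l' * (a * (1 - c) * b)"
    by (intro tendsto_intros p d g h)
  have sqrt: "filterlim (\<lambda>n. sqrt (m n)) at_top sequentially"
    by (rule filterlim_compose[OF sqrt_at_top m])
  have f: "filterlim (\<lambda>n. p n * (1 - p n) * ((d n / m n) * (1 - h n) * g n) * sqrt (m n)) at_top
      sequentially"
    by (rule filterlim_tendsto_pos_mult_at_top[OF lim _ sqrt]) (use p d g h in simp)
  have m1: "\<forall>\<^sub>F n in sequentially. 1 \<le> m n" using m by (simp add: filterlim_at_top)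
  show ?thesis
  proof (rule filterlim_at_top_mono[OF f])
    show "\<forall>\<^sub>F n in sequentially. p n * (1 - p n) * ((d n / m n) * (1 - h n) * g n) * sqrt (m n)
        \<le> v n / sqrt (m n)"
      using m1 v
    proof eventually_elim
      case (elim n)
      have "sqrt (m n) / m n = 1 / sqrt (m n)" using elim by (simp add: field_simps)
      then have 1: "(d n / m n) * sqrt (m n) = d n * (1 / sqrt (m n))"
          by (metis times_divide_eq_left times_divide_eq_right)
      have "p n * (1 - p n) * ((d n / m n) * (1 - h n) * g n) * sqrt (m n)
          = p n * (1 - p n) * ((1 - h n) * g n) * ((d n / m n) * sqrt (m n))"
        by (simp only: mult_ac)
      also have "\<dots> = p n * (1 - p n) * (d n * (1 - h n) * g n) * (1 / sqrt (m n))"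
        unfolding 1 by (simp only: mult_ac)
      also have "\<dots> \<le> v n * (1 / sqrt (m n))" using elim by (intro mult_right_mono) auto
      finally show ?case by simp
    qed
  qed
qed

lemma tendsto_of_stratified_bound:
  fixes m :: "nat \<Rightarrow> nat \<Rightarrow> nat" and \<sigma>2 :: "nat \<Rightarrow> nat \<Rightarrow> real" and \<Phi> :: "nat \<Rightarrow> complex"
  assumes S: "0 < S"
    and m: "\<And>s. s < S \<Longrightarrow> filterlim (\<lambda>n. m n s) at_top sequentially"
    and growth: "\<And>s. s < S \<Longrightarrow> filterlim (\<lambda>n. \<sigma>2 n s / sqrt (real (m n s))) at_top sequentially"
    and \<sigma>2: "\<And>n s. s < S \<Longrightarrow> 0 \<le> \<sigma>2 n s"
    and bound: "\<And>n \<delta> B. 0 < (\<Sum>s<S. \<sigma>2 n s) \<Longrightarrow> 0 < \<delta> \<Longrightarrow> \<delta> \<le> 1/2 \<Longrightarrow> 0 \<le> B \<Longrightarrow>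
      (\<And>s. s < S \<Longrightarrow> 2 + ln (real (m n s)) \<le> B) \<Longrightarrow>
      cmod (\<Phi> n - \<phi>) \<le> \<bar>t\<bar> ^ 3 * (B / sqrt (\<Sum>s<S. \<sigma>2 n s)) + t ^ 4 * (B / sqrt (\<Sum>s<S. \<sigma>2 n s))\<^sup>2
      + \<bar>t\<bar> * (2 * \<delta> + 2 * (\<Sum>s<S. sqrt (2 * sqrt (real (m n s))) / sqrt (\<Sum>s<S. \<sigma>2 n s)))
      + 2 / \<delta> * (\<Sum>s<S. (6 * sqrt (real (m n s)) + sqrt (\<sigma>2 n s)) / (\<Sum>s<S. \<sigma>2 n s))"
  shows "\<Phi> \<longlonglongrightarrow> \<phi>"
proof -
  define v where "v n = (\<Sum>s<S. \<sigma>2 n s)" for n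
  define q where "q s n = sqrt (real (m n s)) / \<sigma>2 n s" for s n
  have le_v: "\<sigma>2 n s \<le> v n" if "s < S" for n s
    unfolding v_def by (rule member_le_sum) (use that \<sigma>2 in auto)
  have m': "filterlim (\<lambda>n. real (m n s)) at_top sequentially" if "s < S" for s
    by (rule filterlim_compose[OF filterlim_real_sequentially m[OF that]])
  have q0: "q s \<longlonglongrightarrow> 0" if s: "s < S" for s
    using tendsto_inverse_0_at_top[OF growth[OF s]] unfolding q_def by simp
  have ev: "\<forall>\<^sub>F n in sequentially. 1 \<le> real (m n s) \<and> 0 < \<sigma>2 n s" if s: "s < S" for s
  proof -
    have "\<forall>\<^sub>F n in sequentially. 1 \<le> real (m n s)" using m'[OF s] unfolding filterlim_at_top
        by blast
    moreover have "\<forall>\<^sub>F n in sequentially. 1 \<le> \<sigma>2 n s / sqrt (real (m n s))"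
        using growth[OF s] unfolding filterlim_at_top by blast
    ultimately show ?thesis
    proof eventually_elim
      case (elim n)
      then have "\<sigma>2 n s \<noteq> 0" by auto
      then show ?case using elim \<sigma>2[OF s, of n] by simp
    qed
  qed
  have sq0: "(\<lambda>n. sqrt (c * q s n)) \<longlonglongrightarrow> 0" if "s < S" for s c
    using tendsto_real_sqrt[OF tendsto_mult[OF tendsto_const[of c] q0[OF that]]] by simp
  have t1: "(\<lambda>n. sqrt (2 * sqrt (real (m n s))) / sqrt (v n)) \<longlonglongrightarrow> 0" if s: "s < S" for s
  proof (rule Lim_null_comparison[OF _ sq0[OF s, of 2]])
    show "\<forall>\<^sub>F n in sequentially. norm (sqrt (2 * sqrt (real (m n s))) / sqrt (v n))
        \<le> sqrt (2 * q s n)"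
      using ev[OF s]
    proof eventually_elim
      case (elim n)
      then have "sqrt (2 * sqrt (real (m n s))) / sqrt (v n)
          \<le> sqrt (2 * sqrt (real (m n s))) / sqrt (\<sigma>2 n s)"
        using le_v[OF s, of n] by (intro divide_left_mono mult_pos_pos) auto
      then show ?case using elim le_v[OF s, of n] unfolding q_def by (simp add: real_sqrt_divide)
    qed
  qed
  have t2: "(\<lambda>n. (6 * sqrt (real (m n s)) + sqrt (\<sigma>2 n s)) / v n) \<longlonglongrightarrow> 0" if s: "s < S" for s
  proof (rule Lim_null_comparison)
    show "(\<lambda>n. 6 * q s n + sqrt (1 * q s n)) \<longlonglongrightarrow> 0"
      using tendsto_add[OF tendsto_mult[OF tendsto_const[of 6] q0[OF s]] sq0[OF s, of 1]] by simp
    show "\<forall>\<^sub>F n in sequentially. norm ((6 * sqrt (real (m n s)) + sqrt (\<sigma>2 n s)) / v n)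
        \<le> 6 * q s n + sqrt (1 * q s n)"
      using ev[OF s]
    proof eventually_elim
      case (elim n)
      have "(6 * sqrt (real (m n s)) + sqrt (\<sigma>2 n s)) / v n \<le> (6 * sqrt (real (m n s))
          + sqrt (\<sigma>2 n s)) / \<sigma>2 n s"
        using elim le_v[OF s, of n] by (intro divide_left_mono mult_pos_pos) auto
      also have "\<dots> = 6 * q s n + sqrt (\<sigma>2 n s) / \<sigma>2 n s" unfolding q_def
          by (simp add: add_divide_distrib)
      also have "sqrt (\<sigma>2 n s) / \<sigma>2 n s = sqrt (1 / \<sigma>2 n s)"
        using elim by (simp add: real_sqrt_divide field_simps)
      also have "\<dots> \<le> sqrt (q s n)" unfolding q_def using elim
          by (intro real_sqrt_le_mono divide_right_mono) auto
      finally show ?case using elim le_v[OF s, of n] by simp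
    qed
  qed
  define B where "B n = (\<Sum>s<S. \<bar>2 + ln (real (m n s))\<bar>)" for n
  have t3: "(\<lambda>n. \<bar>2 + ln (real (m n s))\<bar> / sqrt (v n)) \<longlonglongrightarrow> 0" if s: "s < S" for s
  proof (rule Lim_null_comparison)
    have "((\<lambda>x::real. \<bar>2 + ln x\<bar> / sqrt (sqrt x)) \<longlongrightarrow> 0) at_top" by real_asymp
    from filterlim_compose[OF this m'[OF s]]
    have z: "(\<lambda>n. \<bar>2 + ln (real (m n s))\<bar> / sqrt (sqrt (real (m n s)))) \<longlonglongrightarrow> 0" .
    show "(\<lambda>n. \<bar>2 + ln (real (m n s))\<bar> / sqrt (sqrt (real (m n s))) * sqrt (1 * q s n)) \<longlonglongrightarrow> 0"
      using tendsto_mult[OF z sq0[OF s, of 1]] by simp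
    show "\<forall>\<^sub>F n in sequentially. norm (\<bar>2 + ln (real (m n s))\<bar> / sqrt (v n)) \<le> \<bar>2
        + ln (real (m n s))\<bar> / sqrt (sqrt (real (m n s))) * sqrt (1 * q s n)"
      using ev[OF s]
    proof eventually_elim
      case (elim n)
      have "\<bar>2 + ln (real (m n s))\<bar> / sqrt (v n) \<le> \<bar>2 + ln (real (m n s))\<bar> / sqrt (\<sigma>2 n s)"
        using elim le_v[OF s, of n] by (intro divide_left_mono mult_pos_pos) auto
      also have "\<dots> = \<bar>2 + ln (real (m n s))\<bar> / sqrt (sqrt (real (m n s))) * sqrt (1 * q s n)"
        unfolding q_def using elim by (simp add: real_sqrt_divide)
      finally show ?case using elim le_v[OF s, of n] by simp
    qed
  qed
  have B0: "(\<lambda>n. B n / sqrt (v n)) \<longlonglongrightarrow> 0"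
    unfolding B_def sum_divide_distrib by (rule tendsto_null_sum) (use t3 in auto)
  have T1: "(\<lambda>n. \<Sum>s<S. sqrt (2 * sqrt (real (m n s))) / sqrt (v n)) \<longlonglongrightarrow> 0"
    by (rule tendsto_null_sum) (use t1 in auto)
  have T2: "(\<lambda>n. \<Sum>s<S. (6 * sqrt (real (m n s)) + sqrt (\<sigma>2 n s)) / v n) \<longlonglongrightarrow> 0"
    by (rule tendsto_null_sum) (use t2 in auto)
  define A where "A \<delta> n = \<bar>t\<bar> ^ 3 * (B n / sqrt (v n)) + t ^ 4 * (B n / sqrt (v n))\<^sup>2
      + \<bar>t\<bar> * (2 * \<delta> + 2 * (\<Sum>s<S. sqrt (2 * sqrt (real (m n s))) / sqrt (v n)))
      + 2 / \<delta> * (\<Sum>s<S. (6 * sqrt (real (m n s)) + sqrt (\<sigma>2 n s)) / v n)" for \<delta> n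
  have A: "A \<delta> \<longlonglongrightarrow> \<bar>t\<bar> ^ 3 * 0 + t ^ 4 * 0\<^sup>2 + \<bar>t\<bar> * (2 * \<delta> + 2 * 0) + 2 / \<delta> * 0" for \<delta>
    unfolding A_def by (intro tendsto_intros B0 T1 T2)
  have v_pos: "\<forall>\<^sub>F n in sequentially. 0 < v n"
    using ev[OF S]
  proof eventually_elim
    case (elim n)
    then show ?case using le_v[OF S, of n] by linarith
  qed
  have ub: "\<forall>\<^sub>F n in sequentially. cmod (\<Phi> n - \<phi>) \<le> A \<delta> n" if \<delta>: "0 < \<delta>" "\<delta> \<le> 1/2" for \<delta>
    using v_pos
  proof eventually_elim
    case (elim n)
    have B1: "0 \<le> B n" unfolding B_def by (intro sum_nonneg) simp
    have B2: "2 + ln (real (m n s)) \<le> B n" if s: "s < S" for s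
    proof -
      have "\<bar>2 + ln (real (m n s))\<bar> \<le> B n" unfolding B_def by (rule member_le_sum) (use s in auto)
      then show ?thesis by linarith
    qed
    show ?case unfolding A_def v_def by (rule bound) (use elim \<delta> B1 B2 in \<open>auto simp: v_def\<close>)
  qed
  have "(\<lambda>n. cmod (\<Phi> n - \<phi>)) \<longlonglongrightarrow> 0"
  proof (rule tendstoI)
    fix \<epsilon> :: real assume \<epsilon>: "0 < \<epsilon>"
    define \<delta> where "\<delta> = min (1/2) (\<epsilon> / (4 * (\<bar>t\<bar> + 1)))"
    have \<delta>: "0 < \<delta>" "\<delta> \<le> 1/2"
      unfolding \<delta>_def using \<epsilon> by (simp add: add_nonneg_pos) (rule min.cobounded1)
    have "\<bar>t\<bar> * (2 * \<delta>) < \<epsilon>"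
    proof -
      have "(\<bar>t\<bar> + 1) * \<delta> \<le> (\<bar>t\<bar> + 1) * (\<epsilon> / (4 * (\<bar>t\<bar> + 1)))" unfolding \<delta>_def
          by (intro mult_left_mono) auto
      also have "\<dots> = \<epsilon> / 4" by (simp add: field_simps)
      finally have "\<bar>t\<bar> * \<delta> + \<delta> \<le> \<epsilon> / 4" by (simp add: distrib_right)
      then show ?thesis using \<delta> \<epsilon> by simp
    qed
    then have "\<forall>\<^sub>F n in sequentially. A \<delta> n < \<epsilon>" using order_tendstoD(2)[OF A[of \<delta>], of \<epsilon>] by simp
    with ub[OF \<delta>] show "\<forall>\<^sub>F n in sequentially. dist (cmod (\<Phi> n - \<phi>)) 0 < \<epsilon>"
      by eventually_elim simp
  qed
  then show ?thesis by (rule LIM_zero_cancel[OF tendsto_norm_zero_cancel])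
qed

section \<open>Reduction to finitely supported distributions\<close>

lemma measurable_finite_range:
  assumes "finite R" "\<And>\<omega>. \<omega> \<in> space M \<Longrightarrow> Y \<omega> \<in> R"
    and "\<And>v. v \<in> R \<Longrightarrow> {\<omega> \<in> space M. Y \<omega> = v} \<in> sets M"
  shows "Y \<in> measurable M (count_space UNIV)"
proof (rule measurableI)
  fix A
  have "Y -` A \<inter> space M = (\<Union>v\<in>A \<inter> R. {\<omega> \<in> space M. Y \<omega> = v})" using assms(2) by auto
  also have "\<dots> \<in> sets M" using assms by (intro sets.finite_UN) auto
  finally show "Y -` A \<inter> space M \<in> sets M" .
qed auto

lemma (in prob_space) pmf_of_finite_range:
  assumes Y: "Y \<in> measurable M (count_space UNIV)" and R: "finite R" "\<And>\<omega>. \<omega> \<in> space M \<Longrightarrow> Y \<omega> \<in> R"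
  obtains P where "measure_pmf P = distr M (count_space UNIV) Y" "finite (set_pmf P)"
proof -
  let ?D = "distr M (count_space UNIV) Y"
  interpret D: prob_space ?D by (rule prob_space_distr[OF Y])
  have AE_R: "AE v in ?D. v \<in> R"
    using R(2) by (subst AE_distr_iff[OF Y]) (auto intro: AE_I2)
  have "AE v in ?D. \<forall>r\<in>R. measure ?D {r} = 0 \<longrightarrow> v \<noteq> r"
  proof (subst AE_finite_all[OF R(1)], intro ballI)
    fix r assume "r \<in> R"
    show "AE v in ?D. measure ?D {r} = 0 \<longrightarrow> v \<noteq> r"
    proof (cases "measure ?D {r} = 0")
      case True
      then have "{r} \<in> null_sets ?D" by (auto simp: null_sets_def D.emeasure_eq_measure)
      then show ?thesis using AE_not_in by fastforce
    qed simp
  qed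
  with AE_R have "AE v in ?D. measure ?D {v} \<noteq> 0" by eventually_elim auto
  then have eq: "measure_pmf (Abs_pmf ?D) = ?D"
    by (intro Abs_pmf_inverse) (auto intro: D.prob_space_axioms)
  have "AE v in measure_pmf (Abs_pmf ?D). v \<in> R" unfolding eq by (rule AE_R)
  then have "set_pmf (Abs_pmf ?D) \<subseteq> R" by (auto simp: AE_measure_pmf_iff)
  with that[OF eq] R(1) show ?thesis using finite_subset by blast
qed

lemma (in prob_space) distr_Pi_pmf:
  fixes X :: "'i \<Rightarrow> 'a \<Rightarrow> 'x" and dflt :: 'x
  assumes I: "finite I" and ind: "indep_vars (\<lambda>_. count_space UNIV) X I"
    and p: "\<And>i. i \<in> I \<Longrightarrow> measure_pmf (p i) = distr M (count_space UNIV) (X i)"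
    and fin: "\<And>i. i \<in> I \<Longrightarrow> finite (R i)" "\<And>i \<omega>. i \<in> I \<Longrightarrow> \<omega> \<in> space M \<Longrightarrow> X i \<omega> \<in> R i"
  defines "Y \<equiv> \<lambda>\<omega> i. if i \<in> I then X i \<omega> else dflt"
  shows "Y \<in> measurable M (count_space UNIV)" "distr M (count_space UNIV) Y
      = measure_pmf (Pi_pmf I dflt p)"
proof -
  have X: "X i \<in> measurable M (count_space UNIV)" if "i \<in> I" for i using ind that
      by (auto simp: indep_vars_def2)
  have ev: "{\<omega> \<in> space M. Y \<omega> = v} = (if \<forall>i. i \<notin> I \<longrightarrow> v i = dflt then {\<omega> \<in> space M. \<forall>i\<in>I. X i \<omega>
      = v i} else {})" for v
    unfolding Y_def by (auto simp: fun_eq_iff)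
  have single: "{\<omega> \<in> space M. X i \<omega> = v} \<in> sets M" if "i \<in> I" for i v
    using measurable_sets[OF X[OF that], of "{v}"] by (simp add: vimage_def Int_def conj_commute)
  have sets: "{\<omega> \<in> space M. Y \<omega> = v} \<in> sets M" for v
  proof -
    have "{\<omega> \<in> space M. \<forall>i\<in>I. X i \<omega> = v i} \<in> sets M"
      using I single by (intro sets.sets_Collect_finite_All)
    then show ?thesis unfolding ev by auto
  qed
  have R: "finite (PiE_dflt I dflt R)" using I fin by auto
  have YR: "Y \<omega> \<in> PiE_dflt I dflt R" if "\<omega> \<in> space M" for \<omega>
    using that fin by (auto simp: Y_def PiE_dflt_def)
  show Y: "Y \<in> measurable M (count_space UNIV)" by (rule measurable_finite_range[OF R YR sets])
  obtain Q where Q: "measure_pmf Q = distr M (count_space UNIV) Y"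
      using pmf_of_finite_range[OF Y R YR] by metis
  have "Q = Pi_pmf I dflt p"
  proof (rule pmf_eqI)
    fix v
    have "pmf Q v = prob {\<omega> \<in> space M. Y \<omega> = v}"
      unfolding pmf.rep_eq Q by (subst measure_distr[OF Y]) (auto intro!: arg_cong[where f = prob])
    also have "\<dots> = pmf (Pi_pmf I dflt p) v"
    proof (cases "\<forall>i. i \<notin> I \<longrightarrow> v i = dflt")
      case True
      have pm: "pmf (p i) (v i) = prob (X i -` {v i} \<inter> space M)" if "i \<in> I" for i
        unfolding pmf.rep_eq p[OF that] by (subst measure_distr[OF X[OF that]]) auto
      have "prob {\<omega> \<in> space M. \<forall>i\<in>I. X i \<omega> = v i} = (\<Prod>i\<in>I. pmf (p i) (v i))"
      proof (cases "I = {}")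
        case True then show ?thesis by (simp add: prob_space)
      next
        case False
        have "indep_sets (\<lambda>i. { X i -` A \<inter> space M | A. A \<in> sets (count_space UNIV)}) I"
          using ind unfolding indep_vars_def2 by auto
        then have "prob (\<Inter>i\<in>I. X i -` {v i} \<inter> space M) = (\<Prod>i\<in>I. prob (X i -` {v i} \<inter> space M))"
          by (rule indep_setsD) (use I False in auto)
        moreover have "(\<Inter>i\<in>I. X i -` {v i} \<inter> space M) = {\<omega> \<in> space M. \<forall>i\<in>I. X i \<omega> = v i}"
            using False by auto
        ultimately show ?thesis using pm by simp
      qed
      then show ?thesis using True unfolding ev by (simp add: pmf_Pi I)
    next
      case False
      then show ?thesis unfolding ev by (auto simp: pmf_Pi I)
    qed
    finally show "pmf Q v = pmf (Pi_pmf I dflt p) v" .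
  qed
  with Q show "distr M (count_space UNIV) Y = measure_pmf (Pi_pmf I dflt p)" by simp
qed

definition event_index :: "nat set \<Rightarrow> (nat \<Rightarrow> real) \<Rightarrow> nat \<Rightarrow> nat" where
  "event_index J T0 j = the_inv_into {..<nK J T0} (evt_time J T0) (T0 j)"

lemma evt_time_less:
  assumes "finite J" "k < l" "l < nK J T0"
  shows "evt_time J T0 k < evt_time J T0 l"
  unfolding evt_time_def using assms
  by (intro sorted_wrt_nth_less[of "(<)"]) (auto simp: nK_def)

lemma bij_evt_time:
  assumes "finite J"
  shows "bij_betw (evt_time J T0) {..<nK J T0} (T0 ` J)"
  unfolding evt_time_def nK_def
  by (rule bij_betw_nth) (use assms in auto)

lemma evt_time_event_index:
  assumes "finite J" "j \<in> J"
  shows "evt_time J T0 (event_index J T0 j) = T0 j" "event_index J T0 j < nK J T0"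
proof -
  show "evt_time J T0 (event_index J T0 j) = T0 j"
    unfolding event_index_def using assms by (intro f_the_inv_into_f_bij_betw[OF bij_evt_time]) auto
  show "event_index J T0 j < nK J T0"
    unfolding event_index_def
    using bij_betw_apply[OF bij_betw_the_inv_into[OF bij_evt_time[OF assms(1), of T0]], of "T0 j"]
        assms(2) by auto
qed

lemma event_index_image:
  assumes "finite J"
  shows "event_index J T0 ` J = {..<nK J T0}"
proof -
  have "event_index J T0 ` J = the_inv_into {..<nK J T0} (evt_time J T0) ` (T0 ` J)"
    unfolding event_index_def by (simp add: image_image)
  also have "\<dots> = {..<nK J T0}"
    using bij_betw_the_inv_into[OF bij_evt_time[OF assms]] by (simp add: bij_betw_def)
  finally show ?thesis .
qed

lemma event_index_eq_iff:
  assumes "finite J" "j \<in> J" "k < nK J T0"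
  shows "event_index J T0 j = k \<longleftrightarrow> T0 j = evt_time J T0 k"
  using evt_time_event_index[OF assms(1,2), of T0] assms(3) bij_evt_time[OF assms(1), of T0]
  by (metis bij_betw_def inj_on_eq_iff lessThan_iff)

lemma le_event_index_iff:
  assumes "finite J" "j \<in> J" "k < nK J T0"
  shows "k \<le> event_index J T0 j \<longleftrightarrow> evt_time J T0 k \<le> T0 j"
  using evt_time_event_index[OF assms(1,2), of T0] assms evt_time_less[OF assms(1)]
  by (metis linorder_not_le nless_le not_less_iff_gr_or_eq)

section \<open>The logrank statistic as a function of risk types\<close>

lemma sum_of_bool_slice:
  "(\<Sum>i\<in>{i \<in> {s} \<times> {..<m}. A i}. of_bool (B i))
      = real (card {j \<in> {..<m :: nat}. A (s, j) \<and> B (s, j)})"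
proof -
  have "(\<Sum>i\<in>{i \<in> {s} \<times> {..<m}. A i}. of_bool (B i))
      = real (card ({i \<in> {s} \<times> {..<m}. A i} \<inter> {i. B i}))"
    by (rule sum_of_bool_eq) auto
  also have "{i \<in> {s} \<times> {..<m}. A i} \<inter> {i. B i} = Pair s ` {j \<in> {..<m}. A (s, j) \<and> B (s, j)}"
      by auto
  also have "card \<dots> = card {j \<in> {..<m}. A (s, j) \<and> B (s, j)}"
      by (rule card_image) (auto simp: inj_on_def)
  finally show ?thesis .
qed

definition risk_treated :: "nat \<Rightarrow> bool \<times> nat set \<Rightarrow> real" where
  "risk_treated k v = of_bool (fst v \<and> k \<in> snd v)"

definition risk :: "nat \<Rightarrow> bool \<times> nat set \<Rightarrow> real" where
  "risk k v = of_bool (k \<in> snd v)"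

text \<open>Only the set of event times up to which a unit is uncensored enters the statistic, so a
  treatment indicator with its two censoring times can be replaced by an element of a finite set.\<close>

definition risk_type :: "nat set \<Rightarrow> (nat \<Rightarrow> real) \<Rightarrow> bool \<times> ennreal \<times> ennreal \<Rightarrow> bool \<times> nat set" where
  "risk_type J T0 b = (fst b, {k. k < nK J T0 \<and> ennreal (evt_time J T0 k)
      \<le> (if fst b then fst (snd b) else snd (snd b))})"

lemma measurable_risk_type:
  "risk_type J T0 \<in> measurable (count_space UNIV \<Otimes>\<^sub>M (borel \<Otimes>\<^sub>M borel)) (count_space UNIV)"
proof (rule measurable_finite_range)
  show "finite (UNIV \<times> Pow {..<nK J T0} :: (bool \<times> nat set) set)" by simp
  show "risk_type J T0 b \<in> UNIV \<times> Pow {..<nK J T0}" for b by (auto simp: risk_type_def)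
  fix v :: "bool \<times> nat set" assume v: "v \<in> UNIV \<times> Pow {..<nK J T0}"
  let ?N = "count_space UNIV \<Otimes>\<^sub>M (borel \<Otimes>\<^sub>M borel) :: (bool \<times> ennreal \<times> ennreal) measure"
  have "{b \<in> space ?N. risk_type J T0 b = v} = {b \<in> space ?N. fst b = fst v \<and>
     (\<forall>k\<in>{..<nK J T0}. (k \<in> snd v) = (ennreal (evt_time J T0 k)
         \<le> (if fst b then fst (snd b) else snd (snd b))))}"
    using v by (auto simp: risk_type_def)
  also have "\<dots> \<in> sets ?N" by measurable
  finally show "{b \<in> space ?N. risk_type J T0 b = v} \<in> sets ?N" .
qed

lemma (in prob_space) risk_probability:
  fixes Z :: "'a \<Rightarrow> bool" and C1 C0 :: "'a \<Rightarrow> ennreal"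
  assumes meas: "(\<lambda>\<omega>. (Z \<omega>, C1 \<omega>, C0 \<omega>)) \<in> measurable M (count_space UNIV \<Otimes>\<^sub>M (borel \<Otimes>\<^sub>M borel))"
    and bern: "prob {\<omega> \<in> space M. Z \<omega>} = q"
    and prod: "distr M (count_space UNIV \<Otimes>\<^sub>M (borel \<Otimes>\<^sub>M borel)) (\<lambda>\<omega>. (Z \<omega>, C1 \<omega>, C0 \<omega>))
       = distr M (count_space UNIV) Z \<Otimes>\<^sub>M distr M (borel \<Otimes>\<^sub>M borel) (\<lambda>\<omega>. (C1 \<omega>, C0 \<omega>))"
    and Q: "distr M (borel \<Otimes>\<^sub>M borel) (\<lambda>\<omega>. (C1 \<omega>, C0 \<omega>)) = Q"
  shows "prob {\<omega> \<in> space M. Z \<omega> \<and> c \<le> C1 \<omega>} = q * measure Q {x. c \<le> fst x}" (is ?th1)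
    and "prob {\<omega> \<in> space M. \<not> Z \<omega> \<and> c \<le> C0 \<omega>} = (1 - q) * measure Q {x. c \<le> snd x}" (is ?th2)
    and "distr M (count_space UNIV \<Otimes>\<^sub>M (borel \<Otimes>\<^sub>M borel)) (\<lambda>\<omega>. (Z \<omega>, C1 \<omega>, C0 \<omega>))
        = measure_pmf (bernoulli_pmf q) \<Otimes>\<^sub>M Q" (is ?th3)
    and "prob_space Q"
proof -
  have Zm[measurable]: "Z \<in> measurable M (count_space UNIV)"
    using measurable_compose[OF meas measurable_fst] by simp
  have Cm[measurable]: "(\<lambda>\<omega>. (C1 \<omega>, C0 \<omega>)) \<in> measurable M (borel \<Otimes>\<^sub>M borel)"
    using measurable_compose[OF meas measurable_snd] by simp
  show pQ: "prob_space Q" unfolding Q[symmetric] by (rule prob_space_distr) simp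
  interpret Q: prob_space Q by (rule pQ)
  have sQ: "sets Q = sets (borel \<Otimes>\<^sub>M borel)" unfolding Q[symmetric] by simp
  have q01: "0 \<le> q" "q \<le> 1" using bern by auto
  have notZ: "prob {\<omega> \<in> space M. \<not> Z \<omega>} = 1 - q"
  proof -
    have "{\<omega> \<in> space M. \<not> Z \<omega>} = space M - {\<omega> \<in> space M. Z \<omega>}" by auto
    then show ?thesis using prob_compl[of "{\<omega> \<in> space M. Z \<omega>}"] bern by simp
  qed
  have dZ: "distr M (count_space UNIV) Z = measure_pmf (bernoulli_pmf q)"
  proof (rule measure_eqI_countable[of _ UNIV])
    fix z :: bool
    have "emeasure (distr M (count_space UNIV) Z) {z} = emeasure M {\<omega> \<in> space M. Z \<omega> = z}"
      by (subst emeasure_distr) (auto intro!: arg_cong[where f = "emeasure M"])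
    also have "\<dots> = pmf (bernoulli_pmf q) z" using bern notZ q01
        by (cases z) (auto simp: emeasure_eq_measure)
    finally show "emeasure (distr M (count_space UNIV) Z) {z}
        = emeasure (measure_pmf (bernoulli_pmf q)) {z}"
      by (simp add: emeasure_pmf_single)
  qed auto
  show d: ?th3 unfolding prod dZ Q ..
  have key: "prob {\<omega> \<in> space M. Z \<omega> = z \<and> (C1 \<omega>, C0 \<omega>) \<in> B} = pmf (bernoulli_pmf q) z * measure Q B"
    if B: "B \<in> sets (borel \<Otimes>\<^sub>M borel)" for z B
  proof -
    have "prob {\<omega> \<in> space M. Z \<omega> = z \<and> (C1 \<omega>, C0 \<omega>) \<in> B} =
       measure (distr M (count_space UNIV \<Otimes>\<^sub>M (borel \<Otimes>\<^sub>M borel)) (\<lambda>\<omega>. (Z \<omega>, C1 \<omega>, C0 \<omega>))) ({z} \<times> B)"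
      using B by (subst measure_distr[OF meas]) (auto intro!: arg_cong[where f = prob])
    also have "\<dots> = measure (measure_pmf (bernoulli_pmf q)) {z} * measure Q B"
      unfolding d measure_def
      by (subst Q.emeasure_pair_measure_Times) (use B sQ in \<open>auto simp: enn2real_mult\<close>)
    finally show ?thesis by (simp add: measure_pmf_single)
  qed
  have B1: "{x. c \<le> fst x} \<in> sets (borel \<Otimes>\<^sub>M borel :: (ennreal \<times> ennreal) measure)"
    and B0: "{x. c \<le> snd x} \<in> sets (borel \<Otimes>\<^sub>M borel :: (ennreal \<times> ennreal) measure)"
  proof -
    have "{x \<in> space (borel \<Otimes>\<^sub>M borel). c \<le> fst x} \<in> sets (borel \<Otimes>\<^sub>M borel :: (ennreal \<times> ennreal)
        measure)"
      "{x \<in> space (borel \<Otimes>\<^sub>M borel). c \<le> snd x} \<in> sets (borel \<Otimes>\<^sub>M borel :: (ennreal \<times> ennreal)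
          measure)"
      by measurable
    then show "{x. c \<le> fst x} \<in> sets (borel \<Otimes>\<^sub>M borel :: (ennreal \<times> ennreal) measure)"
      "{x. c \<le> snd x} \<in> sets (borel \<Otimes>\<^sub>M borel :: (ennreal \<times> ennreal) measure)"
      by (auto simp: space_pair_measure)
  qed
  show ?th1 using key[OF B1, of True] q01 by simp
  show ?th2 using key[OF B0, of False] q01 by simp
qed

lemma stratum_statistics:
  fixes T0 :: "nat \<Rightarrow> real" and s :: 's
  assumes str: "stratum I p ({s} \<times> {..<m}) P (\<lambda>i. event_index {..<m} T0 (snd i)) (nK {..<m} T0)
      risk_treated risk"
  defines "\<K> \<equiv> nK {..<m} T0" and "\<J> \<equiv> {s} \<times> {..<m}" and "\<e> \<equiv> \<lambda>i :: 's \<times> nat. event_index {..<m} T0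
      (snd i)"
  shows "k < \<K> \<Longrightarrow> stratum.d \<J> \<e> k = real (dk {..<m} T0 k)"
    and "k < \<K> \<Longrightarrow> stratum.h \<J> \<e> k = hk {..<m} T0 k"
proof -
  interpret st: stratum I dflt p "{s} \<times> {..<m}" P "\<lambda>i. event_index {..<m} T0 (snd i)" "nK {..<m}
      T0" risk_treated risk for dflt
    by (rule str)
  assume k: "k < \<K>"
  have "{i \<in> {s} \<times> {..<m}. event_index {..<m} T0 (snd i) = k}
      = Pair s ` {j \<in> {..<m}. event_index {..<m} T0 j = k}"
    by auto
  also have "{j \<in> {..<m}. event_index {..<m} T0 j = k} = {j \<in> {..<m}. T0 j = evt_time {..<m} T0 k}"
    using event_index_eq_iff[of "{..<m}" _ k T0] k unfolding \<K>_def by auto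
  finally have "card (st.Ev k) = dk {..<m} T0 k" unfolding st.Ev_def dk_def
      by (simp add: card_image inj_on_def)
  then show d: "stratum.d \<J> \<e> k = real (dk {..<m} T0 k)" unfolding \<J>_def \<e>_def st.d_def by simp
  have "{i \<in> {s} \<times> {..<m}. k \<le> event_index {..<m} T0 (snd i)}
      = Pair s ` {j \<in> {..<m}. evt_time {..<m} T0 k \<le> T0 j}"
    using le_event_index_iff[of "{..<m}" _ k T0] k unfolding \<K>_def by auto
  then have "card (st.R k) = nk {..<m} T0 k" unfolding st.R_def nk_def
      by (simp add: card_image inj_on_def)
  then show "stratum.h \<J> \<e> k = hk {..<m} T0 k"
    using d unfolding \<J>_def \<e>_def st.h_def hk_def st.n_def by simp
qed

lemma stratum_logrank:
  fixes T0 :: "nat \<Rightarrow> real" and s :: 's and x :: "'s \<times> nat \<Rightarrow> bool \<times> nat set"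
  assumes str: "stratum I p ({s} \<times> {..<m}) P (\<lambda>i. event_index {..<m} T0 (snd i)) (nK {..<m} T0)
      risk_treated risk"
    and T0: "\<And>j. 0 \<le> T0 j"
    and x: "\<And>j. j < m \<Longrightarrow> x (s, j) = risk_type {..<m} T0 (z j, c1 j, c0 j)"
  defines "\<K> \<equiv> nK {..<m} T0" and "\<J> \<equiv> {s} \<times> {..<m}" and "\<e> \<equiv> \<lambda>i :: 's \<times> nat. event_index {..<m} T0
      (snd i)"
    and "W \<equiv> \<lambda>j. obs_W (T0 j) (T0 j) (z j) (c1 j) (c0 j)" and "Dl \<equiv> \<lambda>j. obs_Delta (T0 j) (T0 j) (z
        j) (c1 j) (c0 j)"
  shows "lr_L {..<m} T0 z W Dl = stratum.L \<J> \<e> \<K> risk_treated risk x"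
    and "lr_U {..<m} T0 z W Dl = stratum.U \<J> \<e> \<K> risk_treated risk x"
proof -
  interpret st: stratum I dflt p "{s} \<times> {..<m}" P "\<lambda>i. event_index {..<m} T0 (snd i)" "nK {..<m}
      T0" risk_treated risk for dflt
    by (rule str)
  let ?t = "evt_time {..<m} T0" and ?c = "\<lambda>j. if z j then c1 j else c0 j" and ?K = "nK {..<m} T0"
  have t: "0 \<le> ?t k" if "k < ?K" for k
    using bij_betw_apply[OF bij_evt_time[of "{..<m}" T0], of k] that T0 by auto
  have W: "ennreal (?t k) \<le> W j \<longleftrightarrow> ?t k \<le> T0 j \<and> ennreal (?t k) \<le> ?c j" for j k
    unfolding W_def obs_W_def using T0[of j] by (simp add: ennreal_le_iff)
  have Dl: "Dl j \<and> W j = ennreal (?t k) \<longleftrightarrow> T0 j = ?t k \<and> ennreal (?t k) \<le> ?c j" if "k < ?K" for j k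
    unfolding W_def obs_W_def Dl_def obs_Delta_def using T0[of j] t[OF that] by (auto simp: min_def)
  have r1: "risk_treated k (x (s, j)) = of_bool (z j \<and> ennreal (?t k) \<le> ?c j)"
    and r: "risk k (x (s, j)) = of_bool (ennreal (?t k) \<le> ?c j)" if "k < ?K" "j < m" for k j
    using that x by (auto simp: risk_treated_def risk_def risk_type_def)
  have slice: "(\<Sum>i\<in>{i \<in> {s} \<times> {..<m}. A i}. f (x i)) = real (card {j \<in> {..<m}. A (s, j) \<and> B j})"
    if "\<And>j. j < m \<Longrightarrow> f (x (s, j)) = of_bool (B j)" for A f B
  proof -
    have "(\<Sum>i\<in>{i \<in> {s} \<times> {..<m}. A i}. f (x i)) = (\<Sum>i\<in>{i \<in> {s} \<times> {..<m}. A i}. of_bool (B (snd i)))"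
      by (rule sum.cong) (use that in auto)
    then show ?thesis by (simp add: sum_of_bool_slice)
  qed
  have N: "real (Nk {..<m} T0 W k) = st.N k x" and N1: "real (N1k {..<m} T0 z W k) = st.N1 k x"
    and N0: "real (N0k {..<m} T0 z W k) = st.N k x - st.N1 k x"
    and D: "real (Dk {..<m} T0 W Dl k) = st.D k x" and D1: "real (D1k {..<m} T0 z W Dl k)
        = st.D1 k x"
    if k: "k < ?K" for k
  proof -
    have iff: "k \<le> event_index {..<m} T0 j \<longleftrightarrow> ?t k \<le> T0 j" "event_index {..<m} T0 j = k \<longleftrightarrow> T0 j
        = ?t k" if "j < m" for j
      using le_event_index_iff[of "{..<m}" j k T0] event_index_eq_iff[of "{..<m}" j k T0] that k
          by auto
    have "st.N k x = real (card {j \<in> {..<m}. k \<le> event_index {..<m} T0 j \<and> ennreal (?t k) \<le> ?c j})"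
      unfolding st.N_def st.R_def using slice[of "risk k" "\<lambda>j. ennreal (?t k) \<le> ?c j" "\<lambda>i. k
          \<le> event_index {..<m} T0 (snd i)", OF r[OF k]] by simp
    also have "{j \<in> {..<m}. k \<le> event_index {..<m} T0 j \<and> ennreal (?t k) \<le> ?c j}
        = {i \<in> {..<m}. ennreal (?t k) \<le> W i}"
      using W iff by auto
    finally show N: "real (Nk {..<m} T0 W k) = st.N k x" unfolding Nk_def by simp
    have "st.N1 k x = real (card {j \<in> {..<m}. k
        \<le> event_index {..<m} T0 j \<and> (z j \<and> ennreal (?t k) \<le> ?c j)})"
      unfolding st.N1_def st.R_def using slice[of "risk_treated k" "\<lambda>j. (z j \<and> ennreal (?t k)
          \<le> ?c j)" "\<lambda>i. k \<le> event_index {..<m} T0 (snd i)", OF r1[OF k]] by simp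
    also have "{j \<in> {..<m}. k \<le> event_index {..<m} T0 j \<and> (z j \<and> ennreal (?t k) \<le> ?c j)}
        = {i \<in> {..<m}. z i \<and> ennreal (?t k) \<le> W i}"
      using W iff by auto
    finally show N1: "real (N1k {..<m} T0 z W k) = st.N1 k x" unfolding N1k_def by simp
    have "st.D k x = real (card {j \<in> {..<m}. event_index {..<m} T0 j = k \<and> ennreal (?t k) \<le> ?c j})"
      unfolding st.D_def st.Ev_def using slice[of "risk k" "\<lambda>j. ennreal (?t k)
          \<le> ?c j" "\<lambda>i. event_index {..<m} T0 (snd i) = k", OF r[OF k]] by simp
    also have "{j \<in> {..<m}. event_index {..<m} T0 j = k \<and> ennreal (?t k) \<le> ?c j}
        = {i \<in> {..<m}. Dl i \<and> W i = ennreal (?t k)}"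
      using Dl[OF k] iff by auto
    finally show "real (Dk {..<m} T0 W Dl k) = st.D k x" unfolding Dk_def by simp
    have "st.D1 k x = real (card {j \<in> {..<m}. event_index {..<m} T0 j
        = k \<and> (z j \<and> ennreal (?t k) \<le> ?c j)})"
      unfolding st.D1_def st.Ev_def using slice[of "risk_treated k" "\<lambda>j. (z j \<and> ennreal (?t k)
          \<le> ?c j)" "\<lambda>i. event_index {..<m} T0 (snd i) = k", OF r1[OF k]] by simp
    also have "{j \<in> {..<m}. event_index {..<m} T0 j = k \<and> (z j \<and> ennreal (?t k) \<le> ?c j)}
        = {i \<in> {..<m}. z i \<and> Dl i \<and> W i = ennreal (?t k)}"
      using Dl[OF k] iff by auto
    finally show "real (D1k {..<m} T0 z W Dl k) = st.D1 k x" unfolding D1k_def by simp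
    have "{i \<in> {..<m}. ennreal (?t k) \<le> W i} = {i \<in> {..<m}. z i \<and> ennreal (?t k)
        \<le> W i} \<union> {i \<in> {..<m}. \<not> z i \<and> ennreal (?t k) \<le> W i}"
      by auto
    then have "Nk {..<m} T0 W k = N1k {..<m} T0 z W k + N0k {..<m} T0 z W k"
      unfolding Nk_def N1k_def N0k_def by (simp add: card_Un_disjoint disjoint_iff)
    then show "real (N0k {..<m} T0 z W k) = st.N k x - st.N1 k x" using N N1 by simp
  qed
  show "lr_L {..<m} T0 z W Dl = stratum.L \<J> \<e> \<K> risk_treated risk x"
    unfolding lr_L_def \<J>_def \<e>_def \<K>_def st.L_def Mk_def
        by (intro sum.cong refl) (simp add: N N1 D D1)
  show "lr_U {..<m} T0 z W Dl = stratum.U \<J> \<e> \<K> risk_treated risk x"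
    unfolding lr_U_def \<J>_def \<e>_def \<K>_def st.U_def Vk_def st.V_def Let_def
        by (intro sum.cong refl) (simp add: N N1 N0 D)
qed

section \<open>Growth of the variance and the limit theorem\<close>

lemma (in prob_space) stratum_pmf:
  fixes Z :: "nat \<Rightarrow> 'a \<Rightarrow> bool" and C1 C0 :: "nat \<Rightarrow> 'a \<Rightarrow> ennreal"
  assumes meas: "\<And>j. j < m \<Longrightarrow> (\<lambda>\<omega>. (Z j \<omega>, C1 j \<omega>, C0 j \<omega>)) \<in> measurable M (count_space UNIV \<Otimes>\<^sub>M
      (borel \<Otimes>\<^sub>M borel))"
    and bern: "\<And>j. j < m \<Longrightarrow> prob {\<omega> \<in> space M. Z j \<omega>} = q"
    and prod: "\<And>j. j < m \<Longrightarrow> distr M (count_space UNIV \<Otimes>\<^sub>M (borel \<Otimes>\<^sub>M borel)) (\<lambda>\<omega>. (Z j \<omega>, C1 j \<omega>,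
        C0 j \<omega>))
       = distr M (count_space UNIV) (Z j) \<Otimes>\<^sub>M distr M (borel \<Otimes>\<^sub>M borel) (\<lambda>\<omega>. (C1 j \<omega>, C0 j \<omega>))"
    and Q: "\<And>j. j < m \<Longrightarrow> distr M (borel \<Otimes>\<^sub>M borel) (\<lambda>\<omega>. (C1 j \<omega>, C0 j \<omega>)) = Q"
  shows "\<exists>P. finite (set_pmf P) \<and>
    (\<forall>j<m. measure_pmf P = distr M (count_space UNIV) (\<lambda>\<omega>. risk_type J T0 (Z j \<omega>, C1 j \<omega>, C0 j
        \<omega>))) \<and>
    (\<forall>k. 0 < m \<longrightarrow> k < nK J T0 \<longrightarrow>
       measure_pmf.expectation P (risk_treated k) = q * measure Q {x. ennreal (evt_time J T0 k)
           \<le> fst x} \<and>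
       measure_pmf.expectation P (risk k) = q * measure Q {x. ennreal (evt_time J T0 k) \<le> fst x}
         + (1 - q) * measure Q {x. ennreal (evt_time J T0 k) \<le> snd x})"
proof (cases "m = 0")
  case True
  then show ?thesis by (intro exI[of _ "return_pmf (False, {})"]) auto
next
  case False
  then have m: "0 < m" by simp
  let ?N = "count_space UNIV \<Otimes>\<^sub>M (borel \<Otimes>\<^sub>M borel) :: (bool \<times> ennreal \<times> ennreal) measure"
  let ?b = "\<lambda>j \<omega>. (Z j \<omega>, C1 j \<omega>, C0 j \<omega>)"
  let ?X = "\<lambda>j \<omega>. risk_type J T0 (?b j \<omega>)"
  note law = risk_probability[OF meas bern prod Q]
  have X: "?X j \<in> measurable M (count_space UNIV)" if "j < m" for j
    by (rule measurable_compose[OF meas[OF that] measurable_risk_type])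
  have distr_X: "distr M (count_space UNIV) (?X j)
      = distr (measure_pmf (bernoulli_pmf q) \<Otimes>\<^sub>M Q) (count_space UNIV) (risk_type J T0)"
      if "j < m" for j
    unfolding law(3)[OF that that that that, symmetric]
    by (subst distr_distr[OF measurable_risk_type meas[OF that]]) (simp add: o_def)
  obtain P where P: "measure_pmf P = distr M (count_space UNIV) (?X 0)" "finite (set_pmf P)"
    by (rule pmf_of_finite_range[OF X[OF m], of "UNIV \<times> Pow {..<nK J T0}"]) (auto simp:
        risk_type_def)
  show ?thesis
  proof (intro exI[of _ P] conjI allI impI)
    show "finite (set_pmf P)" by (rule P)
    show "measure_pmf P = distr M (count_space UNIV) (?X j)" if "j < m" for j
      using distr_X[OF that] distr_X[OF m] P(1) by simp
    fix k assume k: "k < nK J T0"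
    let ?c = "ennreal (evt_time J T0 k)"
    have exp: "measure_pmf.expectation P f = expectation (\<lambda>\<omega>. f (?X 0 \<omega>))" for f :: "bool \<times> nat
        set \<Rightarrow> real"
      unfolding P(1) by (rule integral_distr[OF X[OF m]]) simp
    have [measurable]: "Measurable.pred M (Z 0)" "C1 0 \<in> borel_measurable M" "C0 0 \<in>
        borel_measurable M"
      using measurable_compose[OF meas[OF m] measurable_fst]
        measurable_compose[OF measurable_compose[OF meas[OF m] measurable_snd] measurable_fst]
        measurable_compose[OF measurable_compose[OF meas[OF m] measurable_snd] measurable_snd]
      by auto
    define A1 A0 where "A1 = {\<omega> \<in> space M. Z 0 \<omega> \<and> ?c \<le> C1 0 \<omega>}" and "A0
        = {\<omega> \<in> space M. \<not> Z 0 \<omega> \<and> ?c \<le> C0 0 \<omega>}"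
    have s[measurable]: "A1 \<in> sets M" "A0 \<in> sets M" unfolding A1_def A0_def by measurable
    have "expectation (\<lambda>\<omega>. risk_treated k (?X 0 \<omega>)) = expectation (indicat_real A1)"
      by (rule Bochner_Integration.integral_cong) (use k in \<open>auto simp: risk_treated_def
          risk_type_def A1_def indicator_def\<close>)
    also have "\<dots> = prob A1" using s by simp
    finally show 1: "measure_pmf.expectation P (risk_treated k) = q * measure Q {x. ?c \<le> fst x}"
      unfolding exp A1_def using law(1)[OF m m m m] by simp
    have "expectation (\<lambda>\<omega>. risk k (?X 0 \<omega>)) = expectation (\<lambda>\<omega>. indicat_real A1 \<omega>
        + indicat_real A0 \<omega>)"
      by (rule Bochner_Integration.integral_cong) (use k in \<open>auto simp: risk_def risk_type_def
          A1_def A0_def indicator_def\<close>)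
    also have "\<dots> = prob A1 + prob A0" using s by (simp add: emeasure_eq_measure)
    finally show "measure_pmf.expectation P (risk k) = q * measure Q {x. ?c \<le> fst x}
        + (1 - q) * measure Q {x. ?c \<le> snd x}"
      unfolding exp A1_def A0_def using law(1,2)[OF m m m m] by simp
  qed
qed

lemma sum_event_times:
  assumes "finite J"
  shows "(\<Sum>k<nK J T0. real (dk J T0 k) * g (evt_time J T0 k)) = (\<Sum>j\<in>J. g (T0 j))"
proof -
  have "(\<Sum>j\<in>J. g (T0 j)) = (\<Sum>k<nK J T0. \<Sum>j\<in>{j \<in> J. event_index J T0 j = k}. g (T0 j))"
    by (rule sum.group[symmetric]) (use assms event_index_image[OF assms, of T0] in auto)
  also have "\<dots> = (\<Sum>k<nK J T0. real (dk J T0 k) * g (evt_time J T0 k))"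
  proof (rule sum.cong[OF refl])
    fix k assume "k \<in> {..<nK J T0}"
    then have "{j \<in> J. event_index J T0 j = k} = {j \<in> J. T0 j = evt_time J T0 k}"
      using event_index_eq_iff[OF assms] by auto
    then show "(\<Sum>j\<in>{j \<in> J. event_index J T0 j = k}. g (T0 j))
        = real (dk J T0 k) * g (evt_time J T0 k)"
      by (simp add: dk_def)
  qed
  finally show ?thesis ..
qed

lemma stratum_variance_growth:
  fixes m :: "nat \<Rightarrow> nat" and T0 :: "nat \<Rightarrow> nat \<Rightarrow> real" and s :: 's
    and p :: "nat \<Rightarrow> 's \<times> nat \<Rightarrow> (bool \<times> nat set) pmf"
  defines "\<K> \<equiv> \<lambda>n. nK {..<m n} (T0 n)" and "\<J> \<equiv> \<lambda>n. {s} \<times> {..<m n}"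
    and "\<e> \<equiv> \<lambda>n (i :: 's \<times> nat). event_index {..<m n} (T0 n) (snd i)"
    and "\<t> \<equiv> \<lambda>n. evt_time {..<m n} (T0 n)"
  assumes str: "\<And>n. stratum (I n) (p n) (\<J> n) (P n) (\<e> n) (\<K> n) risk_treated risk"
    and treated: "\<And>n k. 0 < m n \<Longrightarrow> k < \<K> n \<Longrightarrow> measure_pmf.expectation (P n) (risk_treated k)
        = q n * G1 n (\<t> n k)"
    and all: "\<And>n k. 0 < m n \<Longrightarrow> k < \<K> n \<Longrightarrow>
       measure_pmf.expectation (P n) (risk k) = q n * G1 n (\<t> n k) + (1 - q n) * G0 n (\<t> n k)"
    and G: "\<And>n c. 0 < m n \<Longrightarrow> 0 \<le> G1 n c \<and> G1 n c \<le> 1 \<and> 0 \<le> G0 n c \<and> G0 n c \<le> 1"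
    and q: "\<And>n. 0 < q n \<and> q n < 1"
    and m: "filterlim m at_top sequentially"
    and cond: "cond1 q m T0 G1 G0 \<or> cond2 q m T0 G1 G0"
  shows "filterlim (\<lambda>n. stratum.\<sigma>2 (\<J> n) (P n) (\<e> n) (\<K> n) risk_treated risk / sqrt (real (m n)))
      at_top sequentially"
proof -
  define v where "v n = stratum.\<sigma>2 (\<J> n) (P n) (\<e> n) (\<K> n) risk_treated risk" for n
  have m': "filterlim (\<lambda>n. real (m n)) at_top sequentially"
    by (rule filterlim_compose[OF filterlim_real_sequentially m])
  have m_pos: "\<forall>\<^sub>F n in sequentially. 0 < m n" 
    by (rule eventually_compose_filterlim[OF eventually_gt_at_top m])
  have card: "card (\<J> n) = m n" for n by (simp add: \<J>_def)
  have d: "stratum.d (\<J> n) (\<e> n) k = real (dk {..<m n} (T0 n) k)" "stratum.h (\<J> n) (\<e> n) k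
      = hk {..<m n} (T0 n) k" if "k < \<K> n" for n k
    using stratum_statistics[OF str[unfolded \<J>_def \<e>_def \<K>_def]] that
        unfolding \<J>_def \<e>_def \<K>_def by auto
  have prod: "stratum.\<pi>1 (P n) risk_treated k * (stratum.\<pi> (P n) risk k - stratum.\<pi>1 (P n)
      risk_treated k)
       = q n * (1 - q n) * (G1 n (\<t> n k) * G0 n (\<t> n k))" if "0 < m n" "k < \<K> n" for n k
    unfolding stratum.\<pi>1_def[OF str] stratum.\<pi>_def[OF str] using treated[OF that] all[OF that]
        by simp
  have qq: "0 \<le> q n * (1 - q n)" for n using q[of n] by simp
  show ?thesis
    using cond
  proof
    assume c: "cond1 q m T0 G1 G0"
    define dm where "dm n = real (Max ((\<lambda>k. dk {..<m n} (T0 n) k) ` {..<\<K> n}))" for n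
    define gt where "gt n = (\<Sum>j<m n. G1 n (T0 n j) * G0 n (T0 n j)) / real (m n)" for n
    obtain l l' where l: "0 < l" "q \<longlonglongrightarrow> l" "0 < l'" "(\<lambda>n. 1 - q n) \<longlonglongrightarrow> l'"
      and lim: "filterlim (\<lambda>n. min ((gt n / dm n) * sqrt (real (m n) / ln (real (m n)))) (gt n *
          real (m n) / dm n ^ 3)) at_top sequentially"
      using c unfolding cond1_def Let_def gt_def dm_def \<K>_def by auto
    have lim1: "filterlim (\<lambda>n. (gt n / dm n) * sqrt (real (m n) / ln (real (m n)))) at_top
        sequentially"
      by (rule filterlim_at_top_mono[OF lim]) auto
    have d_le: "stratum.d (\<J> n) (\<e> n) k \<le> dm n" if "k < \<K> n" for n k
      unfolding d(1)[OF that] dm_def of_nat_le_iff by (rule Max_ge) (use that in auto)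
    have dm1: "1 \<le> dm n" if "0 < m n" for n
    proof -
      have "0 < \<K> n" unfolding \<K>_def nK_def using that by (auto simp: card_gt_0_iff)
      then show ?thesis using stratum.d_ge_1[OF str] d_le by (meson order_trans)
    qed
    have gt0: "0 \<le> gt n" for n unfolding gt_def using G[of n]
        by (auto intro!: divide_nonneg_nonneg sum_nonneg mult_nonneg_nonneg)
    have bnd: "q n * (1 - q n) * (real (m n) * gt n - 2 * dm n * sqrt (real (m n))) \<le> v n"
        if mn: "0 < m n" for n
    proof -
      have "q n * (1 - q n) * ((\<Sum>k<\<K> n. stratum.d (\<J> n) (\<e> n) k * (G1 n (\<t> n k) * G0 n (\<t> n k))) -
          2 * dm n * sqrt (real (card (\<J> n)))) \<le> v n"
        unfolding v_def
        by (rule stratum.\<sigma>2_ge_sum[OF str prod[OF mn] _ qq d_le]) (use G[OF mn] dm1[OF mn] in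
            \<open>auto intro: mult_le_one\<close>)
      also have "(\<Sum>k<\<K> n. stratum.d (\<J> n) (\<e> n) k * (G1 n (\<t> n k) * G0 n (\<t> n k))) =
          (\<Sum>k<\<K> n. real (dk {..<m n} (T0 n) k) * (G1 n (\<t> n k) * G0 n (\<t> n k)))"
        by (intro sum.cong refl) (simp add: d)
      also have "\<dots> = real (m n) * gt n"
        unfolding gt_def \<K>_def \<t>_def using sum_event_times[of "{..<m n}" "T0 n" "\<lambda>c. G1 n c * G0 n
            c"] mn by simp
      finally show ?thesis unfolding card .
    qed
    have ev: "\<forall>\<^sub>F n in sequentially. q n * (1 - q n) * (real (m n) * gt n - 2 * dm n * sqrt (real
        (m n))) \<le> v n"
      by (rule eventually_mono[OF m_pos bnd])
    show ?thesis unfolding v_def[symmetric]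
      by (rule variance_growth_few_ties[OF l(2,1,4,3) m' lim1 gt0 _ qq ev])
        (use m_pos dm1 in \<open>auto elim: eventually_mono\<close>)
  next
    assume "cond2 q m T0 G1 G0"
    then obtain K k l l' a b c e where K: "\<forall>\<^sub>F n in sequentially. nK {..<m n} (T0 n) = K" "k < K"
      and l: "0 < l" "q \<longlonglongrightarrow> l" "0 < l'" "(\<lambda>n. 1 - q n) \<longlonglongrightarrow> l'"
      and lims: "(\<lambda>n. real (dk {..<m n} (T0 n) k) / real (m n)) \<longlonglongrightarrow> a" "a > 0"
        "(\<lambda>n. G1 n (evt_time {..<m n} (T0 n) k)) \<longlonglongrightarrow> b" "b > 0"
        "(\<lambda>n. G0 n (evt_time {..<m n} (T0 n) k)) \<longlonglongrightarrow> c" "c > 0"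
        "(\<lambda>n. hk {..<m n} (T0 n) k) \<longlonglongrightarrow> e" "e < 1"
      unfolding cond2_def by blast
    have g: "(\<lambda>n. G1 n (\<t> n k) * G0 n (\<t> n k)) \<longlonglongrightarrow> b * c" unfolding \<t>_def by (intro tendsto_mult lims)
    have bc: "0 < b * c" using lims by simp
    have ev: "\<forall>\<^sub>F n in sequentially. q n * (1 - q n) * (real (dk {..<m n} (T0 n) k) * (1 - hk
        {..<m n} (T0 n) k) * (G1 n (\<t> n k) * G0 n (\<t> n k))) \<le> v n"
      using m_pos K(1)
    proof eventually_elim
      case (elim n)
      then have k: "k < \<K> n" using K(2) unfolding \<K>_def by simp
      show ?case using stratum.\<sigma>2_ge_term[OF str k prod[OF elim(1) k]] unfolding v_def d[OF k] .
    qed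
    show ?thesis unfolding v_def[symmetric]
      by (rule variance_growth_many_ties[OF l(2,1,4,3) m' lims(1,2) g bc lims(7,8) ev])
  qed
qed

theorem theorem6:
  fixes S :: nat
    and m :: "nat \<Rightarrow> nat \<Rightarrow> nat"
    and T1 T0 :: "nat \<Rightarrow> nat \<Rightarrow> nat \<Rightarrow> real"
    and M :: "nat \<Rightarrow> 'a measure"
    and Z :: "nat \<Rightarrow> nat \<Rightarrow> nat \<Rightarrow> 'a \<Rightarrow> bool"
    and C1 C0 :: "nat \<Rightarrow> nat \<Rightarrow> nat \<Rightarrow> 'a \<Rightarrow> ennreal"
    and p :: "nat \<Rightarrow> nat \<Rightarrow> real"
    and Q :: "nat \<Rightarrow> nat \<Rightarrow> (ennreal \<times> ennreal) measure"
  assumes size: "\<And>n. (\<Sum>s<S. m n s) = n"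
    and nonneg: "\<And>n s j. 0 \<le> T1 n s j" "\<And>n s j. 0 \<le> T0 n s j"
    and H0: "\<And>n s j. T1 n s j = T0 n s j"
    and prob: "\<And>n. prob_space (M n)"
    and indep: "\<And>n. prob_space.indep_vars (M n)
                   (\<lambda>_. count_space UNIV \<Otimes>\<^sub>M (borel \<Otimes>\<^sub>M borel))
                   (\<lambda>(s, j) \<omega>. (Z n s j \<omega>, C1 n s j \<omega>, C0 n s j \<omega>))
                   {(s, j). s < S \<and> j < m n s}"
    and A1_p: "\<And>n s. s < S \<Longrightarrow> 0 < p n s \<and> p n s < 1"
    and A1_bern: "\<And>n s j. s < S \<Longrightarrow> j < m n s \<Longrightarrow>
                    measure (M n) {\<omega> \<in> space (M n). Z n s j \<omega>} = p n s"
    and A1_indep: "\<And>n s j. s < S \<Longrightarrow> j < m n s \<Longrightarrow>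
                    distr (M n) (count_space UNIV \<Otimes>\<^sub>M (borel \<Otimes>\<^sub>M borel))
                      (\<lambda>\<omega>. (Z n s j \<omega>, C1 n s j \<omega>, C0 n s j \<omega>))
                    = distr (M n) (count_space UNIV) (Z n s j) \<Otimes>\<^sub>M
                      distr (M n) (borel \<Otimes>\<^sub>M borel) (\<lambda>\<omega>. (C1 n s j \<omega>, C0 n s j \<omega>))"
    and A2: "\<And>n s j. s < S \<Longrightarrow> j < m n s \<Longrightarrow>
               distr (M n) (borel \<Otimes>\<^sub>M borel) (\<lambda>\<omega>. (C1 n s j \<omega>, C0 n s j \<omega>)) = Q n s"
    and C3_size: "\<And>s. s < S \<Longrightarrow> filterlim (\<lambda>n. m n s) at_top sequentially"
    and C3_cond: "\<And>s. s < S \<Longrightarrow>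
        (let G1 = (\<lambda>n c. measure (Q n s) {x. ennreal c \<le> fst x});
             G0 = (\<lambda>n c. measure (Q n s) {x. ennreal c \<le> snd x})
         in cond1 (\<lambda>n. p n s) (\<lambda>n. m n s) (\<lambda>n. T0 n s) G1 G0 \<or>
            cond2 (\<lambda>n. p n s) (\<lambda>n. m n s) (\<lambda>n. T0 n s) G1 G0)"
  shows "weak_conv_m
     (\<lambda>n. distr (M n) borel (\<lambda>\<omega>.
        let W = (\<lambda>s j. obs_W (T1 n s j) (T0 n s j) (Z n s j \<omega>) (C1 n s j \<omega>) (C0 n s j \<omega>));
            Dl = (\<lambda>s j. obs_Delta (T1 n s j) (T0 n s j) (Z n s j \<omega>) (C1 n s j \<omega>) (C0 n s j \<omega>))
        in (\<Sum>s<S. lr_L {..<m n s} (T0 n s) (\<lambda>j. Z n s j \<omega>) (W s) (Dl s))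
           / sqrt (\<Sum>s<S. lr_U {..<m n s} (T0 n s) (\<lambda>j. Z n s j \<omega>) (W s) (Dl s))))
     std_normal_distribution"
proof -
  let ?N = "count_space UNIV \<Otimes>\<^sub>M (borel \<Otimes>\<^sub>M borel) :: (bool \<times> ennreal \<times> ennreal) measure"
  have S: "0 < S" using size[of 1] by (cases S) auto
  define I where "I n = {(s, j). s < S \<and> j < m n s}" for n
  have fin_I: "finite (I n)" for n
  proof -
    have "I n = (SIGMA s:{..<S}. {..<m n s})" unfolding I_def by auto
    then show ?thesis by simp
  qed
  have meas: "(\<lambda>\<omega>. (Z n s j \<omega>, C1 n s j \<omega>, C0 n s j \<omega>)) \<in> measurable (M n) ?N"
      if "s < S" "j < m n s" for n s j
  proof -
    have "\<forall>i\<in>{(s, j). s < S \<and> j < m n s}. (case i of (s, j) \<Rightarrow> \<lambda>\<omega>. (Z n s j \<omega>, C1 n s j \<omega>, C0 n s j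
        \<omega>)) \<in> measurable (M n) ?N"
      using indep[of n] unfolding prob_space.indep_vars_def2[OF prob] by auto
    then show ?thesis using that by auto
  qed
  define X where "X n i \<omega> = risk_type {..<m n (fst i)} (T0 n (fst i)) (Z n (fst i) (snd i) \<omega>, C1 n
      (fst i) (snd i) \<omega>, C0 n (fst i) (snd i) \<omega>)" for n i \<omega>
  define G1 G0 where "G1 s n c = measure (Q n s) {x. ennreal c \<le> fst x}" and "G0 s n c
      = measure (Q n s) {x. ennreal c \<le> snd x}" for s n c
  define K where "K n s = nK {..<m n s} (T0 n s)" for n s
  define e where "e n s i = event_index {..<m n s} (T0 n s) (snd i)" for n s and i :: "nat \<times> nat"
  define J where "J n s = {s} \<times> {..<m n s}" for n and s :: nat
  define good where "good n s P \<longleftrightarrow> finite (set_pmf P) \<and>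
    (\<forall>j<m n s. measure_pmf P = distr (M n) (count_space UNIV) (X n (s, j))) \<and>
    (\<forall>k. 0 < m n s \<longrightarrow> k < K n s \<longrightarrow>
       measure_pmf.expectation P (risk_treated k)
           = p n s * G1 s n (evt_time {..<m n s} (T0 n s) k) \<and>
       measure_pmf.expectation P (risk k) = p n s * G1 s n (evt_time {..<m n s} (T0 n s) k)
           + (1 - p n s) * G0 s n (evt_time {..<m n s} (T0 n s) k))"
    for n s P
  define P where "P n s = (SOME P. good n s P)" for n s
  have good: "good n s (P n s)" if "s < S" for n s
  proof -
    have "\<exists>P. good n s P"
      unfolding good_def X_def G1_def G0_def K_def fst_conv snd_conv
      by (rule prob_space.stratum_pmf[OF prob meas[OF that] A1_bern[OF that] A1_indep[OF that]
          A2[OF that]])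
    then show ?thesis unfolding P_def by (rule someI_ex)
  qed
  have P_fin: "\<And>n s. s < S \<Longrightarrow> finite (set_pmf (P n s))"
    and P_distr: "\<And>n s j. s < S \<Longrightarrow> j < m n s \<Longrightarrow> measure_pmf (P n s)
        = distr (M n) (count_space UNIV) (X n (s, j))"
    and P_treated: "\<And>n s k. s < S \<Longrightarrow> 0 < m n s \<Longrightarrow> k < K n s \<Longrightarrow>
       measure_pmf.expectation (P n s) (risk_treated k)
           = p n s * G1 s n (evt_time {..<m n s} (T0 n s) k)"
    and P_all: "\<And>n s k. s < S \<Longrightarrow> 0 < m n s \<Longrightarrow> k < K n s \<Longrightarrow>
       measure_pmf.expectation (P n s) (risk k) = p n s * G1 s n (evt_time {..<m n s} (T0 n s) k)
           + (1 - p n s) * G0 s n (evt_time {..<m n s} (T0 n s) k)"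
    using good unfolding good_def by blast+
  define pp where "pp n i = P n (fst i)" for n and i :: "nat \<times> nat"
  have str: "stratum (I n) (pp n) (J n s) (P n s) (e n s) (K n s) risk_treated risk"
      if s: "s < S" for n s
  proof
    show "finite (I n)" by (rule fin_I)
    show "finite (set_pmf (pp n i))" if "i \<in> I n" for i using that P_fin
        by (auto simp: I_def pp_def)
    show "J n s \<subseteq> I n" using s by (auto simp: J_def I_def)
    show "pp n i = P n s" if "i \<in> J n s" for i using that by (auto simp: J_def pp_def)
    show "finite (set_pmf (P n s))" by (rule P_fin[OF s])
    have "e n s ` J n s = event_index {..<m n s} (T0 n s) ` {..<m n s}" unfolding e_def J_def
        by force
    then show "e n s ` J n s = {..<K n s}" unfolding K_def
        using event_index_image[of "{..<m n s}" "T0 n s"] by simp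
  qed (auto simp: risk_def risk_treated_def)
  interpret fp: finite_product "I n" "(False, {})" "pp n" for n
    using fin_I P_fin by unfold_locales (auto simp: I_def pp_def)
  define \<sigma>2 where "\<sigma>2 n s = stratum.\<sigma>2 (J n s) (P n s) (e n s) (K n s) risk_treated risk" for n s
  have growth: "filterlim (\<lambda>n. \<sigma>2 n s / sqrt (real (m n s))) at_top sequentially"
      if s: "s < S" for s
  proof -
    have G: "0 \<le> G1 s n c \<and> G1 s n c \<le> 1 \<and> 0 \<le> G0 s n c \<and> G0 s n c \<le> 1" if "0 < m n s" for n c
    proof -
      interpret Q: prob_space "Q n s"
        using prob_space.risk_probability(4)[OF prob meas[OF s that] A1_bern[OF s that]
            A1_indep[OF s that] A2[OF s that]] .
      show ?thesis unfolding G1_def G0_def by simp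
    qed
    have cond: "cond1 (\<lambda>n. p n s) (\<lambda>n. m n s) (\<lambda>n. T0 n s) (G1 s) (G0 s) \<or> cond2 (\<lambda>n. p n s) (\<lambda>n.
        m n s) (\<lambda>n. T0 n s) (G1 s) (G0 s)"
      using C3_cond[OF s] unfolding Let_def G1_def[abs_def] G0_def[abs_def] .
    show ?thesis
      using stratum_variance_growth[where s = s and I = I and p = pp and P = "\<lambda>n. P n s" and q
          = "\<lambda>n. p n s" and m = "\<lambda>n. m n s" and ?T0.0 = "\<lambda>n. T0 n s" and ?G1.0 = "G1 s" and ?G0.0
          = "G0 s",
          OF str[OF s, unfolded J_def e_def[abs_def] K_def] P_treated[OF s, unfolded K_def]
              P_all[OF s, unfolded K_def] G A1_p[OF s] C3_size[OF s] cond]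
      unfolding \<sigma>2_def J_def e_def[abs_def] K_def .
  qed
  define H where "H n x = (\<Sum>s<S. stratum.L (J n s) (e n s) (K n s) risk_treated risk x) / sqrt
      (\<Sum>s<S. stratum.U (J n s) (e n s) (K n s) risk_treated risk x)" for n x
  define Y where "Y n \<omega> i = (if i \<in> I n then X n i \<omega> else (False, {}))" for n \<omega> i
  have Y: "Y n \<in> measurable (M n) (count_space UNIV)"
    and distr_Y: "distr (M n) (count_space UNIV) (Y n)
        = measure_pmf (Pi_pmf (I n) (False, {}) (pp n))" for n
  proof -
    have "prob_space.indep_vars (M n) (\<lambda>_. count_space UNIV) (\<lambda>i \<omega>. risk_type {..<m n (fst i)} (T0
        n (fst i)) ((case i of (s, j) \<Rightarrow> \<lambda>\<omega>. (Z n s j \<omega>, C1 n s j \<omega>, C0 n s j \<omega>)) \<omega>)) (I n)"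
      unfolding I_def by (rule prob_space.indep_vars_compose2[OF prob indep measurable_risk_type])
    also have "(\<lambda>i \<omega>. risk_type {..<m n (fst i)} (T0 n (fst i)) ((case i of (s, j) \<Rightarrow> \<lambda>\<omega>. (Z n s j
        \<omega>, C1 n s j \<omega>, C0 n s j \<omega>)) \<omega>)) = X n"
      by (auto simp: fun_eq_iff X_def case_prod_beta)
    finally have ind: "prob_space.indep_vars (M n) (\<lambda>_. count_space UNIV) (X n) (I n)" .
    have pm: "measure_pmf (pp n i) = distr (M n) (count_space UNIV) (X n i)" if "i \<in> I n" for i
      using that P_distr by (auto simp: I_def pp_def)
    have R: "X n i \<omega> \<in> UNIV \<times> Pow {..<K n (fst i)}" for i \<omega>
        by (auto simp: X_def risk_type_def K_def)
    show "Y n \<in> measurable (M n) (count_space UNIV)"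
      unfolding Y_def[abs_def] by (rule prob_space.distr_Pi_pmf(1)[OF prob fin_I ind pm _ R]) auto
    show "distr (M n) (count_space UNIV) (Y n) = measure_pmf (Pi_pmf (I n) (False, {}) (pp n))"
      unfolding Y_def[abs_def] by (rule prob_space.distr_Pi_pmf(2)[OF prob fin_I ind pm _ R]) auto
  qed
  have SLR: "(let W = (\<lambda>s j. obs_W (T1 n s j) (T0 n s j) (Z n s j \<omega>) (C1 n s j \<omega>) (C0 n s j \<omega>));
            Dl = (\<lambda>s j. obs_Delta (T1 n s j) (T0 n s j) (Z n s j \<omega>) (C1 n s j \<omega>) (C0 n s j \<omega>))
        in (\<Sum>s<S. lr_L {..<m n s} (T0 n s) (\<lambda>j. Z n s j \<omega>) (W s) (Dl s))
           / sqrt (\<Sum>s<S. lr_U {..<m n s} (T0 n s) (\<lambda>j. Z n s j \<omega>) (W s) (Dl s)))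
               = H n (Y n \<omega>)" for n \<omega>
  proof -
    have Y_type: "Y n \<omega> (s, j) = risk_type {..<m n s} (T0 n s) (Z n s j \<omega>, C1 n s j \<omega>, C0 n s j
        \<omega>)" if "s < S" "j < m n s" for s j
      using that by (simp add: Y_def I_def X_def)
    have eqs: "lr_L {..<m n s} (T0 n s) (\<lambda>j. Z n s j \<omega>)
        (\<lambda>j. obs_W (T0 n s j) (T0 n s j) (Z n s j \<omega>) (C1 n s j \<omega>) (C0 n s j \<omega>))
        (\<lambda>j. obs_Delta (T0 n s j) (T0 n s j) (Z n s j \<omega>) (C1 n s j \<omega>) (C0 n s j \<omega>))
      = stratum.L ({s} \<times> {..<m n s}) (\<lambda>i. event_index {..<m n s} (T0 n s) (snd i)) (nK {..<m n s}
          (T0 n s)) risk_treated risk (Y n \<omega>)"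
      "lr_U {..<m n s} (T0 n s) (\<lambda>j. Z n s j \<omega>)
        (\<lambda>j. obs_W (T0 n s j) (T0 n s j) (Z n s j \<omega>) (C1 n s j \<omega>) (C0 n s j \<omega>))
        (\<lambda>j. obs_Delta (T0 n s j) (T0 n s j) (Z n s j \<omega>) (C1 n s j \<omega>) (C0 n s j \<omega>))
      = stratum.U ({s} \<times> {..<m n s}) (\<lambda>i. event_index {..<m n s} (T0 n s) (snd i)) (nK {..<m n s}
          (T0 n s)) risk_treated risk (Y n \<omega>)" if "s < S" for s
      by (rule stratum_logrank[OF str[OF that, of n, unfolded J_def e_def[abs_def] K_def]
          nonneg(2)], rule Y_type[OF that], assumption)+
    show ?thesis
      unfolding Let_def H0 H_def J_def e_def[abs_def] K_def
      by (intro arg_cong2[where f = "(/)"] arg_cong[where f = sqrt] sum.cong refl eqs) auto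
  qed
  show ?thesis
    unfolding SLR
  proof (rule levy_continuity)
    have HY: "(\<lambda>\<omega>. H n (Y n \<omega>)) \<in> borel_measurable (M n)" for n
      by (rule measurable_compose[OF Y]) simp
    show "real_distribution (distr (M n) borel (\<lambda>\<omega>. H n (Y n \<omega>)))" for n
      using prob_space.real_distribution_distr[OF prob HY] .
    show "real_distribution std_normal_distribution" by (rule real_dist_normal_dist)
    fix t :: real
    have char: "char (distr (M n) borel (\<lambda>\<omega>. H n (Y n \<omega>))) t
        = measure_pmf.expectation (Pi_pmf (I n) (False, {}) (pp n)) (\<lambda>x. iexp (t * H n x))" for n
    proof -
      have "char (distr (M n) borel (\<lambda>\<omega>. H n (Y n \<omega>))) t = (CLINT \<omega>|M n. iexp (t * H n (Y n \<omega>)))"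
        unfolding char_def by (rule integral_distr[OF HY]) simp
      also have "\<dots> = (CLINT x|distr (M n) (count_space UNIV) (Y n). iexp (t * H n x))"
        by (rule integral_distr[OF Y, symmetric]) simp
      finally show ?thesis unfolding distr_Y .
    qed
    have card: "card (J n s) = m n s" for n s by (simp add: J_def)
    have JI: "J n s = {i \<in> I n. fst i = s}" if "s < S" for n s using that
        by (auto simp: J_def I_def)
    have "(\<lambda>n. measure_pmf.expectation (Pi_pmf (I n) (False, {}) (pp n)) (\<lambda>x. iexp (t * H n x))) \<longlonglongrightarrow>
        complex_of_real (exp (- (t\<^sup>2) / 2))"
    proof (rule tendsto_of_stratified_bound[OF S C3_size growth])
      show "0 \<le> \<sigma>2 n s" if "s < S" for n s unfolding \<sigma>2_def
          by (rule stratum.\<sigma>2_nonneg[OF str[OF that]])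
      fix n and \<delta> B :: real
      assume *: "0 < (\<Sum>s<S. \<sigma>2 n s)" "0 < \<delta>" "\<delta> \<le> 1/2" "0 \<le> B" "\<And>s. s < S \<Longrightarrow> 2
          + ln (real (m n s)) \<le> B"
      show "cmod (measure_pmf.expectation (Pi_pmf (I n) (False, {}) (pp n)) (\<lambda>x. iexp (t * H n x))
          - complex_of_real (exp (- (t\<^sup>2) / 2)))
        \<le> \<bar>t\<bar> ^ 3 * (B / sqrt (\<Sum>s<S. \<sigma>2 n s)) + t ^ 4 * (B / sqrt (\<Sum>s<S. \<sigma>2 n s))\<^sup>2
      + \<bar>t\<bar> * (2 * \<delta> + 2 * (\<Sum>s<S. sqrt (2 * sqrt (real (m n s))) / sqrt (\<Sum>s<S. \<sigma>2 n s)))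
      + 2 / \<delta> * (\<Sum>s<S. (6 * sqrt (real (m n s)) + sqrt (\<sigma>2 n s)) / (\<Sum>s<S. \<sigma>2 n s))"
        unfolding H_def card[symmetric, of n] \<sigma>2_def
      proof (rule fp.stratified_char_bound[where st = fst, OF str])
        show "fst i < S" if "i \<in> I n" for i using that by (auto simp: I_def)
        show "J n s = {i \<in> I n. fst i = s}" if "s < S" for s by (rule JI[OF that])
        show "0 < (\<Sum>s<S. stratum.\<sigma>2 (J n s) (P n s) (e n s) (K n s) risk_treated risk)"
          using *(1) unfolding \<sigma>2_def .
        show "2 + ln (real (card (J n s))) \<le> B" if "s < S" for s using *(5)[OF that]
            by (simp add: card)
      qed (use *(2-4) in auto)
    qed
    then show "(\<lambda>n. char (distr (M n) borel (\<lambda>\<omega>. H n (Y n \<omega>))) t) \<longlonglongrightarrow> char std_normal_distribution t"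
      unfolding char char_std_normal_distribution .
  qed
qed

end
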